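(* Let $M$ be a real-valued Lévy process associated to the semigroup $T_t$ on $\mathcal{S}(\mathbb{R})$, with characteristic function $\mathbb{E}e^{i\xi M(t)}=e^{t\eta(\xi)}$, $\xi\in\mathbb{R}$, and let $H$ be an inhomogeneous subordinator, independent of $M$, with Laplace transform $$\mathbb{E}e^{-p(H(t)-H(s))}=e^{-\int_s^tf(p,\tau)\,d\tau},\quad p\in\mathbb{R}^+,\ 0\le s\le t,\qquad f(p,\tau)=\int_0^\infty(1-e^{-zp})\,\nu_\tau(dz).$$ Then the additive process $M(H(t))$ has time-dependent generator $$\mathcal{L}_th(x)=\int_0^\infty\big(T_zh(x)-h(x)\big)\,\nu_t(dz),\qquad h\in\mathcal{S}(\mathbb{R}).$$
   Context: An additive process is a stochastically continuous process started at $0$ a.s. with independent (not necessarily stationary) increments. An inhomogeneous subordinator is a non-decreasing additive process; $\nu_\tau$ denotes its time-dependent Lévy measure on $(0,\infty)$, and $f(\cdot,\tau)$ is a Bernstein function for each $\tau$. The semigroup of $M$ is $T_zh(x)=\mathbb{E}\,h(x+M(z))$. For an additive process $X$, the propagator is $T^X_{s,t}h(x)=\mathbb{E}\,h(x+X(t)-X(s))$, $0\le s\le t$, and the time-dependent generator is $\lim_{\epsilon\to0^+}\frac{T^X_{t,t+\epsilon}h-h}{\epsilon}$, the limit being in the sup-norm. $\mathcal{S}(\mathbb{R})$ is the Schwartz space.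
   Formalization: The generator formula is asserted at every t where f(p,·) is right-continuous for all p ≥ 0, and for almost every t in general, because changing ν_τ at a single time τ alters the formula there but not the process. *)

theory Defs
  imports "HOL-Probability.Probability"
begin

text \<open>
  Processes are families \<open>X :: real \<Rightarrow> 'a \<Rightarrow> real\<close> indexed by \<open>t \<ge> 0\<close>; the values at negative
  times are irrelevant.
\<close>

context prob_space
begin

definition independent_increments :: "(real \<Rightarrow> 'a \<Rightarrow> real) \<Rightarrow> bool" where
  "independent_increments X \<longleftrightarrow>
     (\<forall>(n::nat) (t::nat \<Rightarrow> real). 0 \<le> t 0 \<longrightarrow> (\<forall>i<n. t i < t (Suc i)) \<longrightarrow>
        indep_vars (\<lambda>_. borel) (\<lambda>i \<omega>. X (t (Suc i)) \<omega> - X (t i) \<omega>) {..<n})"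

definition stationary_increments :: "(real \<Rightarrow> 'a \<Rightarrow> real) \<Rightarrow> bool" where
  "stationary_increments X \<longleftrightarrow>
     (\<forall>s t. 0 \<le> s \<longrightarrow> s \<le> t \<longrightarrow>
        distr M borel (\<lambda>\<omega>. X t \<omega> - X s \<omega>) = distr M borel (X (t - s)))"

definition stochastically_continuous :: "(real \<Rightarrow> 'a \<Rightarrow> real) \<Rightarrow> bool" where
  "stochastically_continuous X \<longleftrightarrow>
     (\<forall>t\<ge>0. \<forall>\<epsilon>>0.
        ((\<lambda>s. prob {\<omega> \<in> space M. \<bar>X s \<omega> - X t \<omega>\<bar> > \<epsilon>}) \<longlongrightarrow> 0) (at t within {0..}))"

definition additive_process :: "(real \<Rightarrow> 'a \<Rightarrow> real) \<Rightarrow> bool" where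
  "additive_process X \<longleftrightarrow>
     (\<forall>t\<ge>0. random_variable borel (X t)) \<and>
     (AE \<omega> in M. X 0 \<omega> = 0) \<and>
     stochastically_continuous X \<and>
     independent_increments X"

definition cadlag_paths :: "(real \<Rightarrow> 'a \<Rightarrow> real) \<Rightarrow> bool" where
  "cadlag_paths X \<longleftrightarrow>
     (AE \<omega> in M. \<forall>t\<ge>0. continuous (at_right t) (\<lambda>s. X s \<omega>) \<and>
                        (t > 0 \<longrightarrow> (\<exists>l. ((\<lambda>s. X s \<omega>) \<longlongrightarrow> l) (at_left t))))"

text \<open>
  Path regularity is part of the notion of a Levy process: random time changes of a process are
  not determined by its finite-dimensional distributions alone.
\<close>

definition levy_process :: "(real \<Rightarrow> 'a \<Rightarrow> real) \<Rightarrow> bool" where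
  "levy_process X \<longleftrightarrow> additive_process X \<and> stationary_increments X \<and> cadlag_paths X"

definition inhomogeneous_subordinator :: "(real \<Rightarrow> 'a \<Rightarrow> real) \<Rightarrow> bool" where
  "inhomogeneous_subordinator X \<longleftrightarrow>
     additive_process X \<and>
     (AE \<omega> in M. \<forall>s t. 0 \<le> s \<longrightarrow> s \<le> t \<longrightarrow> X s \<omega> \<le> X t \<omega>)"

definition independent_processes ::
    "(real \<Rightarrow> 'a \<Rightarrow> real) \<Rightarrow> (real \<Rightarrow> 'a \<Rightarrow> real) \<Rightarrow> bool" where
  "independent_processes X Y \<longleftrightarrow>
     indep_var (PiM {0..} (\<lambda>_. borel)) (\<lambda>\<omega>. \<lambda>t\<in>{0..}. X t \<omega>)
               (PiM {0..} (\<lambda>_. borel)) (\<lambda>\<omega>. \<lambda>t\<in>{0..}. Y t \<omega>)"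

definition semigroup_of ::
    "(real \<Rightarrow> 'a \<Rightarrow> real) \<Rightarrow> real \<Rightarrow> (real \<Rightarrow> complex) \<Rightarrow> real \<Rightarrow> complex" where
  "semigroup_of X z h x = expectation (\<lambda>\<omega>. h (x + X z \<omega>))"

definition propagator ::
    "(real \<Rightarrow> 'a \<Rightarrow> real) \<Rightarrow> real \<Rightarrow> real \<Rightarrow> (real \<Rightarrow> complex) \<Rightarrow> real \<Rightarrow> complex" where
  "propagator X s t h x = expectation (\<lambda>\<omega>. h (x + X t \<omega> - X s \<omega>))"

text \<open>
  \<open>has_generator_at X t h g\<close>: the time-dependent generator of \<open>X\<close> at time \<open>t\<close> is defined at \<open>h\<close>
  (the limit in sup-norm exists) and maps it to \<open>g\<close>.
\<close>

definition has_generator_at ::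
    "(real \<Rightarrow> 'a \<Rightarrow> real) \<Rightarrow> real \<Rightarrow> (real \<Rightarrow> complex) \<Rightarrow> (real \<Rightarrow> complex) \<Rightarrow> bool" where
  "has_generator_at X t h g \<longleftrightarrow>
     uniform_limit UNIV (\<lambda>\<epsilon> x. (propagator X t (t + \<epsilon>) h x - h x) /\<^sub>R \<epsilon>) g (at_right 0)"

end

definition iter_deriv :: "nat \<Rightarrow> (real \<Rightarrow> complex) \<Rightarrow> real \<Rightarrow> complex" where
  "iter_deriv n = (\<lambda>g x. vector_derivative g (at x)) ^^ n"

definition schwartz :: "(real \<Rightarrow> complex) set" where
  "schwartz = {h. (\<forall>n x. iter_deriv n h differentiable at x) \<and>
                  (\<forall>m n. bounded (range (\<lambda>x. x ^ m *\<^sub>R iter_deriv n h x)))}"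

text \<open>Levy measures of (driftless) subordinators, as Borel measures on the line carried by the
  positive half-line.\<close>

definition subordinator_levy_measure :: "real measure \<Rightarrow> bool" where
  "subordinator_levy_measure \<nu> \<longleftrightarrow>
     sets \<nu> = sets borel \<and> emeasure \<nu> {..0} = 0 \<and> (\<integral>\<^sup>+z. ennreal (min 1 z) \<partial>\<nu>) < \<infinity>"

end

theory Submission
  imports Defs
begin

text \<open>
  Conditioning on the time change is done on a right-approximating grid: by independence and right-continuity
  of the paths of \<open>M\<close>, \<open>E (\<Prod>\<^sub>i g\<^sub>i (\<Delta>\<^sub>i MH)) = E (\<Prod>\<^sub>i G\<^sub>i (\<Delta>\<^sub>i H))\<close> with \<open>G\<^sub>i z = E (g\<^sub>i (M z))\<close>. This reduces
  both the independence of the increments of \<open>MH\<close> and the difference quotients of its propagator to \<open>H\<close>.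

  For the generator, the image measures of \<open>\<Delta>H / \<epsilon>\<close> have Laplace exponents converging to those of \<open>\<nu>\<^sub>t\<close>.
  Weighted by \<open>1 - e\<^sup>-\<^sup>z\<close> and transported by \<open>y = e\<^sup>-\<^sup>z\<close> they are finite measures on \<open>[0, 1]\<close> whose moments
  converge, so Bernstein approximation gives convergence of integrals, uniformly over classes of functions
  that are bounded, Lipschitz and \<open>O(z)\<close> at \<open>0\<close> with common constants. The functions
  \<open>z \<mapsto> T\<^sub>z h x - h x\<close>, with parameter \<open>x\<close>, form such a class: \<open>M\<close> satisfies \<open>E (min 1 (M\<^sub>z)\<^sup>2) = O(z)\<close> and
  \<open>E (sin M\<^sub>z) = O(z)\<close>, and \<open>h (x + y) - h x = h' x sin y + O(min 1 y\<^sup>2)\<close> uniformly in \<open>x\<close>.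
  Only integer arguments of the Laplace exponents enter, which is why Lebesgue's differentiation theorem
  applied to countably many functions suffices for almost every \<open>t\<close>.
\<close>

subsection \<open>Right-sided Lebesgue differentiation\<close>

text \<open>Two obstacles shape the proof. First, \<open>\<nu> t\<close> may be infinite near 0 and
  the generator asks for a limit uniform in \<open>x\<close>, so weak convergence tested on one
  integrand at a time is too little. The degree in the Bernstein step depends only on the common
  bounds, which leaves finitely many moments for the whole class of integrands. After the change of
  variable, mass at \<open>y = 1\<close> would mean a drift and mass at \<open>y = 0\<close>
  killing. The limit measure has neither, so integrands may be cut off near both ends, where the
  division by \<open>1 - y\<close> or the missing limit at infinity would spoil the Lipschitz
  property. Second, \<open>M\<close> may have no moments and \<open>\<eta>\<close> is given only
  through \<open>exp (t * \<eta>)\<close>. Hence the bounded \<open>sin\<close> stands in for the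
  first-order term, and a bound for \<open>\<eta>\<close> on [0, 1] is extracted from stochastic
  continuity. Finally, the law of \<open>H\<close> determines each \<open>f p\<close> only up to a
  null set of times. A statement at one fixed time therefore needs a regularity condition there,
  here right-continuity.\<close>

lemma set_integral_nonneg_disjoint_UN:
  fixes f :: "'b \<Rightarrow> real"
  assumes C: "countable C" and disj: "disjoint_family_on I C"
    and sets: "\<And>i. i \<in> C \<Longrightarrow> I i \<in> sets N"
    and int: "set_integrable N (\<Union>i\<in>C. I i) f"
    and nonneg: "\<And>i. i \<in> C \<Longrightarrow> 0 \<le> (LINT x:I i|N. f x)"
  shows "0 \<le> (LINT x:(\<Union>i\<in>C. I i)|N. f x)"
proof -
  \<comment> \<open>Indices outside the range of \<open>to_nat_on C\<close> get the empty set, so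
    finite and infinite \<open>C\<close> are handled alike and no \<open>I i\<close> occurs
    twice.\<close>
  define A where "A n = (if n \<in> to_nat_on C ` C then I (from_nat_into C n) else {})" for n
  have A_eq: "A (to_nat_on C i) = I i" if "i \<in> C" for i
    using that C by (auto simp: A_def)
  have UN: "(\<Union>n. A n) = (\<Union>i\<in>C. I i)"
  proof safe
    fix x n assume "x \<in> A n"
    then show "x \<in> (\<Union>i\<in>C. I i)"
      using C by (auto simp: A_def split: if_splits)
  next
    fix x i assume "i \<in> C" "x \<in> I i"
    then show "x \<in> (\<Union>n. A n)"
      using A_eq by blast
  qed
  have disjA: "A m \<inter> A n = {}" if "m \<noteq> n" for m n
    using that disj C by (fastforce simp: A_def disjoint_family_on_def split: if_splits)
  have setsA: "A n \<in> sets N" for n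
    using sets C by (auto simp: A_def)
  have intA: "set_integrable N (A n) f" for n
    by (rule set_integrable_subset[OF int setsA]) (use UN in blast)
  \<comment> \<open>Finite additivity gives the sign on each partial union; continuity along
    increasing sets carries it to the limit, although \<open>f\<close> itself has no sign.\<close>
  define B where "B n = (\<Union>i<n. A i)" for n :: nat
  have setsB: "B n \<in> sets N" for n
    using setsA by (auto simp: B_def)
  have B_nonneg: "0 \<le> (LINT x:B n|N. f x)" for n
  proof -
    have "(LINT x:B n|N. f x) = (\<Sum>i<n. (LINT x:A i|N. f x))"
      unfolding B_def by (rule set_integral_finite_Union) (use disjA intA in \<open>auto simp: disjoint_family_on_def setsA\<close>)
    also have "\<dots> \<ge> 0"
      using nonneg C by (intro sum_nonneg) (auto simp: A_def set_lebesgue_integral_def)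
    finally show ?thesis .
  qed
  have UN_B: "(\<Union>n. B n) = (\<Union>n. A n)"
    by (auto simp: B_def)
  have "(\<lambda>n. LINT x:B n|N. f x) \<longlonglongrightarrow> (LINT x:(\<Union>n. B n)|N. f x)"
  proof (rule set_integral_cont_up)
    show "incseq B"
      by (force simp: B_def incseq_def)
    show "set_integrable N (\<Union> (range B)) f"
      using int UN UN_B by simp
  qed (use setsB in auto)
  then have "0 \<le> (LINT x:(\<Union>n. B n)|N. f x)"
    by (rule LIMSEQ_le_const) (use B_nonneg in auto)
  then show ?thesis
    unfolding UN_B UN .
qed

text \<open>Vitali covering takes the place of a maximal inequality. Disjoint intervals
  \<open>[t, t + e]\<close> with average above \<beta>, chosen inside an open set barely larger than
  the set \<open>D\<close> where \<open>g < \<alpha>\<close>, cover \<open>?S\<close> up to a null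
  set. On their union \<open>J\<close> the integral of \<open>g - \<beta>\<close> is nonnegative,
  yet \<open>g - \<beta> < \<alpha> - \<beta>\<close> on \<open>J \<inter> D\<close> and the
  remainder of \<open>J\<close> has small weight. This forces \<open>J \<inter> D\<close> to be
  small.\<close>

lemma negligible_upper_derivative:
  fixes g :: "real \<Rightarrow> real"
  assumes g: "integrable lborel g" and ab: "\<alpha> < \<beta>"
  shows "negligible {t. g t < \<alpha> \<and> \<bar>t\<bar> \<le> c \<and>
    (\<forall>d>0. \<exists>e. 0 < e \<and> e < d \<and> \<beta> * e < (LINT \<tau>:{t..t+e}|lborel. g \<tau>))}"
    (is "negligible ?S")
  unfolding negligible_outer_le
proof (intro allI impI)
  fix d :: real assume d: "0 < d"
  have [measurable]: "g \<in> borel_measurable borel"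
    using g by auto
  \<comment> \<open>\<open>B\<close> contains \<open>D\<close> with a margin and has finite measure.
    The weight \<open>w\<close> dominates both 1 on \<open>B\<close> and
    \<open>\<bar>g\<bar>\<close>, so one outer approximation controls lengths and integrals of
    \<open>g\<close> together.\<close>
  define B where "B = {- c - 1<..<c + 1}"
  define D where "D = {t. g t < \<alpha> \<and> \<bar>t\<bar> \<le> c}"
  define w where "w t = indicator B t + \<bar>g t\<bar>" for t
  \<comment> \<open>Solves \<open>(1 + \<bar>\<beta>\<bar>) * \<delta> = (\<beta> - \<alpha>) *
    d\<close>, so that the final division by \<open>\<beta> - \<alpha>\<close> leaves exactly
    \<open>d\<close>.\<close>
  define \<delta> where "\<delta> = d * (\<beta> - \<alpha>) / (1 + \<bar>\<beta>\<bar>)"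
  have \<delta>: "\<delta> > 0"
    using d ab by (simp add: \<delta>_def)
  have D_sets [measurable]: "D \<in> sets borel" and B_sets [measurable]: "B \<in> sets borel"
    by (auto simp: D_def B_def)
  have B_fin: "emeasure lborel B < \<infinity>"
    unfolding B_def by (intro emeasure_bounded_finite) auto
  have w: "integrable lborel w"
    unfolding w_def using g B_fin by (intro Bochner_Integration.integrable_add integrable_real_indicator) auto
  have w_nonneg: "0 \<le> w t" for t
    by (simp add: w_def)
  have [measurable]: "w \<in> borel_measurable borel"
    using w by auto
  define N where "N = density lborel (\<lambda>t. ennreal (w t))"
  have N_sets: "sets N = sets borel"
    by (simp add: N_def)
  have fin: "emeasure N (space N) \<noteq> \<infinity>"
    using w w_nonneg by (simp add: N_def emeasure_density nn_integral_eq_integral)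
  have D_fin: "emeasure N D \<noteq> \<infinity>"
    using fin emeasure_space[of N D] by (auto simp: top_unique)
  obtain U where U: "D \<subseteq> U" "open U" "emeasure N U < emeasure N D + ennreal \<delta>"
  proof -
    have "(INF U\<in>{U. D \<subseteq> U \<and> open U}. emeasure N U) < emeasure N D + ennreal \<delta>"
    proof -
      obtain r where "emeasure N D = ennreal r" "0 \<le> r"
        using D_fin by (cases "emeasure N D") auto
      then have "emeasure N D < emeasure N D + ennreal \<delta>"
        using \<delta> by (simp add: ennreal_less_iff flip: ennreal_plus)
      then show ?thesis
        using outer_regular[OF N_sets fin, of D] by simp
    qed
    then show ?thesis
      using that by (auto simp: INF_less_iff)
  qed
  define V where "V = U \<inter> B"
  have V: "D \<subseteq> V" "open V" "V \<subseteq> B"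
    using U by (auto simp: V_def B_def D_def)
  have [measurable]: "V \<in> sets borel"
    using V by simp
  have "emeasure N V < emeasure N D + ennreal \<delta>"
    using U(3) emeasure_mono[of V U N] U(2) by (auto simp: V_def N_sets intro: le_less_trans)
  then have "emeasure N (V - D) < ennreal \<delta>"
    using V D_fin by (subst emeasure_Diff, simp_all add: N_sets)
      (subst minus_less_iff_ennreal, auto simp: less_top add.commute N_sets intro!: emeasure_mono)
  moreover have "emeasure N (V - D) = (\<integral>\<^sup>+t. ennreal (indicator (V - D) t * w t) \<partial>lborel)"
    unfolding N_def by (subst emeasure_density) (auto intro!: nn_integral_cong simp: indicator_def)
  ultimately have "(\<integral>\<^sup>+t. ennreal (indicator (V - D) t * w t) \<partial>lborel) < ennreal \<delta>"
    by simp
  moreover have int_VD: "integrable lborel (\<lambda>t. indicator (V - D) t * w t)"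
    using integrable_mult_indicator[OF _ w, of "V - D"] by simp
  ultimately have VD: "(LINT t|lborel. indicator (V - D) t * w t) \<le> \<delta>"
    using \<delta> w_nonneg by (subst (asm) nn_integral_eq_integral) (auto simp: ennreal_less_iff)
  \<comment> \<open>A pair is (left end, length). Midpoint and half-length present the interval as a
    closed ball; \<open>t\<close> is a boundary point of it, which the covering theorem admits and
    which makes one-sided intervals possible.\<close>
  define K where "K = {(t, e). 0 < e \<and> {t..t+e} \<subseteq> V \<and> \<beta> * e < (LINT \<tau>:{t..t+e}|lborel. g \<tau>)}"
  have cball_eq: "cball (t + e / 2) (e / 2) = {t..t+e}" for t e :: real
    by (simp add: cball_eq_atLeastAtMost)
  obtain C where C: "countable C" "C \<subseteq> K"
     "pairwise (\<lambda>i j. disjnt (cball (fst i + snd i / 2) (snd i / 2)) (cball (fst j + snd j / 2) (snd j / 2))) C"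
     "negligible (?S - (\<Union>i\<in>C. cball (fst i + snd i / 2) (snd i / 2)))"
  proof (rule Vitali_covering_theorem_cballs[of K "\<lambda>i. snd i / 2" ?S "\<lambda>i. fst i + snd i / 2"])
    show "0 < snd i / 2" if "i \<in> K" for i
      using that by (auto simp: K_def)
    fix x r :: real assume x: "x \<in> ?S" and r: "0 < r"
    then have "x \<in> V"
      using V by (auto simp: D_def)
    then obtain s where s: "0 < s" "ball x s \<subseteq> V"
      using V(2) by (auto simp: open_contains_ball)
    obtain e where e: "0 < e" "e < min s r" "\<beta> * e < (LINT \<tau>:{x..x+e}|lborel. g \<tau>)"
      using x r s by (auto dest!: spec[of _ "min s r"])
    have "{x..x+e} \<subseteq> ball x s"
      using e by (auto simp: dist_real_def)
    then have "(x, e) \<in> K"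
      using e s by (auto simp: K_def)
    then show "\<exists>i. i \<in> K \<and> x \<in> cball (fst i + snd i / 2) (snd i / 2) \<and> snd i / 2 < r"
      using e by (intro exI[of _ "(x, e)"]) (auto simp: cball_eq)
  qed auto
  define I where "I i = {fst i..fst i + snd i :: real}" for i
  define J where "J = (\<Union>i\<in>C. I i)"
  have CI: "cball (fst i + snd i / 2) (snd i / 2) = I i" for i :: "real \<times> real"
    by (simp add: I_def cball_eq)
  have J: "J \<subseteq> V"
  proof -
    have "I i \<subseteq> V" if "i \<in> C" for i
      using subsetD[OF C(2) that] by (simp add: K_def I_def split_beta)
    then show ?thesis
      by (auto simp: J_def)
  qed
  have [measurable]: "J \<in> sets borel"
    unfolding J_def using C(1) by (intro sets.countable_UN') (auto simp: I_def)
  have JD_fin: "emeasure lborel (J \<inter> D) < \<infinity>"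
  proof -
    have "emeasure lborel (J \<inter> D) \<le> emeasure lborel B"
      using J V by (intro emeasure_mono) auto
    then show ?thesis
      using B_fin by simp
  qed
  \<comment> \<open>Every \<open>I i\<close> lies in \<open>V\<close> and thus in \<open>B\<close>,
    where \<open>k\<close> is \<open>g - \<beta>\<close>; the indicator makes it integrable over the
    line.\<close>
  define k where "k t = g t - \<beta> * indicator B t" for t
  have k: "integrable lborel k"
    unfolding k_def using g B_fin by (intro Bochner_Integration.integrable_diff integrable_mult_right integrable_real_indicator) auto
  have "0 \<le> (LINT t:(\<Union>i\<in>C. I i)|lborel. k t)"
  proof (rule set_integral_nonneg_disjoint_UN)
    show "disjoint_family_on I C"
      using C(3) by (auto simp: disjoint_family_on_def pairwise_def CI disjnt_def)
    show "set_integrable lborel (\<Union> (I ` C)) k"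
      using k \<open>J \<in> sets borel\<close> unfolding J_def set_integrable_def by (intro integrable_mult_indicator) auto
    fix i assume i: "i \<in> C"
    then have iK: "0 < snd i" "I i \<subseteq> V" "\<beta> * snd i < (LINT \<tau>:I i|lborel. g \<tau>)"
      using subsetD[OF C(2) i] by (simp_all add: K_def I_def split_beta)
    have gi: "set_integrable lborel (I i) g"
      using g unfolding set_integrable_def I_def by (intro integrable_mult_indicator) auto
    have \<beta>i: "set_integrable lborel (I i) (\<lambda>_. \<beta>)"
      unfolding set_integrable_def I_def by (intro integrable_scaleR_left integrable_real_indicator) (use iK(1) in auto)
    have "(LINT t:I i|lborel. k t) = (LINT t:I i|lborel. g t - \<beta>)"
      using iK V by (intro set_lebesgue_integral_cong) (auto simp: k_def I_def indicator_def)
    also have "\<dots> = (LINT t:I i|lborel. g t) - (LINT t:I i|lborel. \<beta>)"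
      using gi \<beta>i by (rule set_integral_diff)
    also have "(LINT t:I i|lborel. \<beta>) = \<beta> * snd i"
      using iK by (simp add: I_def set_integral_const)
    finally show "0 \<le> (LINT t:I i|lborel. k t)"
      using iK by simp
  qed (use C(1) in \<open>auto simp: I_def\<close>)
  then have "0 \<le> (LINT t|lborel. indicator J t * k t)"
    by (simp add: J_def set_lebesgue_integral_def)
  \<comment> \<open>Pointwise split of \<open>J\<close>: on \<open>J \<inter> D\<close> use
    \<open>g < \<alpha>\<close>; the rest lies in \<open>V - D\<close>, where
    \<open>(1 + \<bar>\<beta>\<bar>) * w\<close> dominates.\<close>
  also have "\<dots> \<le> (LINT t|lborel. (\<alpha> - \<beta>) * indicator (J \<inter> D) t + (1 + \<bar>\<beta>\<bar>) * (indicator (V - D) t * w t))"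
  proof (rule integral_mono)
    show "integrable lborel (\<lambda>t. indicator J t * k t)"
      using integrable_mult_indicator[OF _ k, of J] by simp
    show "integrable lborel (\<lambda>t. (\<alpha> - \<beta>) * indicator (J \<inter> D) t + (1 + \<bar>\<beta>\<bar>) * (indicator (V - D) t * w t))"
      using JD_fin int_VD by (intro Bochner_Integration.integrable_add integrable_mult_right integrable_real_indicator) auto
    fix t :: real
    have "g t - \<beta> \<le> (1 + \<bar>\<beta>\<bar>) * (1 + \<bar>g t\<bar>)"
    proof -
      have "g t - \<beta> \<le> \<bar>g t\<bar> + \<bar>\<beta>\<bar>"
        by linarith
      also have "\<dots> \<le> (1 + \<bar>\<beta>\<bar>) * (1 + \<bar>g t\<bar>)"
        by (simp add: distrib_left distrib_right)
      finally show ?thesis .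
    qed
    then show "indicator J t * k t \<le> (\<alpha> - \<beta>) * indicator (J \<inter> D) t + (1 + \<bar>\<beta>\<bar>) * (indicator (V - D) t * w t)"
      using J V w_nonneg[of t] by (auto simp: k_def indicator_def w_def D_def split: if_splits)
  qed
  also have "\<dots> = (\<alpha> - \<beta>) * measure lborel (J \<inter> D) + (1 + \<bar>\<beta>\<bar>) * (LINT t|lborel. indicator (V - D) t * w t)"
    using JD_fin int_VD by (subst Bochner_Integration.integral_add) (auto intro!: integrable_mult_right integrable_real_indicator)
  also have "\<dots> \<le> (\<alpha> - \<beta>) * measure lborel (J \<inter> D) + (1 + \<bar>\<beta>\<bar>) * \<delta>"
    using VD by (intro add_left_mono mult_left_mono) auto
  finally have "measure lborel (J \<inter> D) \<le> d"
  proof -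
    assume "0 \<le> (\<alpha> - \<beta>) * measure lborel (J \<inter> D) + (1 + \<bar>\<beta>\<bar>) * \<delta>"
    moreover have "(1 + \<bar>\<beta>\<bar>) * \<delta> = (\<beta> - \<alpha>) * d"
      by (simp add: \<delta>_def)
    ultimately have "(\<beta> - \<alpha>) * measure lborel (J \<inter> D) \<le> (\<beta> - \<alpha>) * d"
      by (simp add: algebra_simps)
    then show ?thesis
      using ab by simp
  qed
  show "\<exists>T. ?S \<subseteq> T \<and> T \<in> lmeasurable \<and> measure lebesgue T \<le> d"
  proof (intro exI conjI)
    have neg: "negligible (?S - J)"
      using C(4) by (simp add: CI J_def)
    have JD: "J \<inter> D \<in> lmeasurable"
      using JD_fin by (intro fmeasurableI) auto
    show "?S \<subseteq> (J \<inter> D) \<union> (?S - J)"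
      unfolding D_def by blast
    show "(J \<inter> D) \<union> (?S - J) \<in> lmeasurable"
      using JD neg by (intro fmeasurable.Un) (auto simp: negligible_imp_measurable)
    have "measure lebesgue ((J \<inter> D) \<union> (?S - J)) \<le> measure lebesgue (J \<inter> D) + measure lebesgue (?S - J)"
      using JD neg by (intro measure_Un_le) (auto simp: negligible_imp_sets fmeasurableD)
    also have "\<dots> \<le> d"
      using \<open>measure lborel (J \<inter> D) \<le> d\<close> neg by (simp add: negligible_imp_measure0)
    finally show "measure lebesgue ((J \<inter> D) \<union> (?S - J)) \<le> d" .
  qed
qed

text \<open>If the averages at \<open>t\<close> do not eventually stay below some bound above
  \<open>g t\<close>, rational \<alpha> < \<beta> fit in between and put \<open>t\<close> into one
  of countably many negligible sets. The lower bound is the upper bound for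
  \<open>- g\<close>.\<close>

theorem AE_tendsto_right_average:
  fixes g :: "real \<Rightarrow> real"
  assumes g: "integrable lborel g"
  shows "AE t in lborel. ((\<lambda>e. (LINT \<tau>:{t..t+e}|lborel. g \<tau>) / e) \<longlongrightarrow> g t) (at_right 0)"
proof -
  define S where "S f \<alpha> \<beta> c = {t. f t < \<alpha> \<and> \<bar>t\<bar> \<le> c \<and>
    (\<forall>d>0. \<exists>e. 0 < e \<and> e < d \<and> \<beta> * e < (LINT \<tau>:{t..t+e}|lborel. f \<tau>))}"
    for f :: "real \<Rightarrow> real" and \<alpha> \<beta> c :: real
  have upper: "\<forall>\<^sub>F e in at_right 0. (LINT \<tau>:{t..t+e}|lborel. f \<tau>) / e < b"
    if t: "\<And>\<alpha> \<beta> n. \<alpha> \<in> \<rat> \<Longrightarrow> \<beta> \<in> \<rat> \<Longrightarrow> \<alpha> < \<beta> \<Longrightarrow> t \<notin> S f \<alpha> \<beta> (real n)" and b: "f t < b"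
    for f t b
  proof -
    obtain \<beta> where \<beta>: "\<beta> \<in> \<rat>" "f t < \<beta>" "\<beta> < b"
      using Rats_dense_in_real[OF b] by auto
    obtain \<alpha> where \<alpha>: "\<alpha> \<in> \<rat>" "f t < \<alpha>" "\<alpha> < \<beta>"
      using Rats_dense_in_real[OF \<beta>(2)] by auto
    have "t \<notin> S f \<alpha> \<beta> (real (nat \<lceil>\<bar>t\<bar>\<rceil>))"
      using \<alpha> \<beta> by (intro t)
    then obtain d where d: "d > 0" "\<And>e. 0 < e \<Longrightarrow> e < d \<Longrightarrow> (LINT \<tau>:{t..t+e}|lborel. f \<tau>) \<le> \<beta> * e"
    proof -
      have "f t < \<alpha>" "\<bar>t\<bar> \<le> real (nat \<lceil>\<bar>t\<bar>\<rceil>)"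
        using \<alpha> by (auto simp: real_nat_ceiling_ge)
      with \<open>t \<notin> S f \<alpha> \<beta> _\<close> show ?thesis
        using that unfolding S_def mem_Collect_eq by (meson not_less)
    qed
    show ?thesis
      unfolding eventually_at_right_field
    proof (intro exI conjI allI impI)
      fix e assume "0 < e" "e < d"
      with d have "(LINT \<tau>:{t..t+e}|lborel. f \<tau>) / e \<le> \<beta>"
        by (simp add: divide_le_eq)
      with \<beta> show "(LINT \<tau>:{t..t+e}|lborel. f \<tau>) / e < b"
        by simp
    qed (fact d)
  qed
  define E where "E f = (\<Union>(\<alpha>, \<beta>, n)\<in>{(\<alpha>, \<beta>, n :: nat). \<alpha> \<in> \<rat> \<and> \<beta> \<in> \<rat> \<and> \<alpha> < \<beta>}. S f \<alpha> \<beta> (real n))" for f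
  have E: "negligible (E f)" if "integrable lborel f" for f
    unfolding E_def
  proof (rule negligible_countable_Union)
    have "{(\<alpha>, \<beta>, n :: nat). \<alpha> \<in> \<rat> \<and> \<beta> \<in> \<rat> \<and> \<alpha> < (\<beta> :: real)} \<subseteq> \<rat> \<times> \<rat> \<times> UNIV"
      by auto
    then have "countable {(\<alpha>, \<beta>, n :: nat). \<alpha> \<in> \<rat> \<and> \<beta> \<in> \<rat> \<and> \<alpha> < (\<beta> :: real)}"
      by (rule countable_subset) (intro countable_SIGMA countable_rat, auto)
    then show "countable ((\<lambda>(\<alpha>, \<beta>, n). S f \<alpha> \<beta> (real n)) ` {(\<alpha>, \<beta>, n :: nat). \<alpha> \<in> \<rat> \<and> \<beta> \<in> \<rat> \<and> \<alpha> < \<beta>})"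
      by simp
  qed (use negligible_upper_derivative[OF that] in \<open>auto simp: S_def\<close>)
  have "negligible (E g \<union> E (\<lambda>x. - g x))"
    using E g by simp
  then have "AE t in lebesgue. t \<notin> E g \<union> E (\<lambda>x. - g x)"
    by (intro AE_not_in) (simp add: negligible_iff_null_sets)
  then have "AE t in lborel. t \<notin> E g \<union> E (\<lambda>x. - g x)"
    by (simp add: AE_completion_iff)
  then show ?thesis
  proof eventually_elim
    case (elim t)
    show ?case
    proof (rule order_tendstoI)
      fix b assume "g t < b"
      then show "\<forall>\<^sub>F e in at_right 0. (LINT \<tau>:{t..t+e}|lborel. g \<tau>) / e < b"
        using elim by (intro upper) (auto simp: E_def)
    next
      fix b assume "b < g t"
      then have "\<forall>\<^sub>F e in at_right 0. (LINT \<tau>:{t..t+e}|lborel. - g \<tau>) / e < - b"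
        using elim by (intro upper) (auto simp: E_def)
      then show "\<forall>\<^sub>F e in at_right 0. b < (LINT \<tau>:{t..t+e}|lborel. g \<tau>) / e"
        by eventually_elim (simp add: set_lebesgue_integral_def)
    qed
  qed
qed

subsection \<open>Convergence of integrals from convergence of moments\<close>

text \<open>A Chebyshev argument: \<open>u \<le> a + u\<^sup>2 / a\<close> trades the mean distance
  from \<open>x\<close> to \<open>k / n\<close> for the variance of the binomial law, at most
  \<open>1 / n\<close> after rescaling. The free parameter \<open>a\<close> replaces a square root
  and is chosen by the caller.\<close>

lemma Bernstein_approx_Lipschitz:
  fixes f :: "real \<Rightarrow> 'b :: real_normed_vector"
  assumes lip: "\<And>y. y \<in> {0..1} \<Longrightarrow> norm (f x - f y) \<le> L * \<bar>x - y\<bar>"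
    and x: "x \<in> {0..1}" and n: "n > 0" and a: "a > 0" and L: "L \<ge> 0"
  shows "norm (f x - (\<Sum>k\<le>n. Bernstein n k x *\<^sub>R f (k / n))) \<le> L * (a + 1 / (real n * a))"
proof -
  have B0: "0 \<le> Bernstein n k x" for k
    using x by (intro Bernstein_nonneg) auto
  \<comment> \<open>The square is rewritten through \<open>k * (k - 1)\<close>, \<open>k\<close> and
    1, whose Bernstein sums have known values.\<close>
  have "(\<Sum>k\<le>n. (k - n * x)\<^sup>2 * Bernstein n k x) =
      (\<Sum>k\<le>n. real k * (real k - 1) * Bernstein n k x + (1 - 2 * n * x) * (real k * Bernstein n k x) + (n * x)\<^sup>2 * Bernstein n k x)"
    by (intro sum.cong) (auto simp: power2_eq_square algebra_simps)
  also have "\<dots> = real n * (real n - 1) * x\<^sup>2 + (1 - 2 * n * x) * (n * x) + (n * x)\<^sup>2"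
    by (simp only: sum.distrib sum_kk_Bernstein sum_k_Bernstein sum_Bernstein flip: sum_distrib_left)
  also have "\<dots> = n * (x * (1 - x))"
    by (simp add: power2_eq_square algebra_simps)
  also have "\<dots> \<le> real n * 1"
    using x by (intro mult_left_mono mult_le_one) auto
  finally have var: "(\<Sum>k\<le>n. (k - n * x)\<^sup>2 * Bernstein n k x) \<le> n"
    by simp
  have ab: "\<bar>x - k / n\<bar> \<le> a + (k - n * x)\<^sup>2 / (n\<^sup>2 * a)" for k :: nat
  proof -
    define u where "u = \<bar>x - k / n\<bar>"
    have "(k - n * x)\<^sup>2 / (n\<^sup>2 * a) = u\<^sup>2 / a"
      using n by (simp add: u_def field_simps power2_eq_square)
    moreover have "u \<le> a + u\<^sup>2 / a"
    proof (cases "u \<le> a")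
      case False
      then have "u * a \<le> u\<^sup>2"
        using a by (simp add: power2_eq_square)
      then have "u \<le> u\<^sup>2 / a"
        using a by (simp add: pos_le_divide_eq)
      with a show ?thesis by simp
    qed (use a in \<open>simp add: add_increasing2\<close>)
    ultimately show ?thesis
      by (simp add: u_def)
  qed
  have "f x - (\<Sum>k\<le>n. Bernstein n k x *\<^sub>R f (k / n)) = (\<Sum>k\<le>n. Bernstein n k x *\<^sub>R (f x - f (k / n)))"
    by (simp add: scaleR_diff_right sum_subtractf flip: scaleR_sum_left)
  also have "norm \<dots> \<le> (\<Sum>k\<le>n. Bernstein n k x * (L * (a + (k - n * x)\<^sup>2 / (n\<^sup>2 * a))))"
  proof (intro sum_norm_le)
    fix k assume k: "k \<in> {..n}"
    have "norm (f x - f (k / n)) \<le> L * \<bar>x - k / n\<bar>"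
      using k n by (intro lip) auto
    also have "\<dots> \<le> L * (a + (k - n * x)\<^sup>2 / (n\<^sup>2 * a))"
      using ab L by (intro mult_left_mono)
    finally show "norm (Bernstein n k x *\<^sub>R (f x - f (k / n))) \<le> Bernstein n k x * (L * (a + (k - n * x)\<^sup>2 / (n\<^sup>2 * a)))"
      using B0 by (simp add: mult_left_mono)
  qed
  also have "\<dots> = L * a * (\<Sum>k\<le>n. Bernstein n k x) + L / (n\<^sup>2 * a) * (\<Sum>k\<le>n. (k - n * x)\<^sup>2 * Bernstein n k x)"
    by (simp only: sum_distrib_left flip: sum.distrib) (simp add: algebra_simps)
  also have "\<dots> \<le> L * a + L / (n\<^sup>2 * a) * n"
    using var L a n by (intro add_mono mult_left_mono) auto
  also have "\<dots> = L * (a + 1 / (real n * a))"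
    using n by (simp add: field_simps power2_eq_square)
  finally show ?thesis .
qed

lemma tendsto_integral_poly_of_moments:
  fixes m :: "'i \<Rightarrow> real measure"
  assumes sets: "\<And>i. sets (m i) = sets borel" "sets m0 = sets borel"
    and fin: "\<And>i. finite_measure (m i)" "finite_measure m0"
    and conc: "\<And>i. AE y in m i. y \<in> {0..1}" "AE y in m0. y \<in> {0..1}"
    and mom: "\<And>k. ((\<lambda>i. \<integral>y. y ^ k \<partial>m i) \<longlongrightarrow> (\<integral>y. y ^ k \<partial>m0)) F"
  shows "((\<lambda>i. \<integral>y. poly p y \<partial>m i) \<longlongrightarrow> (\<integral>y. poly p y \<partial>m0)) F"
proof -
  have eq: "(\<integral>y. poly p y \<partial>N) = (\<Sum>j\<le>degree p. coeff p j * (\<integral>y. y ^ j \<partial>N))"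
    if N: "sets N = sets borel" "finite_measure N" "AE y in N. y \<in> {0..1}" for N :: "real measure"
  proof -
    interpret finite_measure N by fact
    have "integrable N (\<lambda>y. y ^ j)" for j
      using N(3) by (intro integrable_const_bound[of _ 1]) (auto simp: power_abs measurable_cong_sets[OF N(1) refl] intro!: power_le_one)
    then show ?thesis
      unfolding poly_altdef by (subst Bochner_Integration.integral_sum) auto
  qed
  have "((\<lambda>i. \<Sum>j\<le>degree p. coeff p j * (\<integral>y. y ^ j \<partial>m i)) \<longlongrightarrow> (\<Sum>j\<le>degree p. coeff p j * (\<integral>y. y ^ j \<partial>m0))) F"
    by (intro tendsto_intros mom)
  then show ?thesis
    by (simp only: eq[OF sets(1) fin(1) conc(1)] eq[OF sets(2) fin(2) conc(2)])
qed

text \<open>The integral of the Bernstein polynomial of \<open>Q x\<close> is a combination of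
  finitely many numbers independent of \<open>x\<close>, with coefficients
  \<open>Q x (k / n)\<close> bounded by \<open>C\<close>; the approximation error depends only on
  \<open>L\<close> and the total mass. Both parts are thus uniform in \<open>x\<close>.\<close>

lemma uniform_limit_integral_of_moments:
  fixes m :: "'i \<Rightarrow> real measure" and Q :: "'x \<Rightarrow> real \<Rightarrow> 'b :: {banach, second_countable_topology}"
  assumes sets: "\<And>i. sets (m i) = sets borel" "sets m0 = sets borel"
    and fin: "\<And>i. finite_measure (m i)" "finite_measure m0"
    and conc: "\<And>i. AE y in m i. y \<in> {0..1}" "AE y in m0. y \<in> {0..1}"
    and mom: "\<And>k. ((\<lambda>i. \<integral>y. y ^ k \<partial>m i) \<longlongrightarrow> (\<integral>y. y ^ k \<partial>m0)) F"
    and Q_meas: "\<And>x. Q x \<in> borel_measurable borel"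
    and Q_bdd: "\<And>x y. y \<in> {0..1} \<Longrightarrow> norm (Q x y) \<le> C"
    and Q_lip: "\<And>x y z. y \<in> {0..1} \<Longrightarrow> z \<in> {0..1} \<Longrightarrow> norm (Q x y - Q x z) \<le> L * \<bar>y - z\<bar>"
  shows "uniform_limit UNIV (\<lambda>i x. \<integral>y. Q x y \<partial>m i) (\<lambda>x. \<integral>y. Q x y \<partial>m0) F"
proof (rule uniform_limitI)
  fix e :: real assume e: "e > 0"
  have C: "C \<ge> 0"
    using order_trans[OF norm_ge_zero Q_bdd[of 0]] by auto
  have L: "L \<ge> 0"
    using order_trans[OF norm_ge_zero Q_lip[of 0 1]] by auto
  \<comment> \<open>Bounds the mass of \<open>m0\<close> and, through convergence of the zeroth
    moment, eventually that of \<open>m i\<close>.\<close>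
  define W where "W = measure m0 UNIV + 1"
  have W: "W > 0"
    by (simp add: W_def add_nonneg_pos)
  \<comment> \<open>With \<open>n > 1 / a\<^sup>2\<close> both terms of the Bernstein error are at
    most \<open>a\<close>, giving \<open>2 * (L + 1) * a = e / (4 * W)\<close>; \<open>L + 1\<close>
    avoids dividing by 0.\<close>
  define a where "a = e / (8 * W) / (L + 1)"
  have a: "a > 0"
    using e L W by (simp add: a_def)
  obtain n :: nat where n: "1 / a\<^sup>2 < n"
    using reals_Archimedean2 by blast
  then have n0: "n > 0"
    using a by (cases n) auto
  have na: "1 / (n * a) \<le> a"
    using n n0 a by (simp add: field_simps power2_eq_square)
  define b where "b k y = Bernstein n k y" for k and y :: real
  define S where "S x y = (\<Sum>k\<le>n. b k y *\<^sub>R Q x (k / n))" for x y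
  have QS: "norm (Q x y - S x y) \<le> e / (4 * W)" if "y \<in> {0..1}" for x y
  proof -
    have "norm (Q x y - S x y) \<le> L * (a + 1 / (real n * a))"
      unfolding S_def b_def using that n0 a L by (intro Bernstein_approx_Lipschitz Q_lip) auto
    also have "\<dots> \<le> (L + 1) * (a + a)"
      using na L a n0 by (intro mult_mono) auto
    also have "\<dots> = 2 * ((L + 1) * a)"
      by simp
    also have "(L + 1) * a = e / (8 * W)"
      using L by (simp add: a_def)
    also have "2 * (e / (8 * W)) = e / (4 * W)"
      by simp
    finally show ?thesis .
  qed
  have b_meas: "b k \<in> borel_measurable borel" for k
    unfolding b_def Bernstein_def by measurable
  have b_bdd: "\<bar>b k y\<bar> \<le> 1" if "y \<in> {0..1}" "k \<le> n" for k y
  proof -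
    have "b k y \<le> (\<Sum>k\<le>n. b k y)"
      using that unfolding b_def by (intro member_le_sum) (auto intro!: Bernstein_nonneg)
    then show ?thesis
      using that Bernstein_nonneg[of y n k] by (simp add: b_def)
  qed
  have step: "norm ((\<integral>y. Q x y \<partial>N) - (\<Sum>k\<le>n. (\<integral>y. b k y \<partial>N) *\<^sub>R Q x (k / n))) \<le> e / 4"
    if N: "sets N = sets borel" "finite_measure N" "AE y in N. y \<in> {0..1}" "measure N UNIV \<le> W" for N x
  proof -
    interpret finite_measure N by fact
    have [simp]: "space N = UNIV"
      using sets_eq_imp_space_eq[OF N(1)] by simp
    have b_int: "integrable N (b k)" if "k \<le> n" for k
      using N(3) b_bdd that by (intro integrable_const_bound[of _ 1]) (auto simp: measurable_cong_sets[OF N(1) refl] b_meas)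
    have S_int: "integrable N (S x)" and "(\<integral>y. S x y \<partial>N) = (\<Sum>k\<le>n. (\<integral>y. b k y \<partial>N) *\<^sub>R Q x (k / n))"
      unfolding S_def using b_int by (auto intro!: Bochner_Integration.integrable_sum)
    moreover have Q_int: "integrable N (Q x)"
      using N(3) Q_bdd by (intro integrable_const_bound[of _ C]) (auto simp: measurable_cong_sets[OF N(1) refl] Q_meas)
    ultimately have "norm ((\<integral>y. Q x y \<partial>N) - (\<Sum>k\<le>n. (\<integral>y. b k y \<partial>N) *\<^sub>R Q x (k / n))) = norm (\<integral>y. Q x y - S x y \<partial>N)"
      by simp
    also have "\<dots> \<le> (\<integral>y. norm (Q x y - S x y) \<partial>N)"
      by (rule integral_norm_bound)
    also have "\<dots> \<le> (\<integral>y. e / (4 * W) \<partial>N)"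
      using N(3) Q_int S_int QS by (intro integral_mono_AE) auto
    also have "\<dots> = measure N UNIV * (e / (4 * W))"
      by simp
    also have "\<dots> \<le> W * (e / (4 * W))"
      using N(4) e W by (intro mult_right_mono) auto
    also have "\<dots> = e / 4"
      using W by simp
    finally show ?thesis .
  qed
  have b_poly: "b k = poly (smult (real (n choose k)) (monom (1 :: real) k * [:1, -1:] ^ (n - k)))" for k
    by (simp add: fun_eq_iff b_def Bernstein_def poly_monom poly_power)
  have lim_b: "((\<lambda>i. \<integral>y. b k y \<partial>m i) \<longlongrightarrow> (\<integral>y. b k y \<partial>m0)) F" for k
    unfolding b_poly by (rule tendsto_integral_poly_of_moments[OF sets fin conc mom])
  have "((\<lambda>i. \<Sum>k\<le>n. \<bar>(\<integral>y. b k y \<partial>m i) - (\<integral>y. b k y \<partial>m0)\<bar>) \<longlongrightarrow> (\<Sum>k\<le>n. 0)) F"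
    by (intro tendsto_sum tendsto_rabs_zero LIM_zero lim_b)
  then have "\<forall>\<^sub>F i in F. (\<Sum>k\<le>n. \<bar>(\<integral>y. b k y \<partial>m i) - (\<integral>y. b k y \<partial>m0)\<bar>) < e / (2 * (C + 1))"
    using e C by (intro order_tendstoD(2)) auto
  moreover have "((\<lambda>i. measure (m i) UNIV) \<longlongrightarrow> measure m0 UNIV) F"
    using mom[of 0] sets_eq_imp_space_eq[OF sets(1)] sets_eq_imp_space_eq[OF sets(2)] by simp
  then have "\<forall>\<^sub>F i in F. measure (m i) UNIV < W"
    by (rule order_tendstoD) (simp add: W_def)
  ultimately show "\<forall>\<^sub>F i in F. \<forall>x\<in>UNIV. dist (\<integral>y. Q x y \<partial>m i) (\<integral>y. Q x y \<partial>m0) < e"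
  proof eventually_elim
    case (elim i)
    show ?case
    proof
      fix x
      let ?T = "\<lambda>N. \<Sum>k\<le>n. (\<integral>y. b k y \<partial>N) *\<^sub>R Q x (k / n)"
      have "norm (?T (m i) - ?T m0) = norm (\<Sum>k\<le>n. ((\<integral>y. b k y \<partial>m i) - (\<integral>y. b k y \<partial>m0)) *\<^sub>R Q x (k / n))"
        by (simp add: scaleR_diff_left sum_subtractf)
      also have "\<dots> \<le> (\<Sum>k\<le>n. \<bar>(\<integral>y. b k y \<partial>m i) - (\<integral>y. b k y \<partial>m0)\<bar> * (C + 1))"
        using n0 C by (intro sum_norm_le) (auto intro!: mult_left_mono order_trans[OF Q_bdd])
      also have "\<dots> = (\<Sum>k\<le>n. \<bar>(\<integral>y. b k y \<partial>m i) - (\<integral>y. b k y \<partial>m0)\<bar>) * (C + 1)"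
        by (simp only: sum_distrib_right)
      also have "\<dots> < e / 2"
        using elim(1) C by (simp add: field_simps)
      finally have "norm (?T (m i) - ?T m0) < e / 2" .
      moreover have "norm ((\<integral>y. Q x y \<partial>m i) - ?T (m i)) \<le> e / 4"
        using elim by (intro step) (auto simp: sets fin conc simp del: atLeastAtMost_iff)
      moreover have "norm ((\<integral>y. Q x y \<partial>m0) - ?T m0) \<le> e / 4"
        by (intro step) (auto simp: sets fin conc W_def simp del: atLeastAtMost_iff)
      ultimately show "dist (\<integral>y. Q x y \<partial>m i) (\<integral>y. Q x y \<partial>m0) < e"
        unfolding dist_norm by norm
    qed
  qed
qed

subsection \<open>Convergence of integrals from convergence of Laplace exponents\<close>

text \<open>One half of the comparison between the Levy weight \<open>min 1 z\<close> and the
  tilting weight. The factor 2 comes from \<open>exp (- z) \<le> 1 / (1 + z)\<close>.\<close>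

lemma min_one_le_one_minus_exp:
  fixes z :: real
  assumes "0 \<le> z"
  shows "min 1 z \<le> 2 * (1 - exp (- z))"
proof -
  have e: "exp (- z) \<le> 1 / (1 + z)"
    using exp_ge_add_one_self[of z] assms by (simp add: exp_minus inverse_eq_divide frac_le)
  have "min 1 z * (1 + z) \<le> 2 * z"
  proof (cases "z \<le> 1")
    case True
    then show ?thesis
      using assms mult_left_le[of z z] by (simp add: algebra_simps)
  qed simp
  then have "min 1 z \<le> 2 * (1 - 1 / (1 + z))"
    using assms by (simp add: field_simps)
  with e show ?thesis by simp
qed

lemma one_minus_exp_le_min_one:
  fixes z :: real
  assumes "0 \<le> z"
  shows "1 - exp (- z) \<le> min 1 z"
  using exp_ge_add_one_self[of "- z"] by simp

text \<open>Weighting by \<open>1 - exp (- Z)\<close> turns the (possibly infinite) image measure of \<open>Z\<close> into a finite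
  one, and \<open>exp (- Z)\<close> compactifies the half-line.\<close>

definition tilted :: "'c measure \<Rightarrow> real \<Rightarrow> ('c \<Rightarrow> real) \<Rightarrow> real measure" where
  "tilted R c Z = distr (density R (\<lambda>\<omega>. ennreal (c * (1 - exp (- Z \<omega>))))) borel (\<lambda>\<omega>. exp (- Z \<omega>))"

text \<open>Both sides of the limit are instances: increments of \<open>H\<close> with
  \<open>c\<close> the factor of the difference quotient, and \<open>z\<close> itself under the Levy
  measure with \<open>c = 1\<close>. Nonnegativity is asked at every point, so the instances clip at
  0.\<close>

locale tilting =
  fixes R :: "'c measure" and c :: real and Z :: "'c \<Rightarrow> real"
  assumes Z_measurable [measurable]: "Z \<in> borel_measurable R"
    and Z_nonneg: "\<And>\<omega>. 0 \<le> Z \<omega>"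
    and c_nonneg: "0 \<le> c"
    and integrable_weight: "integrable R (\<lambda>\<omega>. 1 - exp (- Z \<omega>))"
begin

lemma sets_tilted: "sets (tilted R c Z) = sets borel"
  by (simp add: tilted_def)

lemma weight_nonneg: "0 \<le> 1 - exp (- Z \<omega>)"
  using Z_nonneg by simp

lemma finite_measure_tilted: "finite_measure (tilted R c Z)"
proof (rule finite_measureI)
  have "emeasure (tilted R c Z) (space (tilted R c Z)) = (\<integral>\<^sup>+\<omega>. ennreal (c * (1 - exp (- Z \<omega>))) \<partial>R)"
    by (simp add: tilted_def emeasure_distr emeasure_density nn_integral_cong_AE cong: nn_integral_cong_simp)
  also have "\<dots> = ennreal (\<integral>\<omega>. c * (1 - exp (- Z \<omega>)) \<partial>R)"
    using integrable_weight weight_nonneg c_nonneg by (intro nn_integral_eq_integral) auto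
  finally show "emeasure (tilted R c Z) (space (tilted R c Z)) \<noteq> \<infinity>"
    by simp
qed

lemma AE_tilted: "AE y in tilted R c Z. y \<in> {0..1}"
  unfolding tilted_def using Z_nonneg by (subst AE_distr_iff) auto

lemma integral_tilted:
  fixes Q :: "real \<Rightarrow> 'b :: {banach, second_countable_topology}"
  assumes [measurable]: "Q \<in> borel_measurable borel"
  shows "(\<integral>y. Q y \<partial>tilted R c Z) = c *\<^sub>R (\<integral>\<omega>. (1 - exp (- Z \<omega>)) *\<^sub>R Q (exp (- Z \<omega>)) \<partial>R)"
proof -
  have "(\<integral>y. Q y \<partial>tilted R c Z) = (\<integral>\<omega>. Q (exp (- Z \<omega>)) \<partial>density R (\<lambda>\<omega>. ennreal (c * (1 - exp (- Z \<omega>)))))"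
    unfolding tilted_def by (rule integral_distr) auto
  also have "\<dots> = (\<integral>\<omega>. (c * (1 - exp (- Z \<omega>))) *\<^sub>R Q (exp (- Z \<omega>)) \<partial>R)"
    using weight_nonneg c_nonneg by (intro integral_density) auto
  also have "\<dots> = c *\<^sub>R (\<integral>\<omega>. (1 - exp (- Z \<omega>)) *\<^sub>R Q (exp (- Z \<omega>)) \<partial>R)"
    by (simp flip: scaleR_scaleR)
  finally show ?thesis .
qed

lemma integrable_weighted:
  fixes q :: "real \<Rightarrow> 'b :: {banach, second_countable_topology}"
  assumes [measurable]: "q \<in> borel_measurable borel"
    and q: "\<And>z. 0 \<le> z \<Longrightarrow> norm (q z) \<le> A * (1 - exp (- z))"
  shows "integrable R (\<lambda>\<omega>. q (Z \<omega>))"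
proof (rule Bochner_Integration.integrable_bound)
  show "integrable R (\<lambda>\<omega>. A * (1 - exp (- Z \<omega>)))"
    using integrable_weight by simp
  show "AE \<omega> in R. norm (q (Z \<omega>)) \<le> norm (A * (1 - exp (- Z \<omega>)))"
    using q[OF Z_nonneg] by (intro AE_I2) (simp add: order_trans[OF _ abs_ge_self])
qed measurable

lemma integrable_one_minus_exp: "integrable R (\<lambda>\<omega>. 1 - exp (- (real k * Z \<omega>)))"
proof (rule integrable_weighted[where A = "real k"])
  fix z :: real assume z: "0 \<le> z"
  have "1 + real k * (exp (- z) - 1) \<le> (1 + (exp (- z) - 1)) ^ k"
    by (rule Bernoulli_inequality) simp
  then have "1 - exp (- (real k * z)) \<le> k * (1 - exp (- z))"
    by (simp add: algebra_simps flip: exp_of_nat_mult)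
  then show "norm (1 - exp (- (real k * z))) \<le> k * (1 - exp (- z))"
    using z by simp
qed measurable

text \<open>With \<open>y = exp (- Z)\<close>, \<open>(1 - y) * y ^ k\<close> telescopes as
  \<open>(1 - y ^ Suc k) - (1 - y ^ k)\<close>: every moment is a difference of Laplace exponents at
  consecutive integers.\<close>

lemma moment_tilted:
  "(\<integral>y. y ^ k \<partial>tilted R c Z)
    = c * (\<integral>\<omega>. 1 - exp (- (real (Suc k) * Z \<omega>)) \<partial>R) - c * (\<integral>\<omega>. 1 - exp (- (real k * Z \<omega>)) \<partial>R)"
proof -
  have "(\<integral>y. y ^ k \<partial>tilted R c Z) = c * (\<integral>\<omega>. (1 - exp (- Z \<omega>)) * exp (- Z \<omega>) ^ k \<partial>R)"
    using integral_tilted[of "\<lambda>y. y ^ k"] by simp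
  also have "(\<integral>\<omega>. (1 - exp (- Z \<omega>)) * exp (- Z \<omega>) ^ k \<partial>R)
      = (\<integral>\<omega>. (1 - exp (- (real (Suc k) * Z \<omega>))) - (1 - exp (- (real k * Z \<omega>))) \<partial>R)"
  proof (intro Bochner_Integration.integral_cong refl)
    fix \<omega>
    have "exp (- (real j * Z \<omega>)) = exp (- Z \<omega>) ^ j" for j
      by (simp flip: exp_of_nat_mult)
    then show "(1 - exp (- Z \<omega>)) * exp (- Z \<omega>) ^ k = (1 - exp (- (real (Suc k) * Z \<omega>))) - (1 - exp (- (real k * Z \<omega>)))"
      by (simp only: power_Suc) (simp add: algebra_simps)
  qed
  also have "\<dots> = (\<integral>\<omega>. 1 - exp (- (real (Suc k) * Z \<omega>)) \<partial>R) - (\<integral>\<omega>. 1 - exp (- (real k * Z \<omega>)) \<partial>R)"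
    by (intro Bochner_Integration.integral_diff integrable_one_minus_exp)
  finally show ?thesis
    by (simp add: right_diff_distrib)
qed

text \<open>Replaces the integrand \<open>q\<close> by a function \<open>Q\<close> on [0, 1]. The
  price is itself an integral against the tilted measure, so it can be made small for the limit
  measure and then carried over to the approximating ones.\<close>

lemma norm_integral_minus_tilted_le:
  fixes q Q :: "real \<Rightarrow> 'b :: {banach, second_countable_topology}"
  assumes meas: "q \<in> borel_measurable borel" "Q \<in> borel_measurable borel" "E \<in> borel_measurable borel"
    and q: "\<And>z. 0 \<le> z \<Longrightarrow> norm (q z) \<le> A * (1 - exp (- z))"
    and Q: "\<And>y. y \<in> {0..1} \<Longrightarrow> norm (Q y) \<le> C"
    and E: "\<And>y. y \<in> {0..1} \<Longrightarrow> \<bar>E y\<bar> \<le> C'"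
    and err: "\<And>z. 0 \<le> z \<Longrightarrow> norm (q z - (1 - exp (- z)) *\<^sub>R Q (exp (- z))) \<le> (1 - exp (- z)) * E (exp (- z))"
  shows "norm (c *\<^sub>R (\<integral>\<omega>. q (Z \<omega>) \<partial>R) - (\<integral>y. Q y \<partial>tilted R c Z)) \<le> (\<integral>y. E y \<partial>tilted R c Z)"
proof -
  note [measurable] = meas
  have int_q: "integrable R (\<lambda>\<omega>. q (Z \<omega>))"
    by (rule integrable_weighted[OF meas(1) q])
  have int_Q: "integrable R (\<lambda>\<omega>. (1 - exp (- Z \<omega>)) *\<^sub>R Q (exp (- Z \<omega>)))"
  proof (rule integrable_weighted[where A = C and q = "\<lambda>z. (1 - exp (- z)) *\<^sub>R Q (exp (- z))"])
    fix z :: real assume "0 \<le> z"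
    then show "norm ((1 - exp (- z)) *\<^sub>R Q (exp (- z))) \<le> C * (1 - exp (- z))"
      using Q[of "exp (- z)"] by (simp add: mult.commute[of C] mult_left_mono)
  qed measurable
  have int_E: "integrable R (\<lambda>\<omega>. (1 - exp (- Z \<omega>)) * E (exp (- Z \<omega>)))"
  proof (rule integrable_weighted[where A = C' and q = "\<lambda>z. (1 - exp (- z)) * E (exp (- z))"])
    fix z :: real assume "0 \<le> z"
    then show "norm ((1 - exp (- z)) * E (exp (- z))) \<le> C' * (1 - exp (- z))"
      using E[of "exp (- z)"] by (simp add: abs_mult mult.commute[of C'] mult_left_mono)
  qed measurable
  have "norm (c *\<^sub>R (\<integral>\<omega>. q (Z \<omega>) \<partial>R) - (\<integral>y. Q y \<partial>tilted R c Z))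
      = c * norm (\<integral>\<omega>. q (Z \<omega>) - (1 - exp (- Z \<omega>)) *\<^sub>R Q (exp (- Z \<omega>)) \<partial>R)"
    using int_q int_Q c_nonneg by (simp add: integral_tilted flip: scaleR_diff_right)
  also have "\<dots> \<le> c * (\<integral>\<omega>. norm (q (Z \<omega>) - (1 - exp (- Z \<omega>)) *\<^sub>R Q (exp (- Z \<omega>))) \<partial>R)"
    using c_nonneg by (intro mult_left_mono integral_norm_bound)
  also have "\<dots> \<le> c * (\<integral>\<omega>. (1 - exp (- Z \<omega>)) * E (exp (- Z \<omega>)) \<partial>R)"
    using c_nonneg int_q int_Q int_E err Z_nonneg by (intro mult_left_mono integral_mono) auto
  also have "\<dots> = (\<integral>y. E y \<partial>tilted R c Z)"
    by (simp add: integral_tilted)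
  finally show ?thesis .
qed

end

text \<open>A Lipschitz function on the half-line, rescaled by \<open>1 - exp (- z)\<close> and read in the variable
  \<open>y = exp (- z)\<close>, is uniformly Lipschitz on \<open>[0, 1]\<close> once it is cut off at distance \<open>a\<close> from both ends.
  \<open>cut_error\<close> controls what the cut-off loses.\<close>

definition cut_off :: "real \<Rightarrow> (real \<Rightarrow> 'b :: real_normed_vector) \<Rightarrow> real \<Rightarrow> 'b" where
  "cut_off a q y = (1 / max a (1 - y)) *\<^sub>R q (- ln (max y a))"

definition cut_error :: "real \<Rightarrow> real \<Rightarrow> real" where
  "cut_error a y = min 1 (max 0 (2 - y / a)) + (1 - min 1 ((1 - y) / a))"

lemma cut_off_bounded:
  assumes a: "0 < a" "a < 1" and q: "\<And>z. 0 \<le> z \<Longrightarrow> norm (q z) \<le> B" and y: "y \<in> {0..1}"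
  shows "norm (cut_off a q y) \<le> B / a"
proof -
  have "norm (q (- ln (max y a))) \<le> B"
    using a y by (intro q) auto
  moreover have "1 / max a (1 - y) \<le> 1 / a"
    using a by (intro divide_left_mono) auto
  ultimately have "1 / max a (1 - y) * norm (q (- ln (max y a))) \<le> 1 / a * B"
    using a by (intro mult_mono) auto
  then show ?thesis
    using a by (simp add: cut_off_def)
qed

text \<open>A product rule: the factor \<open>r\<close> is bounded by \<open>1 / a\<close> with
  Lipschitz constant \<open>1 / a\<^sup>2\<close>; the factor \<open>p\<close> is bounded by
  \<open>B\<close> with constant \<open>C / a\<close>, because \<open>ln\<close> is
  \<open>1 / a\<close>-Lipschitz on arguments at least \<open>a\<close>.\<close>

lemma cut_off_Lipschitz:
  assumes a: "0 < a" "a < 1"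
    and q: "\<And>z. 0 \<le> z \<Longrightarrow> norm (q z) \<le> B"
    and lip: "\<And>z w. 0 \<le> z \<Longrightarrow> 0 \<le> w \<Longrightarrow> norm (q z - q w) \<le> C * \<bar>z - w\<bar>"
    and y: "y \<in> {0..1}" "y' \<in> {0..1}"
  shows "norm (cut_off a q y - cut_off a q y') \<le> (C + B) / a\<^sup>2 * \<bar>y - y'\<bar>"
proof -
  define r where "r y = 1 / max a (1 - y)" for y
  define p where "p y = q (- ln (max y a))" for y
  have C: "0 \<le> C"
    using order_trans[OF norm_ge_zero lip[of 0 1]] by simp
  have ln_lip: "\<bar>ln u - ln v\<bar> \<le> \<bar>u - v\<bar> / a" if "a \<le> u" "a \<le> v" for u v
  proof -
    have *: "ln u - ln v \<le> \<bar>u - v\<bar> / a" if "a \<le> u" "a \<le> v" for u v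
    proof -
      have "ln u - ln v \<le> (u - v) / v"
        using that a by (intro ln_diff_le) auto
      also have "\<dots> \<le> \<bar>u - v\<bar> / v"
        using that a by (intro divide_right_mono) auto
      also have "\<dots> \<le> \<bar>u - v\<bar> / a"
        using that a by (intro divide_left_mono) auto
      finally show ?thesis .
    qed
    show ?thesis
      using *[OF that] *[OF that(2,1)] by (simp add: abs_le_iff abs_minus_commute)
  qed
  have p_lip: "norm (p y - p y') \<le> C / a * \<bar>y - y'\<bar>"
  proof -
    have "norm (p y - p y') \<le> C * \<bar>- ln (max y a) - (- ln (max y' a))\<bar>"
      unfolding p_def using a y by (intro lip) auto
    also have "\<dots> \<le> C * (\<bar>max y a - max y' a\<bar> / a)"
      unfolding minus_diff_minus abs_minus_cancel using C by (intro mult_left_mono ln_lip) auto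
    also have "\<dots> \<le> C * (\<bar>y - y'\<bar> / a)"
      using C a by (intro mult_left_mono divide_right_mono) auto
    finally show ?thesis by simp
  qed
  have r: "0 \<le> r y" "r y \<le> 1 / a" for y
    using a by (auto simp: r_def intro!: divide_left_mono)
  have r_lip: "\<bar>r y - r y'\<bar> \<le> \<bar>y - y'\<bar> / a\<^sup>2"
  proof -
    have "r y - r y' = (max a (1 - y') - max a (1 - y)) * (r y * r y')"
      using a by (simp add: r_def field_simps)
    then have "\<bar>r y - r y'\<bar> = \<bar>max a (1 - y') - max a (1 - y)\<bar> * (r y * r y')"
      using r by (simp add: abs_mult)
    also have "\<dots> \<le> \<bar>y - y'\<bar> * (1 / a * (1 / a))"
      using r a by (intro mult_mono) auto
    finally show ?thesis
      by (simp add: power2_eq_square)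
  qed
  have "norm (p y') \<le> B"
    unfolding p_def using a y by (intro q) auto
  have "cut_off a q y - cut_off a q y' = r y *\<^sub>R (p y - p y') + (r y - r y') *\<^sub>R p y'"
    by (simp add: cut_off_def r_def p_def algebra_simps)
  also have "norm \<dots> \<le> r y * norm (p y - p y') + \<bar>r y - r y'\<bar> * norm (p y')"
    using r by (intro norm_triangle_le) simp
  also have "\<dots> \<le> 1 / a * (C / a * \<bar>y - y'\<bar>) + \<bar>y - y'\<bar> / a\<^sup>2 * B"
    using r p_lip r_lip \<open>norm (p y') \<le> B\<close> a by (intro add_mono mult_mono) auto
  also have "\<dots> = (C + B) / a\<^sup>2 * \<bar>y - y'\<bar>"
    by (simp add: add_divide_distrib algebra_simps power2_eq_square)
  finally show ?thesis .
qed

lemma cut_error_nonneg: "0 \<le> cut_error a y"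
  by (auto simp: cut_error_def)

lemma cut_error_bounded:
  assumes "0 < a" "y \<in> {0..1}"
  shows "\<bar>cut_error a y\<bar> \<le> 2"
proof -
  define u where "u = (1 - y) / a"
  have "0 \<le> u"
    using assms by (simp add: u_def)
  then show ?thesis
    using cut_error_nonneg[of a y] unfolding cut_error_def u_def[symmetric] by linarith
qed

lemma cut_error_Lipschitz:
  assumes "0 < a"
  shows "\<bar>cut_error a y - cut_error a y'\<bar> \<le> 2 / a * \<bar>y - y'\<bar>"
proof -
  have "\<bar>cut_error a y - cut_error a y'\<bar> \<le> \<bar>y / a - y' / a\<bar> + \<bar>(1 - y) / a - (1 - y') / a\<bar>"
    unfolding cut_error_def by (auto simp: min_def max_def)
  also have "\<dots> = 2 / a * \<bar>y - y'\<bar>"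
    using assms by (simp add: diff_divide_distrib[symmetric] abs_minus_commute[of y' y])
  finally show ?thesis .
qed

text \<open>For \<open>y \<ge> a\<close> only the weight is altered, and the loss
  \<open>1 - s\<close> is the second summand of \<open>cut_error\<close>. For \<open>y < a\<close>
  the function is frozen at \<open>- ln a\<close>, and the crude bound
  \<open>2 * A * (1 - y)\<close> suffices since the first summand is then 1. That summand falls
  linearly to 0 at \<open>2 * a\<close>, a Lipschitz majorant of the indicator of
  \<open>y < a\<close>.\<close>

lemma cut_off_error:
  assumes a: "0 < a" "a < 1" and z: "0 \<le> z"
    and q: "\<And>z. 0 \<le> z \<Longrightarrow> norm (q z) \<le> A * (1 - exp (- z))"
  shows "norm (q z - (1 - exp (- z)) *\<^sub>R cut_off a q (exp (- z)))
    \<le> (1 - exp (- z)) * (2 * A * cut_error a (exp (- z)))"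
proof -
  define y where "y = exp (- z)"
  have y: "0 < y" "y \<le> 1" "z = - ln y"
    using z by (auto simp: y_def)
  define s where "s = (1 - y) / max a (1 - y)"
  have s: "0 \<le> s" "s \<le> 1" "s = min 1 ((1 - y) / a)"
    using a y by (auto simp: s_def max_def min_def field_simps)
  have A: "0 \<le> A"
    using order_trans[OF norm_ge_zero q[of 1]] by (simp add: zero_le_mult_iff)
  have qz: "norm (q z) \<le> A * (1 - y)"
    using q[OF z] by (simp add: y_def)
  have eq: "q z - (1 - y) *\<^sub>R cut_off a q y = q z - s *\<^sub>R q (- ln (max y a))"
    by (simp add: cut_off_def s_def)
  have "norm (q z - s *\<^sub>R q (- ln (max y a))) \<le> (1 - y) * (2 * A * cut_error a y)"
  proof (cases "a \<le> y")
    case True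
    then have "q z - s *\<^sub>R q (- ln (max y a)) = (1 - s) *\<^sub>R q z"
      using y by (simp add: algebra_simps)
    then have "norm (q z - s *\<^sub>R q (- ln (max y a))) \<le> (1 - s) * (A * (1 - y))"
      using s qz by (simp add: mult_left_mono)
    also have "\<dots> \<le> cut_error a y * (A * (1 - y))"
      using s A y by (intro mult_right_mono) (auto simp: cut_error_def)
    also have "\<dots> \<le> 2 * (cut_error a y * (A * (1 - y)))"
      using A y cut_error_nonneg[of a y] by simp
    finally show ?thesis by (simp only: mult_ac)
  next
    case False
    then have "norm (q (- ln (max y a))) \<le> A * (1 - a)"
      using a q[of "- ln a"] by (simp add: max_def)
    also have "\<dots> \<le> A * (1 - y)"
      using False A by (intro mult_left_mono) auto
    finally have "s * norm (q (- ln (max y a))) \<le> 1 * (A * (1 - y))"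
      using s by (intro mult_mono) auto
    then have "norm (q z - s *\<^sub>R q (- ln (max y a))) \<le> A * (1 - y) + A * (1 - y)"
      using qz s by (intro norm_triangle_le_diff add_mono) auto
    also have "\<dots> = 2 * A * (1 - y) * 1"
      by simp
    also have "\<dots> \<le> 2 * A * (1 - y) * cut_error a y"
    proof (rule mult_left_mono)
      have "y / a < 1"
        using False a by simp
      then show "1 \<le> cut_error a y"
        unfolding cut_error_def by linarith
    qed (use A y in simp)
    finally show ?thesis by (simp only: mult_ac)
  qed
  then show ?thesis
    unfolding eq[unfolded y_def] y_def .
qed

text \<open>Convergence of Laplace exponents at the natural numbers gives convergence of all moments of the tilted
  measures, hence of the integrals of all functions that vanish linearly at \<open>0\<close>.\<close>

theorem uniform_limit_integral_of_Laplace: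
  fixes R :: "'i \<Rightarrow> 'c measure" and R0 :: "'d measure"
    and q :: "'x \<Rightarrow> real \<Rightarrow> 'b :: {banach, second_countable_topology}"
  assumes tilt: "\<And>i. tilting (R i) (c i) (Z i)" "tilting R0 1 Z0"
    and Laplace: "\<And>k :: nat. ((\<lambda>i. c i * (\<integral>\<omega>. 1 - exp (- (real k * Z i \<omega>)) \<partial>R i)) \<longlongrightarrow>
      (\<integral>\<omega>. 1 - exp (- (real k * Z0 \<omega>)) \<partial>R0)) F"
    and q_meas: "\<And>x. q x \<in> borel_measurable borel"
    and q_bdd: "\<And>x z. 0 \<le> z \<Longrightarrow> norm (q x z) \<le> B"
    and q_lip: "\<And>x z w. 0 \<le> z \<Longrightarrow> 0 \<le> w \<Longrightarrow> norm (q x z - q x w) \<le> C * \<bar>z - w\<bar>"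
    and q_lin: "\<And>x z. 0 \<le> z \<Longrightarrow> norm (q x z) \<le> A * (1 - exp (- z))"
  shows "uniform_limit UNIV (\<lambda>i x. c i *\<^sub>R (\<integral>\<omega>. q x (Z i \<omega>) \<partial>R i)) (\<lambda>x. \<integral>\<omega>. q x (Z0 \<omega>) \<partial>R0) F"
proof (rule uniform_limitI)
  fix e :: real assume e: "0 < e"
  interpret T: tilting "R i" "c i" "Z i" for i by (rule tilt)
  interpret T0: tilting R0 1 Z0 by (rule tilt)
  have A: "0 \<le> A"
    using order_trans[OF norm_ge_zero q_lin[of 1]] by (simp add: zero_le_mult_iff)
  have moments: "((\<lambda>i. \<integral>y. y ^ k \<partial>tilted (R i) (c i) (Z i)) \<longlongrightarrow> (\<integral>y. y ^ k \<partial>tilted R0 1 Z0)) F" for k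
    unfolding T.moment_tilted T0.moment_tilted
    using tendsto_diff[OF Laplace[of "Suc k"] Laplace[of k]] by simp
  note tilted_limit = uniform_limit_integral_of_moments[OF T.sets_tilted T0.sets_tilted
    T.finite_measure_tilted T0.finite_measure_tilted T.AE_tilted T0.AE_tilted moments]
  have cut_error_meas [measurable]: "cut_error a \<in> borel_measurable borel" for a
    unfolding cut_error_def[abs_def] by measurable
  \<comment> \<open>The errors vanish pointwise on the open interval (0, 1). The end
    \<open>y = 1\<close> has weight \<open>1 - y = 0\<close>, and \<open>y = 0\<close> is never
    reached because \<open>Z0\<close> is finite: no drift and no killing in the limit.\<close>
  have "(\<lambda>n. \<integral>y. cut_error (1 / real (n + 2)) y \<partial>tilted R0 1 Z0) \<longlonglongrightarrow> (\<integral>\<omega>. 0 \<partial>R0)"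
    unfolding T0.integral_tilted[OF cut_error_meas] scaleR_one
  proof (rule integral_dominated_convergence[where w = "\<lambda>\<omega>. 2 * (1 - exp (- Z0 \<omega>))"])
    show "integrable R0 (\<lambda>\<omega>. 2 * (1 - exp (- Z0 \<omega>)))"
      by (intro integrable_mult_right T0.integrable_weight)
    show "AE \<omega> in R0. norm ((1 - exp (- Z0 \<omega>)) *\<^sub>R cut_error (1 / real (n + 2)) (exp (- Z0 \<omega>))) \<le> 2 * (1 - exp (- Z0 \<omega>))" for n
    proof (rule AE_I2)
      fix \<omega>
      have "(1 - exp (- Z0 \<omega>)) * \<bar>cut_error (1 / real (n + 2)) (exp (- Z0 \<omega>))\<bar> \<le> (1 - exp (- Z0 \<omega>)) * 2"
        using T0.Z_nonneg by (intro mult_left_mono cut_error_bounded T0.weight_nonneg) auto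
      then show "norm ((1 - exp (- Z0 \<omega>)) *\<^sub>R cut_error (1 / real (n + 2)) (exp (- Z0 \<omega>))) \<le> 2 * (1 - exp (- Z0 \<omega>))"
        using T0.weight_nonneg[of \<omega>] by (simp only: real_scaleR_def abs_mult real_norm_def abs_of_nonneg mult.commute[of 2])
    qed
    show "AE \<omega> in R0. (\<lambda>n. (1 - exp (- Z0 \<omega>)) *\<^sub>R cut_error (1 / real (n + 2)) (exp (- Z0 \<omega>))) \<longlonglongrightarrow> 0"
    proof (rule AE_I2)
      fix \<omega>
      define y where "y = exp (- Z0 \<omega>)"
      have y: "0 < y" "y \<le> 1"
        using T0.Z_nonneg by (auto simp: y_def)
      show "(\<lambda>n. (1 - exp (- Z0 \<omega>)) *\<^sub>R cut_error (1 / real (n + 2)) (exp (- Z0 \<omega>))) \<longlonglongrightarrow> 0"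
      proof (cases "y = 1")
        case False
        \<comment> \<open>With \<open>a = 1 / (n + 2)\<close> the error is 0 as soon as
          \<open>2 * a \<le> y\<close> and \<open>a \<le> 1 - y\<close>; the shift by 2 keeps
          \<open>a < 1\<close>.\<close>
        obtain N :: nat where N: "max (2 / y) (1 / (1 - y)) < N"
          using reals_Archimedean2 by blast
        have "cut_error (1 / real (n + 2)) y = 0" if "n \<ge> N" for n
        proof -
          have "2 / y \<le> real (n + 2)" "1 / (1 - y) \<le> real (n + 2)"
            using N that by auto
          then have "2 \<le> y * real (n + 2)" "1 \<le> (1 - y) * real (n + 2)"
            using y False by (auto simp: divide_le_eq mult.commute)
          then show ?thesis
            by (simp add: cut_error_def)
        qed
        then show ?thesis
          unfolding y_def[symmetric] by (intro tendsto_eventually) (auto simp: eventually_sequentially)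
      qed (simp add: y_def)
    qed
  qed measurable
  then have "(\<lambda>n. 2 * A * (\<integral>y. cut_error (1 / real (n + 2)) y \<partial>tilted R0 1 Z0)) \<longlonglongrightarrow> 2 * A * 0"
    by (intro tendsto_mult tendsto_const) simp
  then have "\<forall>\<^sub>F n in sequentially. 2 * A * (\<integral>y. cut_error (1 / real (n + 2)) y \<partial>tilted R0 1 Z0) < e / 4"
    using e by (intro order_tendstoD) auto
  then obtain n where n: "2 * A * (\<integral>y. cut_error (1 / real (n + 2)) y \<partial>tilted R0 1 Z0) < e / 4"
    by (auto simp: eventually_sequentially)
  define a where "a = 1 / real (n + 2)"
  have a: "0 < a" "a < 1"
    by (auto simp: a_def)
  have cut_off_meas [measurable]: "cut_off a (q x) \<in> borel_measurable borel" for x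
    using q_meas unfolding cut_off_def[abs_def] by measurable
  have "uniform_limit UNIV (\<lambda>i x. \<integral>y. cut_off a (q x) y \<partial>tilted (R i) (c i) (Z i)) (\<lambda>x. \<integral>y. cut_off a (q x) y \<partial>tilted R0 1 Z0) F"
    by (rule tilted_limit[OF cut_off_meas cut_off_bounded[OF a q_bdd] cut_off_Lipschitz[OF a q_bdd q_lip]])
  then have cut_off_lim: "\<forall>\<^sub>F i in F. \<forall>x\<in>UNIV. dist (\<integral>y. cut_off a (q x) y \<partial>tilted (R i) (c i) (Z i)) (\<integral>y. cut_off a (q x) y \<partial>tilted R0 1 Z0) < e / 4"
    by (rule uniform_limitD) (use e in simp)
  \<comment> \<open>The error function is Lipschitz as well, so the same limit theorem, with a
    one-point parameter, transfers its smallness from the limit measure to the measures with index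
    near the limit.\<close>
  have "uniform_limit UNIV (\<lambda>i (x :: unit). \<integral>y. cut_error a y \<partial>tilted (R i) (c i) (Z i)) (\<lambda>x. \<integral>y. cut_error a y \<partial>tilted R0 1 Z0) F"
    by (rule tilted_limit[where C = 2 and L = "2 / a"])
       (use cut_error_bounded cut_error_Lipschitz a cut_error_meas in \<open>auto simp del: times_divide_eq_left\<close>)
  then have "((\<lambda>i. \<integral>y. cut_error a y \<partial>tilted (R i) (c i) (Z i)) \<longlongrightarrow> (\<integral>y. cut_error a y \<partial>tilted R0 1 Z0)) F"
    by (rule tendsto_uniform_limitI) simp
  then have "((\<lambda>i. 2 * A * (\<integral>y. cut_error a y \<partial>tilted (R i) (c i) (Z i))) \<longlongrightarrow> 2 * A * (\<integral>y. cut_error a y \<partial>tilted R0 1 Z0)) F"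
    by (intro tendsto_mult tendsto_const)
  then have "\<forall>\<^sub>F i in F. 2 * A * (\<integral>y. cut_error a y \<partial>tilted (R i) (c i) (Z i)) < e / 4"
    using n by (intro order_tendstoD) (auto simp: a_def)
  with cut_off_lim
  show "\<forall>\<^sub>F i in F. \<forall>x\<in>UNIV. dist (c i *\<^sub>R (\<integral>\<omega>. q x (Z i \<omega>) \<partial>R i)) (\<integral>\<omega>. q x (Z0 \<omega>) \<partial>R0) < e"
  proof eventually_elim
    case (elim i)
    show ?case
    proof
      fix x
      have triangle: "norm (v - w) < e"
        if "norm (v - v') \<le> s" "norm (w - w') \<le> s'" "norm (v' - w') < e / 4" "s < e / 4" "s' < e / 4"
        for v v' w w' :: 'b and s s' :: real
        using that e by norm
      have bounds: "\<bar>2 * A * cut_error a y\<bar> \<le> 2 * A * 2" if "y \<in> {0..1}" for y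
        using mult_left_mono[OF cut_error_bounded[OF a(1) that], of "2 * A"] A by (simp add: abs_mult)
      have meas: "(\<lambda>y. 2 * A * cut_error a y) \<in> borel_measurable borel"
        by measurable
      have "norm (c i *\<^sub>R (\<integral>\<omega>. q x (Z i \<omega>) \<partial>R i) - (\<integral>y. cut_off a (q x) y \<partial>tilted (R i) (c i) (Z i))) \<le> (\<integral>y. 2 * A * cut_error a y \<partial>tilted (R i) (c i) (Z i))"
        by (rule T.norm_integral_minus_tilted_le[OF q_meas cut_off_meas meas q_lin cut_off_bounded[OF a q_bdd] bounds cut_off_error[OF a _ q_lin]])
      moreover have "norm (1 *\<^sub>R (\<integral>\<omega>. q x (Z0 \<omega>) \<partial>R0) - (\<integral>y. cut_off a (q x) y \<partial>tilted R0 1 Z0)) \<le> (\<integral>y. 2 * A * cut_error a y \<partial>tilted R0 1 Z0)"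
        by (rule T0.norm_integral_minus_tilted_le[OF q_meas cut_off_meas meas q_lin cut_off_bounded[OF a q_bdd] bounds cut_off_error[OF a _ q_lin]])
      moreover have "dist (\<integral>y. cut_off a (q x) y \<partial>tilted (R i) (c i) (Z i)) (\<integral>y. cut_off a (q x) y \<partial>tilted R0 1 Z0) < e / 4"
        using elim by blast
      ultimately show "dist (c i *\<^sub>R (\<integral>\<omega>. q x (Z i \<omega>) \<partial>R i)) (\<integral>\<omega>. q x (Z0 \<omega>) \<partial>R0) < e"
        using elim(2) n unfolding dist_norm a_def[symmetric] integral_mult_right_zero scaleR_one
        by (rule triangle)
    qed
  qed
qed

subsection \<open>Small-time estimates for Levy processes\<close>

lemma norm_exp_minus_one_le:
  fixes w :: complex
  assumes "Re w \<le> 0"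
  shows "norm (exp w - 1) \<le> norm w"
proof -
  have "norm (exp w - exp 0) \<le> 1 * norm (w - 0)"
  proof (rule field_differentiable_bound[of "{w. Re w \<le> 0}" exp exp])
    show "convex {w. Re w \<le> 0}"
      by (rule convex_halfspace_Re_le)
  qed (use assms in \<open>auto intro!: derivative_eq_intros\<close>)
  then show ?thesis by simp
qed

text \<open>The classical truncation inequality: \<open>1 - sin y / y\<close> is the mean of
  \<open>1 - cos (\<xi> * y)\<close> over \<xi> in [0, 1]. Below 2 the fifth-order Taylor bound
  leaves at least \<open>y\<^sup>2 / 8\<close>, since \<open>1 / 6 - 4 / 120 \<ge> 1 / 8\<close>;
  from 2 on the right-hand side is at least 4.\<close>

lemma min_one_square_le_sinc:
  fixes y :: real
  assumes "y \<noteq> 0"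
  shows "min 1 (y\<^sup>2) \<le> 8 * (1 - sin y / y)"
proof -
  have "min 1 (y\<^sup>2) \<le> 8 * (1 - sin y / y)" if y: "0 < y" for y :: real
  proof (cases "y \<ge> 2")
    case True
    then have "2 * sin y \<le> y"
      using sin_le_one[of y] by linarith
    then have "sin y / y \<le> 1 / 2"
      using True by (simp add: divide_le_eq)
    then show ?thesis by simp
  next
    case False
    have "\<bar>sin y - (\<Sum>m<5. sin_coeff m * y ^ m)\<bar> \<le> inverse (fact 5) * \<bar>y\<bar> ^ 5"
      by (rule Maclaurin_sin_bound)
    then have "sin y \<le> y - y ^ 3 / 6 + y ^ 5 / 120"
    proof -
      have "(\<Sum>m<5. sin_coeff m * y ^ m) = y - y ^ 3 / 6"
        by (simp add: sin_coeff_def lessThan_nat_numeral fact_numeral)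
      moreover have "inverse (fact 5) * \<bar>y\<bar> ^ 5 = y ^ 5 / 120"
        using y by (simp add: fact_numeral field_simps)
      ultimately show ?thesis
        using \<open>\<bar>sin y - _\<bar> \<le> _\<close> unfolding abs_le_iff by linarith
    qed
    also have "\<dots> = y * (1 - y\<^sup>2 / 6 + y\<^sup>2 * y\<^sup>2 / 120)"
      by (simp add: algebra_simps eval_nat_numeral)
    also have "\<dots> \<le> y * (1 - y\<^sup>2 / 8)"
    proof (intro mult_left_mono)
      have "y\<^sup>2 \<le> 2\<^sup>2"
        using y False by (intro power_mono) auto
      then have "y\<^sup>2 * y\<^sup>2 \<le> 4 * y\<^sup>2"
        by (intro mult_right_mono) auto
      then show "1 - y\<^sup>2 / 6 + y\<^sup>2 * y\<^sup>2 / 120 \<le> 1 - y\<^sup>2 / 8"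
        using zero_le_power2[of y] by linarith
    qed (use y in auto)
    finally have "sin y / y \<le> 1 - y\<^sup>2 / 8"
      using y by (simp add: divide_le_eq mult.commute)
    then show ?thesis by simp
  qed
  from this[of y] this[of "-y"] assms show ?thesis
    by (cases "y > 0") auto
qed

lemma nn_integral_one_minus_cos:
  fixes y :: real
  assumes "y \<noteq> 0"
  shows "(\<integral>\<^sup>+\<xi>. ennreal (1 - cos (\<xi> * y)) * indicator {0..1} \<xi> \<partial>lborel) = ennreal (1 - sin y / y)"
proof -
  have "(\<integral>\<^sup>+\<xi>. ennreal (1 - cos (\<xi> * y)) * indicator {0..1} \<xi> \<partial>lborel)
      = ennreal ((1 - sin (1 * y) / y) - (0 - sin (0 * y) / y))"
    using assms
    by (intro nn_integral_FTC_Icc[where F = "\<lambda>\<xi>. \<xi> - sin (\<xi> * y) / y"])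
       (auto intro!: derivative_eq_intros simp: has_real_derivative_iff_has_vector_derivative[symmetric])
  then show ?thesis by simp
qed

text \<open>\<open>sin y\<close> agrees with \<open>y\<close> to first order but stays bounded, so
  one estimate covers all jump sizes. For small \<open>y\<close>, Taylor for \<open>h\<close> and
  for \<open>sin\<close> costs \<open>2 * B * y\<^sup>2\<close>; for large \<open>y\<close> the
  three terms are bounded by \<open>B\<close> each.\<close>

lemma norm_diff_le_sin_Taylor:
  fixes h :: "real \<Rightarrow> complex"
  assumes h: "\<And>x. (h has_vector_derivative h1 x) (at x)" "\<And>x. (h1 has_vector_derivative h2 x) (at x)"
    and bdd: "\<And>x. norm (h x) \<le> B" "\<And>x. norm (h1 x) \<le> B" "\<And>x. norm (h2 x) \<le> B"
  shows "norm (h (x + y) - h x - sin y *\<^sub>R h1 x) \<le> 3 * B * min 1 (y\<^sup>2)"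
proof -
  have lin: "norm (f (x + y) - f x - y *\<^sub>R f1 x) \<le> B * y\<^sup>2"
    if f: "\<And>x. (f has_vector_derivative f1 x) (at x)" "\<And>x. (f1 has_vector_derivative f2 x) (at x)" "\<And>x. norm (f2 x) \<le> B"
    for f f1 f2 :: "real \<Rightarrow> 'b :: real_normed_vector" and x y B
  proof -
    have B: "0 \<le> B"
      using order_trans[OF norm_ge_zero f(3)] .
    have on: "onorm (\<lambda>h. h *\<^sub>R f2 u) \<le> B" for u
      by (rule onorm_le) (use f(3)[of u] in \<open>simp add: mult.commute[of B] mult_left_mono\<close>)
    have f1: "norm (f1 u - f1 x) \<le> B * \<bar>y\<bar>" if "u \<in> closed_segment x (x + y)" for u
    proof -
      have "norm (f1 u - f1 x) \<le> B * norm (u - x)"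
        by (rule differentiable_bound[of UNIV f1 "\<lambda>x h. h *\<^sub>R f2 x"])
           (use f(2) on in \<open>auto simp: has_vector_derivative_def\<close>)
      also have "\<dots> \<le> B * \<bar>y\<bar>"
        using that B by (intro mult_left_mono) (auto simp: closed_segment_eq_real_ivl split: if_splits)
      finally show ?thesis .
    qed
    have "norm (f (x + y) - f x - ((x + y) - x) *\<^sub>R f1 x) \<le> norm ((x + y) - x) * (B * \<bar>y\<bar>)"
      by (rule vector_differentiable_bound_linearization[where f' = f1 and S = "closed_segment x (x + y)"])
         (use f f1 in \<open>auto intro: has_vector_derivative_at_within\<close>)
    then show ?thesis
      by (simp add: power2_eq_square ac_simps flip: abs_mult)
  qed
  have B: "0 \<le> B"
    using order_trans[OF norm_ge_zero bdd(1)] .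
  show ?thesis
  proof (cases "\<bar>y\<bar> \<le> 1")
    case True
    have "\<bar>sin y - y\<bar> \<le> 1 * y\<^sup>2"
      using lin[of sin cos "\<lambda>x. - sin x" 1 0 y]
      by (auto intro!: derivative_eq_intros simp: has_real_derivative_iff_has_vector_derivative[symmetric])
    then have "norm ((y - sin y) *\<^sub>R h1 x) \<le> y\<^sup>2 * B"
      using bdd(2)[of x] by (simp add: mult_mono abs_minus_commute)
    moreover have "norm (h (x + y) - h x - y *\<^sub>R h1 x) \<le> B * y\<^sup>2"
      by (rule lin) (use h bdd in auto)
    moreover have "h (x + y) - h x - sin y *\<^sub>R h1 x = (h (x + y) - h x - y *\<^sub>R h1 x) + (y - sin y) *\<^sub>R h1 x"
      by (simp add: algebra_simps)
    ultimately have "norm (h (x + y) - h x - sin y *\<^sub>R h1 x) \<le> B * y\<^sup>2 + y\<^sup>2 * B"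
      by (metis norm_triangle_le add_mono)
    also have "\<dots> \<le> 3 * B * y\<^sup>2"
      using B by simp
    also have "y\<^sup>2 = min 1 (y\<^sup>2)"
      using True by (simp add: abs_square_le_1)
    finally show ?thesis .
  next
    case False
    then have "min 1 (y\<^sup>2) = 1"
      by (simp add: abs_square_less_1 not_less min_def not_le)
    moreover have "norm (h (x + y) - h x - sin y *\<^sub>R h1 x) \<le> B + B + 1 * B"
    proof -
      have "norm (sin y *\<^sub>R h1 x) \<le> 1 * B"
        unfolding norm_scaleR by (intro mult_mono bdd) auto
      moreover have "norm (h (x + y) - h x) \<le> B + B"
        by (intro norm_triangle_le_diff add_mono bdd)
      ultimately show ?thesis
        by (intro norm_triangle_le_diff) linarith
    qed
    ultimately show ?thesis by simp
  qed
qed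

section \<open>Bounds on the characteristic exponent and on truncated moments\<close>

locale levy_with_exponent = prob_space P for P :: "'a measure" +
  fixes M :: "real \<Rightarrow> 'a \<Rightarrow> real" and \<eta> :: "real \<Rightarrow> complex"
  assumes levy: "levy_process M"
    and char_M: "\<And>t \<xi>. 0 \<le> t \<Longrightarrow> expectation (\<lambda>\<omega>. iexp (\<xi> * M t \<omega>)) = exp (of_real t * \<eta> \<xi>)"
begin

lemma M_measurable [measurable]: "0 \<le> t \<Longrightarrow> M t \<in> borel_measurable P"
  using levy by (simp add: levy_process_def additive_process_def)

lemma AE_M_0: "AE \<omega> in P. M 0 \<omega> = 0"
  using levy by (simp add: levy_process_def additive_process_def)

lemma real_distribution_M: "0 \<le> t \<Longrightarrow> real_distribution (distr P borel (M t))"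
  by (intro real_distribution_distr) simp

lemma char_distr_M: "0 \<le> t \<Longrightarrow> char (distr P borel (M t)) \<xi> = exp (of_real t * \<eta> \<xi>)"
  by (simp add: char_def integral_distr char_M flip: of_real_mult)

text \<open>Levy's continuity theorem: \<open>exp (t * \<eta> \<xi>)\<close> is continuous in
  \<open>t\<close> for each \<xi>, so \<open>M (u n)\<close> converges in law. This covers all
  bounded continuous \<open>g\<close>, for which no rate in time is available.\<close>

lemma continuous_on_expectation_M:
  fixes g :: "real \<Rightarrow> 'b :: {banach, second_countable_topology}"
  assumes g: "\<And>x. isCont g x" "\<And>x. norm (g x) \<le> B"
  shows "continuous_on {0..} (\<lambda>z. expectation (\<lambda>\<omega>. g (M z \<omega>)))"
  unfolding continuous_on_sequentially comp_def
proof safe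
  fix u :: "nat \<Rightarrow> real" and z
  assume u: "\<forall>n. u n \<in> {0..}" "u \<longlonglongrightarrow> z" and z: "0 \<le> z"
  have u0: "0 \<le> u n" for n
    using u by auto
  have [measurable]: "g \<in> borel_measurable borel"
    using g by (intro borel_measurable_continuous_onI continuous_at_imp_continuous_on) auto
  have "weak_conv_m (\<lambda>n. distr P borel (M (u n))) (distr P borel (M z))"
  proof (rule levy_continuity)
    show "(\<lambda>n. char (distr P borel (M (u n))) t) \<longlonglongrightarrow> char (distr P borel (M z)) t" for t
      using u0 z u(2) by (simp add: char_distr_M) (intro tendsto_intros)
  qed (use real_distribution_M u0 z in auto)
  then have "(\<lambda>n. integral\<^sup>L (distr P borel (M (u n))) g) \<longlonglongrightarrow> integral\<^sup>L (distr P borel (M z)) g"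
    using real_distribution_M u0 z g
    by (intro weak_conv_imp_integral_bdd_continuous_conv) auto
  then show "(\<lambda>n. expectation (\<lambda>\<omega>. g (M (u n) \<omega>))) \<longlonglongrightarrow> expectation (\<lambda>\<omega>. g (M z \<omega>))"
    using u0 z by (simp add: integral_distr)
qed

lemma Re_exponent_nonpos: "Re (\<eta> \<xi>) \<le> 0"
proof -
  have "norm (char (distr P borel (M 1)) \<xi>) \<le> 1"
    by (intro real_distribution.cmod_char_le_1 real_distribution_M) simp
  then show ?thesis
    by (simp add: char_distr_M norm_exp_eq_Re)
qed

lemma norm_expectation_iexp_minus_one:
  assumes "0 \<le> z"
  shows "norm (expectation (\<lambda>\<omega>. iexp (\<xi> * M z \<omega>)) - 1) \<le> z * norm (\<eta> \<xi>)"
  unfolding char_M[OF assms]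
  using norm_exp_minus_one_le[of "of_real z * \<eta> \<xi>"] assms Re_exponent_nonpos[of \<xi>]
  by (simp add: norm_mult mult_nonneg_nonpos)

text \<open>Stochastic continuity at 0 keeps \<open>Re (exp (s * \<eta> \<xi>))\<close> above 1/2
  for all small \<open>s\<close>, uniformly in \<xi>. The modulus then bounds
  \<open>Re (\<eta> \<xi>)\<close>; the imaginary part is bounded because the curve in
  \<open>s\<close> must not rotate as far as the imaginary axis.\<close>

lemma exponent_bounded_near_0:
  obtains B where "\<And>\<xi>. \<xi> \<in> {0..1} \<Longrightarrow> norm (\<eta> \<xi>) \<le> B"
proof -
  have "((\<lambda>s. prob {\<omega> \<in> space P. \<bar>M s \<omega> - M 0 \<omega>\<bar> > 1/4}) \<longlongrightarrow> 0) (at 0 within {0..})"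
  proof -
    have "\<And>t \<epsilon>. 0 \<le> t \<Longrightarrow> 0 < \<epsilon> \<Longrightarrow>
        ((\<lambda>s. prob {\<omega> \<in> space P. \<bar>M s \<omega> - M t \<omega>\<bar> > \<epsilon>}) \<longlongrightarrow> 0) (at t within {0..})"
      using levy unfolding levy_process_def additive_process_def stochastically_continuous_def by blast
    from this[of 0 "1/4"] show ?thesis
      by (simp only: order_refl zero_less_divide_1_iff zero_less_numeral)
  qed
  then have "\<forall>\<^sub>F s in at 0 within {0..}. prob {\<omega> \<in> space P. \<bar>M s \<omega> - M 0 \<omega>\<bar> > 1/4} < 1/8"
    by (rule order_tendstoD) simp
  then obtain d where d: "d > 0" "\<And>s. 0 < s \<Longrightarrow> s < d \<Longrightarrow> prob {\<omega> \<in> space P. \<bar>M s \<omega> - M 0 \<omega>\<bar> > 1/4} < 1/8"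
    unfolding eventually_at by (auto simp: dist_real_def)
  define z0 where "z0 = d / 2"
  have z0: "0 < z0" "z0 < d"
    using d by (auto simp: z0_def)
  \<comment> \<open>On the small-deviation event \<open>\<bar>iexp - 1\<bar>\<close> is at most 1/4,
    elsewhere at most 2 with probability below 1/8; together at most 1/2.\<close>
  have Re_ge: "1 / 2 \<le> Re (exp (of_real s * \<eta> \<xi>))" if s: "0 < s" "s \<le> z0" and \<xi>: "\<xi> \<in> {0..1}" for s \<xi>
  proof -
    have [measurable]: "M s \<in> borel_measurable P" "M 0 \<in> borel_measurable P"
      using s by auto
    have int: "integrable P (\<lambda>\<omega>. iexp (\<xi> * M s \<omega>))"
      by (intro integrable_const_bound[of _ 1]) auto
    let ?A = "{\<omega> \<in> space P. \<bar>M s \<omega> - M 0 \<omega>\<bar> > 1/4}"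
    have "norm (expectation (\<lambda>\<omega>. iexp (\<xi> * M s \<omega>)) - 1) = norm (expectation (\<lambda>\<omega>. iexp (\<xi> * M s \<omega>) - 1))"
      using int by (simp add: prob_space)
    also have "\<dots> \<le> expectation (\<lambda>\<omega>. norm (iexp (\<xi> * M s \<omega>) - 1))"
      by (rule integral_norm_bound)
    also have "\<dots> \<le> expectation (\<lambda>\<omega>. 1 / 4 + 2 * indicator ?A \<omega>)"
    proof (rule integral_mono_AE)
      show "AE \<omega> in P. norm (iexp (\<xi> * M s \<omega>) - 1) \<le> 1 / 4 + 2 * indicator ?A \<omega>"
        using AE_M_0 AE_space
      proof eventually_elim
        case (elim \<omega>)
        have "norm (iexp (\<xi> * M s \<omega>) - 1) \<le> \<bar>\<xi> * M s \<omega>\<bar>"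
          using iexp_approx1[of "\<xi> * M s \<omega>" 0] by simp
        also have "\<dots> \<le> 1 * \<bar>M s \<omega>\<bar>"
          using \<xi> unfolding abs_mult by (intro mult_right_mono) auto
        finally have 1: "norm (iexp (\<xi> * M s \<omega>) - 1) \<le> \<bar>M s \<omega>\<bar>" by simp
        have "norm (iexp (\<xi> * M s \<omega>) - 1) \<le> 1 + 1"
          by (intro norm_triangle_le_diff) auto
        with 1 elim show ?case
          by (auto simp: indicator_def)
      qed
    qed (use int in \<open>auto intro!: integrable_const_bound[of _ 3] simp: indicator_def\<close>)
    also have "\<dots> = 1 / 4 + 2 * prob ?A"
    proof -
      have "integrable P (indicator ?A :: _ \<Rightarrow> real)"
        by (intro integrable_real_indicator) (auto simp: emeasure_eq_measure)
      then show ?thesis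
        by (subst Bochner_Integration.integral_add) (auto simp: prob_space intro!: arg_cong[where f = prob])
    qed
    also have "\<dots> \<le> 1 / 2"
      using d(2)[of s] s z0 by simp
    finally have "norm (exp (of_real s * \<eta> \<xi>) - 1) \<le> 1 / 2"
      unfolding char_M[OF less_imp_le[OF s(1)]] .
    then have "\<bar>Re (exp (of_real s * \<eta> \<xi>) - 1)\<bar> \<le> 1 / 2"
      using abs_Re_le_cmod order_trans by blast
    then show ?thesis
      unfolding minus_complex.sel one_complex.sel by linarith
  qed
  show ?thesis
  proof (rule that)
    fix \<xi> :: real assume \<xi>: "\<xi> \<in> {0..1}"
    have "1 / 2 \<le> exp (z0 * Re (\<eta> \<xi>)) * cos (z0 * Im (\<eta> \<xi>))"
      using Re_ge[of z0, OF _ _ \<xi>] z0 by (simp add: Re_exp)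
    also have "\<dots> \<le> exp (z0 * Re (\<eta> \<xi>)) * 1"
      by (intro mult_left_mono) auto
    finally have "exp (- ln 2) \<le> exp (z0 * Re (\<eta> \<xi>))"
      by (simp add: exp_minus)
    then have "- ln 2 \<le> z0 * Re (\<eta> \<xi>)"
      by simp
    then have "z0 * \<bar>Re (\<eta> \<xi>)\<bar> \<le> ln 2"
      using Re_exponent_nonpos[of \<xi>] by (simp add: abs_if)
    then have Re: "\<bar>Re (\<eta> \<xi>)\<bar> \<le> ln 2 / z0"
      using z0 by (simp add: field_simps)
    \<comment> \<open>Otherwise \<open>s * \<bar>Im (\<eta> \<xi>)\<bar>\<close> equals
      \<open>pi / 2\<close> for some \<open>s \<le> z0\<close>, where the real part is 0. All
      \<open>s\<close> up to \<open>z0\<close> are used here, not \<open>z0\<close> alone.\<close>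
    have Im: "\<bar>Im (\<eta> \<xi>)\<bar> \<le> pi / 2 / z0"
    proof (rule ccontr)
      assume "\<not> ?thesis"
      then have *: "pi / 2 / z0 < \<bar>Im (\<eta> \<xi>)\<bar>" by simp
      then have Im0: "0 < \<bar>Im (\<eta> \<xi>)\<bar>"
        using z0 pi_gt_zero by (smt (verit) divide_pos_pos)
      define s where "s = pi / 2 / \<bar>Im (\<eta> \<xi>)\<bar>"
      have s: "0 < s" "s \<le> z0"
        using Im0 * z0 by (auto simp: s_def field_simps)
      have "cos (s * Im (\<eta> \<xi>)) = cos \<bar>s * Im (\<eta> \<xi>)\<bar>"
        by (simp add: cos_abs_real)
      also have "\<bar>s * Im (\<eta> \<xi>)\<bar> = pi / 2"
        using s Im0 by (simp add: abs_mult s_def)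
      finally have "Re (exp (of_real s * \<eta> \<xi>)) = 0"
        by (simp add: Re_exp)
      with Re_ge[OF s \<xi>] show False by simp
    qed
    show "norm (\<eta> \<xi>) \<le> ln 2 / z0 + pi / 2 / z0"
      using cmod_le[of "\<eta> \<xi>"] Re Im by simp
  qed
qed

text \<open>Averaging \<open>1 - cos (\<xi> * M z)\<close> over \<xi> in [0, 1] dominates the
  truncated square up to the factor 8. Its expectation at fixed \<xi> is the real part of
  \<open>1 - exp (z * \<eta> \<xi>)\<close>, hence of order \<open>z\<close>.\<close>

lemma expectation_min_square_le:
  obtains K where "0 \<le> K" "\<And>z. 0 \<le> z \<Longrightarrow> expectation (\<lambda>\<omega>. min 1 ((M z \<omega>)\<^sup>2)) \<le> K * z"
proof -
  obtain B where B: "\<And>\<xi>. \<xi> \<in> {0..1} \<Longrightarrow> norm (\<eta> \<xi>) \<le> B"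
    using exponent_bounded_near_0 by blast
  have B0: "0 \<le> B"
    using order_trans[OF norm_ge_zero B[of 0]] by simp
  show ?thesis
  proof (rule that)
    show "0 \<le> 8 * B" using B0 by simp
    fix z :: real assume z: "0 \<le> z"
    then have [measurable]: "M z \<in> borel_measurable P" by simp
    have "(\<integral>\<^sup>+\<omega>. ennreal (min 1 ((M z \<omega>)\<^sup>2)) \<partial>P)
        \<le> (\<integral>\<^sup>+\<omega>. 8 * (\<integral>\<^sup>+\<xi>. ennreal (1 - cos (\<xi> * M z \<omega>)) * indicator {0..1} \<xi> \<partial>lborel) \<partial>P)"
    proof (rule nn_integral_mono)
      fix \<omega>
      show "ennreal (min 1 ((M z \<omega>)\<^sup>2)) \<le> 8 * (\<integral>\<^sup>+\<xi>. ennreal (1 - cos (\<xi> * M z \<omega>)) * indicator {0..1} \<xi> \<partial>lborel)"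
      proof (cases "M z \<omega> = 0")
        case False
        have "ennreal (min 1 ((M z \<omega>)\<^sup>2)) \<le> ennreal (8 * (1 - sin (M z \<omega>) / M z \<omega>))"
          by (intro ennreal_leI min_one_square_le_sinc False)
        also have "\<dots> = 8 * ennreal (1 - sin (M z \<omega>) / M z \<omega>)"
          by (subst ennreal_mult') auto
        finally show ?thesis
          by (simp add: nn_integral_one_minus_cos[OF False])
      qed simp
    qed
    also have "\<dots> = 8 * (\<integral>\<^sup>+\<omega>. (\<integral>\<^sup>+\<xi>. ennreal (1 - cos (\<xi> * M z \<omega>)) * indicator {0..1} \<xi> \<partial>lborel) \<partial>P)"
      by (rule nn_integral_cmult) measurable
    also have "(\<integral>\<^sup>+\<omega>. (\<integral>\<^sup>+\<xi>. ennreal (1 - cos (\<xi> * M z \<omega>)) * indicator {0..1} \<xi> \<partial>lborel) \<partial>P)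
       = (\<integral>\<^sup>+\<xi>. (\<integral>\<^sup>+\<omega>. ennreal (1 - cos (\<xi> * M z \<omega>)) * indicator {0..1} \<xi> \<partial>P) \<partial>lborel)"
    proof -
      interpret pair_sigma_finite P lborel ..
      show ?thesis
        by (rule Fubini'[symmetric]) measurable
    qed
    \<comment> \<open>The constant \<open>B\<close> replaces \<open>norm (\<eta> \<xi>)\<close>
      before integrating in \<xi>, as no measurability of \<open>\<eta>\<close> has been
      established.\<close>
    also have "\<dots> \<le> (\<integral>\<^sup>+\<xi>. ennreal (z * B) * indicator {0..1::real} \<xi> \<partial>lborel)"
    proof (rule nn_integral_mono)
      fix \<xi> :: real
      have "(\<integral>\<^sup>+\<omega>. ennreal (1 - cos (\<xi> * M z \<omega>)) \<partial>P) \<le> ennreal (z * B)" if \<xi>: "\<xi> \<in> {0..1}"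
      proof -
        have int: "integrable P (\<lambda>\<omega>. iexp (\<xi> * M z \<omega>))" "integrable P (\<lambda>\<omega>. cos (\<xi> * M z \<omega>))"
          by (intro integrable_const_bound[of _ 1]; auto)+
        have "(\<integral>\<^sup>+\<omega>. ennreal (1 - cos (\<xi> * M z \<omega>)) \<partial>P) = ennreal (expectation (\<lambda>\<omega>. 1 - cos (\<xi> * M z \<omega>)))"
          using int by (intro nn_integral_eq_integral) auto
        also have "expectation (\<lambda>\<omega>. 1 - cos (\<xi> * M z \<omega>)) = Re (1 - expectation (\<lambda>\<omega>. iexp (\<xi> * M z \<omega>)))"
          using int by (simp add: prob_space Re_exp flip: integral_Re)
        also have "\<dots> \<le> norm (expectation (\<lambda>\<omega>. iexp (\<xi> * M z \<omega>)) - 1)"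
          unfolding norm_minus_commute[of _ 1] by (rule complex_Re_le_cmod)
        also have "\<dots> \<le> z * norm (\<eta> \<xi>)"
          using z by (rule norm_expectation_iexp_minus_one)
        also have "\<dots> \<le> z * B"
          using z B[OF \<xi>] by (rule mult_left_mono[rotated])
        finally show ?thesis
          by (simp add: ennreal_leI)
      qed
      then show "(\<integral>\<^sup>+\<omega>. ennreal (1 - cos (\<xi> * M z \<omega>)) * indicator {0..1} \<xi> \<partial>P) \<le> ennreal (z * B) * indicator {0..1} \<xi>"
        by (auto simp: indicator_def)
    qed
    also have "\<dots> = ennreal (z * B)"
      by (simp add: nn_integral_cmult)
    finally have "(\<integral>\<^sup>+\<omega>. ennreal (min 1 ((M z \<omega>)\<^sup>2)) \<partial>P) \<le> 8 * ennreal (z * B)"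
      by (simp add: mult_left_mono)
    also have "\<dots> = ennreal (8 * B * z)"
      using z B0 ennreal_mult'[of 8 "z * B"] by (simp add: mult_ac)
    finally show "expectation (\<lambda>\<omega>. min 1 ((M z \<omega>)\<^sup>2)) \<le> 8 * B * z"
      using z B0 by (subst integral_eq_nn_integral) (auto intro!: enn2real_leI)
  qed
qed

text \<open>The drift is captured by \<^term>\<open>sin\<close> rather than by a truncated identity because
  its expectation is read off the characteristic function at \<^term>\<open>1::real\<close>.\<close>

lemma norm_expectation_sin_le:
  assumes "0 \<le> z"
  shows "\<bar>expectation (\<lambda>\<omega>. sin (M z \<omega>))\<bar> \<le> z * norm (\<eta> 1)"
proof -
  have [measurable]: "M z \<in> borel_measurable P" using assms by simp
  have int: "integrable P (\<lambda>\<omega>. iexp (1 * M z \<omega>))"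
    by (intro integrable_const_bound[of _ 1]) auto
  have "expectation (\<lambda>\<omega>. sin (M z \<omega>)) = Im (expectation (\<lambda>\<omega>. iexp (1 * M z \<omega>)) - 1)"
    using int by (simp add: Im_exp flip: integral_Im)
  also have "\<bar>\<dots>\<bar> \<le> norm (expectation (\<lambda>\<omega>. iexp (1 * M z \<omega>)) - 1)"
    by (rule abs_Im_le_cmod)
  also have "\<dots> \<le> z * norm (\<eta> 1)"
    using assms by (rule norm_expectation_iexp_minus_one)
  finally show ?thesis .
qed

end

lemma schwartz_derivativesE:
  assumes "h \<in> schwartz"
  obtains h1 h2 B where
    "\<And>x. (h has_vector_derivative h1 x) (at x)" "\<And>x. (h1 has_vector_derivative h2 x) (at x)"
    "\<And>x. norm (h x) \<le> B" "\<And>x. norm (h1 x) \<le> B" "\<And>x. norm (h2 x) \<le> B"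
proof -
  have diff: "(iter_deriv n h has_vector_derivative iter_deriv (Suc n) h x) (at x)" for n x
    using assms by (auto simp: schwartz_def iter_deriv_def vector_derivative_works[symmetric])
  have "\<exists>B. \<forall>x. norm (iter_deriv n h x) \<le> B" for n
  proof -
    have "\<forall>m n. bounded (range (\<lambda>x. x ^ m *\<^sub>R iter_deriv n h x))"
      using assms by (simp add: schwartz_def)
    then have "bounded (range (\<lambda>x. x ^ 0 *\<^sub>R iter_deriv n h x))"
      by blast
    then show ?thesis
      by (auto simp: bounded_iff)
  qed
  then obtain B where B: "\<And>n x. norm (iter_deriv n h x) \<le> B n"
    by metis
  show ?thesis
  proof (rule that)
    show "(h has_vector_derivative iter_deriv 1 h x) (at x)" for x
      using diff[of 0 x] by (simp add: iter_deriv_def)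
    show "(iter_deriv 1 h has_vector_derivative iter_deriv 2 h x) (at x)" for x
      using diff[of 1 x] by (simp add: numeral_2_eq_2)
    show "norm (h x) \<le> max (B 0) (max (B 1) (B 2))" for x
      using B[of 0 x] by (simp add: iter_deriv_def le_max_iff_disj)
  qed (use B in \<open>auto simp: le_max_iff_disj\<close>)
qed

section \<open>Independence and expectations of products\<close>

context prob_space
begin

lemma expectation_prod_increments:
  fixes g :: "nat \<Rightarrow> real \<Rightarrow> 'b :: {real_normed_field, banach, second_countable_topology}"
  assumes X: "independent_increments X"
    and t: "0 \<le> t 0" "\<And>i. i < n \<Longrightarrow> t i < t (Suc i)"
    and g: "\<And>i. i < n \<Longrightarrow> g i \<in> borel_measurable borel" "\<And>i x. i < n \<Longrightarrow> norm (g i x) \<le> B i"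
  shows "expectation (\<lambda>\<omega>. \<Prod>i<n. g i (X (t (Suc i)) \<omega> - X (t i) \<omega>))
      = (\<Prod>i<n. expectation (\<lambda>\<omega>. g i (X (t (Suc i)) \<omega> - X (t i) \<omega>)))"
proof (rule indep_vars_lebesgue_integral)
  have iv: "indep_vars (\<lambda>_. borel) (\<lambda>i \<omega>. X (t (Suc i)) \<omega> - X (t i) \<omega>) {..<n}"
    using X t unfolding independent_increments_def by blast
  then show "indep_vars (\<lambda>_. borel) (\<lambda>i \<omega>. g i (X (t (Suc i)) \<omega> - X (t i) \<omega>)) {..<n}"
    using g by (intro indep_vars_compose2[OF iv]) auto
  fix i assume i: "i \<in> {..<n}"
  then have [measurable]: "(\<lambda>\<omega>. X (t (Suc i)) \<omega> - X (t i) \<omega>) \<in> borel_measurable M" "g i \<in> borel_measurable borel"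
    using iv g by (auto simp: indep_vars_def)
  show "integrable M (\<lambda>\<omega>. g i (X (t (Suc i)) \<omega> - X (t i) \<omega>))"
    using g i by (intro integrable_const_bound[of _ "B i"]) auto
qed simp

text \<open>Closed sets form an intersection-stable generator, and their indicators are limits of
  the continuous functions \<open>1 - k * infdist\<close>, truncated at 0. Continuous test functions
  are the ones that survive the passage from grid times to random times.\<close>

lemma indep_vars_borel_if_expectation_prod:
  fixes X :: "nat \<Rightarrow> 'a \<Rightarrow> real"
  assumes rv: "\<And>i. i < n \<Longrightarrow> random_variable borel (X i)"
    and prod: "\<And>g :: nat \<Rightarrow> real \<Rightarrow> real. (\<And>i x. isCont (g i) x) \<Longrightarrow> (\<And>i x. norm (g i x) \<le> 1) \<Longrightarrow>
      expectation (\<lambda>\<omega>. \<Prod>i<n. g i (X i \<omega>)) = (\<Prod>i<n. expectation (\<lambda>\<omega>. g i (X i \<omega>)))"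
  shows "indep_vars (\<lambda>_. borel) X {..<n}"
\<comment> \<open>An intersection over the empty index set would be the whole type instead of
  \<open>space M\<close>.\<close>
proof (cases "n = 0")
  case True
  then show ?thesis
    by (simp add: indep_vars_def indep_sets_def)
next
  case False
  show ?thesis
  proof (subst indep_vars_finite[where E = "\<lambda>_. Collect closed"])
    show "sets borel = sigma_sets (space borel) (Collect closed :: real set set)"
      by (simp add: borel_eq_closed)
    show "Int_stable (Collect closed :: real set set)"
      by (auto simp: Int_stable_def)
    show "\<forall>A\<in>{..<n} \<rightarrow> Collect closed. prob (\<Inter>j\<in>{..<n}. X j -` A j \<inter> space M)
        = (\<Prod>j\<in>{..<n}. prob (X j -` A j \<inter> space M))"
    proof
      fix A assume "A \<in> {..<n} \<rightarrow> (Collect closed :: real set set)"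
      then have A: "closed (A i)" if "i < n" for i
        using that by auto
      \<comment> \<open>The empty set is separated because \<open>infdist y {}\<close> is 0 by
        convention, which would yield the constant 1.\<close>
      define g where "g k i y = (if A i = {} then 0 else max 0 (1 - real k * infdist y (A i)))" for k i and y :: real
      have cont: "isCont (g k i) x" for k i x
        unfolding g_def by (cases "A i = {}") (auto intro!: continuous_intros continuous_infdist)
      have bdd: "norm (g k i x) \<le> 1" for k i x
        by (auto simp: g_def infdist_nonneg)
      have lim: "(\<lambda>k. g k i y) \<longlonglongrightarrow> indicator (A i) y" if "i < n" for i y
      proof (cases "y \<in> A i")
        case True
        then have "A i \<noteq> {}" by auto
        with True show ?thesis by (simp add: g_def)
      next
        case False
        have "\<forall>\<^sub>F k in sequentially. g k i y = 0"
        proof (cases "A i = {}")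
          case ne: False
          then have pos: "infdist y (A i) > 0"
            using A[OF that] False in_closed_iff_infdist_zero[of "A i" y] infdist_nonneg[of y "A i"] by fastforce
          obtain k0 :: nat where "1 / infdist y (A i) < k0"
            using reals_Archimedean2 by blast
          then have "g k i y = 0" if "k \<ge> k0" for k
            using that pos ne by (simp add: g_def divide_less_eq max_def)
              (smt (verit) mult_right_mono of_nat_mono)
          then show ?thesis
            by (auto simp: eventually_sequentially)
        qed (simp add: g_def)
        then show ?thesis
          using False by (simp add: tendsto_eventually)
      qed
      have g_meas: "g k i \<in> borel_measurable borel" for k i
        using cont by (intro borel_measurable_continuous_onI continuous_at_imp_continuous_on) auto
      have ind_meas: "(\<lambda>\<omega>. indicat_real (A i) (X i \<omega>) :: real) \<in> borel_measurable M" if "i < n" for i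
        using measurable_compose[OF rv[OF that] borel_measurable_indicator[OF borel_closed[OF A[OF that]]]] .
      have gX_meas: "(\<lambda>\<omega>. g k i (X i \<omega>)) \<in> borel_measurable M" if "i < n" for k i
        using rv[OF that] g_meas by measurable
      have "(\<lambda>k. expectation (\<lambda>\<omega>. \<Prod>i<n. g k i (X i \<omega>))) \<longlonglongrightarrow> expectation (\<lambda>\<omega>. \<Prod>i<n. indicat_real (A i) (X i \<omega>))"
      proof (rule integral_dominated_convergence[where w = "\<lambda>_. 1"])
        show "AE \<omega> in M. norm (\<Prod>i<n. g k i (X i \<omega>)) \<le> 1" for k
        proof (rule AE_I2)
          show "norm (\<Prod>i<n. g k i (X i \<omega>)) \<le> 1" for \<omega>
            unfolding prod_norm[symmetric] by (intro prod_le_1) (use bdd in auto)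
        qed
        show "AE \<omega> in M. (\<lambda>k. \<Prod>i<n. g k i (X i \<omega>)) \<longlonglongrightarrow> (\<Prod>i<n. indicat_real (A i) (X i \<omega>))"
          by (intro AE_I2 tendsto_prod lim) auto
      qed (use ind_meas gX_meas in \<open>auto intro!: borel_measurable_prod\<close>)
      moreover have "expectation (\<lambda>\<omega>. \<Prod>i<n. g k i (X i \<omega>)) = (\<Prod>i<n. expectation (\<lambda>\<omega>. g k i (X i \<omega>)))" for k
        using cont bdd by (rule prod)
      moreover have "(\<lambda>k. \<Prod>i<n. expectation (\<lambda>\<omega>. g k i (X i \<omega>))) \<longlonglongrightarrow> (\<Prod>i<n. expectation (\<lambda>\<omega>. indicat_real (A i) (X i \<omega>)))"
      proof (intro tendsto_prod)
        fix i assume "i \<in> {..<n}"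
        then show "(\<lambda>k. expectation (\<lambda>\<omega>. g k i (X i \<omega>))) \<longlonglongrightarrow> expectation (\<lambda>\<omega>. indicat_real (A i) (X i \<omega>))"
          using bdd lim ind_meas gX_meas by (intro integral_dominated_convergence[where w = "\<lambda>_. 1"]) auto
      qed
      ultimately have "expectation (\<lambda>\<omega>. \<Prod>i<n. indicat_real (A i) (X i \<omega>)) = (\<Prod>i<n. expectation (\<lambda>\<omega>. indicat_real (A i) (X i \<omega>)))"
        by (simp add: LIMSEQ_unique)
      moreover have "expectation (\<lambda>\<omega>. \<Prod>i<n. indicat_real (A i) (X i \<omega>)) = prob (\<Inter>j\<in>{..<n}. X j -` A j \<inter> space M)"
      proof -
        have "expectation (\<lambda>\<omega>. \<Prod>i<n. indicat_real (A i) (X i \<omega>)) = expectation (indicat_real (\<Inter>j\<in>{..<n}. X j -` A j \<inter> space M))"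
          using False by (intro Bochner_Integration.integral_cong refl) (auto simp: indicator_def prod_zero_iff)
        also have "\<dots> = prob ((\<Inter>j\<in>{..<n}. X j -` A j \<inter> space M) \<inter> space M)"
          by (rule Bochner_Integration.integral_indicator)
        also have "(\<Inter>j\<in>{..<n}. X j -` A j \<inter> space M) \<inter> space M = (\<Inter>j\<in>{..<n}. X j -` A j \<inter> space M)"
          using False by (intro Int_absorb2 INF_lower2[of 0]) auto
        finally show ?thesis .
      qed
      moreover have "expectation (\<lambda>\<omega>. indicat_real (A i) (X i \<omega>)) = prob (X i -` A i \<inter> space M)" for i
      proof -
        have "expectation (\<lambda>\<omega>. indicat_real (A i) (X i \<omega>)) = expectation (indicat_real (X i -` A i \<inter> space M))"
          by (intro Bochner_Integration.integral_cong refl) (auto simp: indicator_def)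
        then show ?thesis by simp
      qed
      ultimately show "prob (\<Inter>j\<in>{..<n}. X j -` A j \<inter> space M) = (\<Prod>j\<in>{..<n}. prob (X j -` A j \<inter> space M))"
        by simp
    qed
  qed (use False rv in auto)
qed

end

section \<open>Lipschitz dependence of the semigroup on time\<close>

context levy_with_exponent
begin

lemma expectation_M_increment:
  fixes g :: "real \<Rightarrow> 'b :: {banach, second_countable_topology}"
  assumes "0 \<le> s" "s \<le> t" and [measurable]: "g \<in> borel_measurable borel"
  shows "expectation (\<lambda>\<omega>. g (M t \<omega> - M s \<omega>)) = expectation (\<lambda>\<omega>. g (M (t - s) \<omega>))"
proof -
  have [measurable]: "M t \<in> borel_measurable P" "M s \<in> borel_measurable P" "M (t - s) \<in> borel_measurable P"
    using assms by auto
  have "distr P borel (\<lambda>\<omega>. M t \<omega> - M s \<omega>) = distr P borel (M (t - s))"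
    using levy assms by (simp add: levy_process_def stationary_increments_def)
  then have "integral\<^sup>L (distr P borel (\<lambda>\<omega>. M t \<omega> - M s \<omega>)) g = integral\<^sup>L (distr P borel (M (t - s))) g"
    by simp
  then show ?thesis
    by (simp add: integral_distr)
qed

lemma expectation_prod_M_increments:
  fixes g :: "nat \<Rightarrow> real \<Rightarrow> 'b :: {real_normed_field, banach, second_countable_topology}"
  assumes t: "0 \<le> t 0" "\<And>i. i < n \<Longrightarrow> t i < t (Suc i)"
    and g: "\<And>i. i < n \<Longrightarrow> g i \<in> borel_measurable borel" "\<And>i x. i < n \<Longrightarrow> norm (g i x) \<le> B i"
  shows "expectation (\<lambda>\<omega>. \<Prod>i<n. g i (M (t (Suc i)) \<omega> - M (t i) \<omega>))
      = (\<Prod>i<n. expectation (\<lambda>\<omega>. g i (M (t (Suc i) - t i) \<omega>)))"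
proof -
  have t0: "0 \<le> t i" if "i \<le> n" for i
    using that
  proof (induction i)
    case (Suc i)
    then show ?case using t(2)[of i] by simp
  qed (use t in simp)
  have "expectation (\<lambda>\<omega>. \<Prod>i<n. g i (M (t (Suc i)) \<omega> - M (t i) \<omega>))
      = (\<Prod>i<n. expectation (\<lambda>\<omega>. g i (M (t (Suc i)) \<omega> - M (t i) \<omega>)))"
    using levy t g by (intro expectation_prod_increments) (auto simp: levy_process_def additive_process_def)
  also have "\<dots> = (\<Prod>i<n. expectation (\<lambda>\<omega>. g i (M (t (Suc i) - t i) \<omega>)))"
    using t0 t g by (intro prod.cong refl expectation_M_increment) (auto intro: less_imp_le)
  finally show ?thesis .
qed

text \<open>Expand around \<open>X = x + M w\<close> in the increment \<open>D\<close>. By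
  independence the first-order term factors into \<open>E (sin D)\<close>, of order
  \<open>z\<close>, and a bounded factor; the remainder is controlled by
  \<open>E (min 1 D\<^sup>2)\<close>. Nothing depends on \<open>w\<close> or \<open>x\<close>. The
  case \<open>w = 0\<close> gives the linear bound at 0.\<close>

lemma semigroup_Lipschitz:
  assumes "h \<in> schwartz"
  obtains C where "0 \<le> C"
    "\<And>x w z. 0 \<le> w \<Longrightarrow> 0 \<le> z \<Longrightarrow> norm (semigroup_of M (w + z) h x - semigroup_of M w h x) \<le> C * z"
proof -
  obtain h1 h2 B where h: "\<And>x. (h has_vector_derivative h1 x) (at x)" "\<And>x. (h1 has_vector_derivative h2 x) (at x)"
    and bdd: "\<And>x. norm (h x) \<le> B" "\<And>x. norm (h1 x) \<le> B" "\<And>x. norm (h2 x) \<le> B"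
    using schwartz_derivativesE[OF assms] by blast
  have B: "0 \<le> B"
    using order_trans[OF norm_ge_zero bdd(1)] .
  obtain K where K: "0 \<le> K" "\<And>z. 0 \<le> z \<Longrightarrow> expectation (\<lambda>\<omega>. min 1 ((M z \<omega>)\<^sup>2)) \<le> K * z"
    using expectation_min_square_le by blast
  have [measurable]: "h \<in> borel_measurable borel" "h1 \<in> borel_measurable borel"
    using h by (auto intro!: borel_measurable_continuous_onI continuous_at_imp_continuous_on has_vector_derivative_continuous)
  show ?thesis
  proof (rule that)
    show "0 \<le> norm (\<eta> 1) * B + 3 * B * K"
      using B K by simp
    fix x w z :: real assume w: "0 \<le> w" and z: "0 \<le> z"
    have [measurable]: "M w \<in> borel_measurable P" "M z \<in> borel_measurable P" "M (w + z) \<in> borel_measurable P" "M 0 \<in> borel_measurable P"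
      using w z by auto
    define D where "D \<omega> = M (w + z) \<omega> - M w \<omega>" for \<omega>
    define X where "X \<omega> = x + M w \<omega>" for \<omega>
    have [measurable]: "D \<in> borel_measurable P" "X \<in> borel_measurable P"
      by (auto simp: D_def[abs_def] X_def[abs_def])
    have D_distr: "expectation (\<lambda>\<omega>. f (D \<omega>)) = expectation (\<lambda>\<omega>. f (M z \<omega>))" 
      if "f \<in> borel_measurable borel" for f :: "real \<Rightarrow> 'b :: {banach, second_countable_topology}"
      using expectation_M_increment[of w "w + z" f] that w z by (simp add: D_def)
    have int: "integrable P (\<lambda>\<omega>. h (X \<omega> + D \<omega>))" "integrable P (\<lambda>\<omega>. h (X \<omega>))"
      using bdd by (auto intro!: integrable_const_bound[of _ B])
    have int1: "integrable P (\<lambda>\<omega>. sin (D \<omega>) *\<^sub>R h1 (X \<omega>))"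
    proof (intro integrable_const_bound[of _ "1 * B"] AE_I2)
      show "norm (sin (D \<omega>) *\<^sub>R h1 (X \<omega>)) \<le> 1 * B" for \<omega>
        unfolding norm_scaleR by (intro mult_mono bdd) auto
    qed measurable
    have indep: "expectation (\<lambda>\<omega>. sin (D \<omega>) *\<^sub>R h1 (X \<omega>)) = expectation (\<lambda>\<omega>. sin (D \<omega>)) *\<^sub>R expectation (\<lambda>\<omega>. h1 (X \<omega>))"
    proof -
      \<comment> \<open>Independence of increments is available only for strictly increasing times,
        so degenerate increments are treated by hand.\<close>
      consider "z = 0" | "w = 0" | "0 < w" "0 < z"
        using w z by linarith
      then show ?thesis
      proof cases
        case 1
        then show ?thesis by (simp add: D_def)
      next
        case 2
        then have "AE \<omega> in P. X \<omega> = x"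
          using AE_M_0 by (auto simp: X_def elim: eventually_mono)
        then have "expectation (\<lambda>\<omega>. sin (D \<omega>) *\<^sub>R h1 (X \<omega>)) = expectation (\<lambda>\<omega>. sin (D \<omega>) *\<^sub>R h1 x)"
          and "expectation (\<lambda>\<omega>. h1 (X \<omega>)) = expectation (\<lambda>\<omega>. h1 x)"
          by (intro integral_cong_AE; auto elim: eventually_mono)+
        moreover have "integrable P (\<lambda>\<omega>. sin (D \<omega>))"
          by (auto intro!: integrable_const_bound[of _ 1])
        ultimately show ?thesis
          by (simp add: prob_space)
      next
        case 3
        \<comment> \<open>Times 0, \<open>w\<close>, \<open>w + z\<close>. The sine is embedded into
          the complex numbers because all factors share one type; \<open>M 0\<close> vanishes almost
          surely.\<close>
        define t where "t i = (if i = 0 then 0 else if i = 1 then w else w + z)" for i :: nat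
        define g where "g i y = (if i = 0 then h1 (x + y) else complex_of_real (sin y))" for i :: nat and y
        have "expectation (\<lambda>\<omega>. \<Prod>i<2. g i (M (t (Suc i)) \<omega> - M (t i) \<omega>)) = (\<Prod>i<2. expectation (\<lambda>\<omega>. g i (M (t (Suc i) - t i) \<omega>)))"
        proof (rule expectation_prod_M_increments)
          show "norm (g i y) \<le> max B 1" for i y
            using bdd(2)[of "x + y"] by (auto simp: g_def le_max_iff_disj)
          show "g i \<in> borel_measurable borel" for i
            unfolding g_def by (cases "i = 0") auto
        qed (use 3 in \<open>auto simp: t_def\<close>)
        then have "expectation (\<lambda>\<omega>. h1 (x + (M w \<omega> - M 0 \<omega>)) * of_real (sin (D \<omega>))) = expectation (\<lambda>\<omega>. h1 (X \<omega>)) * expectation (\<lambda>\<omega>. of_real (sin (M z \<omega>)))"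
          by (simp add: g_def t_def numeral_2_eq_2 D_def X_def)
        also have "expectation (\<lambda>\<omega>. of_real (sin (M z \<omega>))) = complex_of_real (expectation (\<lambda>\<omega>. sin (D \<omega>)))"
          using D_distr[of sin] by simp
        also have "expectation (\<lambda>\<omega>. h1 (x + (M w \<omega> - M 0 \<omega>)) * of_real (sin (D \<omega>))) = expectation (\<lambda>\<omega>. sin (D \<omega>) *\<^sub>R h1 (X \<omega>))"
          using AE_M_0 by (intro integral_cong_AE) (auto simp: X_def scaleR_conv_of_real mult.commute elim!: eventually_mono)
        finally show ?thesis
          by (simp add: scaleR_conv_of_real mult.commute)
      qed
    qed
    have "semigroup_of M (w + z) h x - semigroup_of M w h x = expectation (\<lambda>\<omega>. h (X \<omega> + D \<omega>)) - expectation (\<lambda>\<omega>. h (X \<omega>))"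
      by (simp add: semigroup_of_def X_def D_def)
    also have "\<dots> = expectation (\<lambda>\<omega>. sin (D \<omega>) *\<^sub>R h1 (X \<omega>)) + expectation (\<lambda>\<omega>. h (X \<omega> + D \<omega>) - h (X \<omega>) - sin (D \<omega>) *\<^sub>R h1 (X \<omega>))"
      using int int1 by simp
    also have "norm \<dots> \<le> norm (\<eta> 1) * B * z + 3 * B * K * z"
    proof (rule norm_triangle_mono)
      have "\<bar>expectation (\<lambda>\<omega>. sin (D \<omega>))\<bar> \<le> z * norm (\<eta> 1)"
        using norm_expectation_sin_le[OF z] D_distr[of sin] by simp
      moreover have "norm (expectation (\<lambda>\<omega>. h1 (X \<omega>))) \<le> B"
      proof -
        have "norm (expectation (\<lambda>\<omega>. h1 (X \<omega>))) \<le> expectation (\<lambda>\<omega>. norm (h1 (X \<omega>)))"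
          by (rule integral_norm_bound)
        also have "\<dots> \<le> expectation (\<lambda>\<omega>. B)"
          using bdd B by (intro integral_mono integrable_const_bound[of _ B]) auto
        finally show ?thesis by (simp add: prob_space)
      qed
      ultimately have "norm (expectation (\<lambda>\<omega>. sin (D \<omega>) *\<^sub>R h1 (X \<omega>))) \<le> (z * norm (\<eta> 1)) * B"
        unfolding indep norm_scaleR using z by (intro mult_mono) auto
      then show "norm (expectation (\<lambda>\<omega>. sin (D \<omega>) *\<^sub>R h1 (X \<omega>))) \<le> norm (\<eta> 1) * B * z"
        by (simp only: mult_ac)
    next
      have "norm (expectation (\<lambda>\<omega>. h (X \<omega> + D \<omega>) - h (X \<omega>) - sin (D \<omega>) *\<^sub>R h1 (X \<omega>)))
          \<le> expectation (\<lambda>\<omega>. norm (h (X \<omega> + D \<omega>) - h (X \<omega>) - sin (D \<omega>) *\<^sub>R h1 (X \<omega>)))"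
        by (rule integral_norm_bound)
      also have "\<dots> \<le> expectation (\<lambda>\<omega>. 3 * B * min 1 ((D \<omega>)\<^sup>2))"
      proof (rule integral_mono)
        show "norm (h (X \<omega> + D \<omega>) - h (X \<omega>) - sin (D \<omega>) *\<^sub>R h1 (X \<omega>)) \<le> 3 * B * min 1 ((D \<omega>)\<^sup>2)" for \<omega>
          by (rule norm_diff_le_sin_Taylor[OF h bdd])
        show "integrable P (\<lambda>\<omega>. 3 * B * min 1 ((D \<omega>)\<^sup>2))"
          by (intro integrable_mult_right integrable_const_bound[of _ 1]) auto
      qed (use int int1 in auto)
      also have "\<dots> = 3 * B * expectation (\<lambda>\<omega>. min 1 ((M z \<omega>)\<^sup>2))"
        using D_distr[of "\<lambda>y. min 1 (y\<^sup>2)"] by simp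
      also have "\<dots> \<le> 3 * B * (K * z)"
        using B K z by (intro mult_left_mono) auto
      finally show "norm (expectation (\<lambda>\<omega>. h (X \<omega> + D \<omega>) - h (X \<omega>) - sin (D \<omega>) *\<^sub>R h1 (X \<omega>))) \<le> 3 * B * K * z"
        by (simp add: mult_ac)
    qed
    also have "\<dots> = (norm (\<eta> 1) * B + 3 * B * K) * z"
      by (simp add: algebra_simps)
    finally show "norm (semigroup_of M (w + z) h x - semigroup_of M w h x) \<le> (norm (\<eta> 1) * B + 3 * B * K) * z" .
  qed
qed

end

subsection \<open>Subordination\<close>

locale subordinated_levy = levy_with_exponent P M \<eta> for P :: "'a measure" and M \<eta> +
  fixes H :: "real \<Rightarrow> 'a \<Rightarrow> real"
  assumes subordinator: "inhomogeneous_subordinator H"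
    and indep: "independent_processes M H"
    and MH_measurable': "\<And>t. 0 \<le> t \<Longrightarrow> (\<lambda>\<omega>. M (H t \<omega>) \<omega>) \<in> borel_measurable P"
begin

definition MH :: "real \<Rightarrow> 'a \<Rightarrow> real" where
  "MH t \<omega> = M (H t \<omega>) \<omega>"

text \<open>The clipping \<open>max 0 z\<close> extends the function constantly to negative
  arguments. It becomes continuous on the whole line, so it can be composed with increments of
  \<open>H\<close>, which are nonnegative only almost surely.\<close>

definition average :: "(real \<Rightarrow> 'b :: {banach, second_countable_topology}) \<Rightarrow> real \<Rightarrow> 'b" where
  "average g z = expectation (\<lambda>\<omega>. g (M (max 0 z) \<omega>))"

lemma MH_measurable [measurable]: "0 \<le> t \<Longrightarrow> MH t \<in> borel_measurable P"
  using MH_measurable' by (simp add: MH_def[abs_def])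

lemma H_measurable [measurable]: "0 \<le> t \<Longrightarrow> H t \<in> borel_measurable P"
  using subordinator by (simp add: inhomogeneous_subordinator_def additive_process_def)

lemma AE_H_mono: "AE \<omega> in P. \<forall>s t. 0 \<le> s \<longrightarrow> s \<le> t \<longrightarrow> H s \<omega> \<le> H t \<omega>"
  using subordinator by (simp add: inhomogeneous_subordinator_def)

lemma AE_H_0: "AE \<omega> in P. H 0 \<omega> = 0"
  using subordinator by (simp add: inhomogeneous_subordinator_def additive_process_def)

lemma AE_H_nonneg: "AE \<omega> in P. \<forall>t\<ge>0. 0 \<le> H t \<omega>"
  using AE_H_mono AE_H_0
proof eventually_elim
  case (elim \<omega>)
  then have "H 0 \<omega> \<le> H t \<omega>" if "0 \<le> t" for t
    using that by blast
  with elim(2) show ?case by simp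
qed

lemma AE_M_right_continuous: "AE \<omega> in P. \<forall>t\<ge>0. ((\<lambda>s. M s \<omega>) \<longlongrightarrow> M t \<omega>) (at_right t)"
  using levy unfolding levy_process_def cadlag_paths_def continuous_within
  by (auto elim: eventually_mono)

lemma isCont_average:
  assumes g: "\<And>x. isCont g x" "\<And>x. norm (g x) \<le> B"
  shows "isCont (average g) z"
proof -
  have "continuous_on UNIV (\<lambda>z. expectation (\<lambda>\<omega>. g (M (max 0 z) \<omega>)))"
    by (rule continuous_on_compose2[OF continuous_on_expectation_M[OF g]]) (auto intro!: continuous_intros)
  then show ?thesis
    by (simp add: average_def[abs_def] continuous_on_eq_continuous_at)
qed

lemma norm_average_le:
  assumes g: "\<And>x. isCont g x" "\<And>x. norm (g x) \<le> B"
  shows "norm (average g z) \<le> B"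
proof -
  have [measurable]: "g \<in> borel_measurable borel"
    using g by (intro borel_measurable_continuous_onI continuous_at_imp_continuous_on) auto
  have [measurable]: "M (max 0 z) \<in> borel_measurable P"
    by simp
  have "norm (average g z) \<le> expectation (\<lambda>\<omega>. norm (g (M (max 0 z) \<omega>)))"
    unfolding average_def by (rule integral_norm_bound)
  also have "\<dots> \<le> expectation (\<lambda>\<omega>. B)"
    using g order_trans[OF norm_ge_zero g(2)] by (intro integral_mono integrable_const_bound[of _ B]) auto
  finally show ?thesis by (simp add: prob_space)
qed

text \<open>Evaluation of a path at a random time is in general not measurable for the product
  sigma-algebra. A time with values in a countable grid splits it into countably many coordinate
  maps.\<close>

lemma measurable_at_random_grid_point:
  fixes t c d :: real
  assumes "0 \<le> t" "0 \<le> c" "0 \<le> d"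
  shows "(\<lambda>(u, v). u ((real (nat \<lfloor>d * v t\<rfloor>) + c) / d)) \<in>
    borel_measurable (PiM {0..} (\<lambda>_. borel :: real measure) \<Otimes>\<^sub>M PiM {0..} (\<lambda>_. borel :: real measure))"
proof -
  let ?D = "PiM {0..} (\<lambda>_ :: real. borel :: real measure)"
  have "(\<lambda>p. fst p ((real (nat \<lfloor>d * snd p t\<rfloor>) + c) / d)) \<in> borel_measurable (?D \<Otimes>\<^sub>M ?D)"
  proof (rule measurable_compose_countable[where f = "\<lambda>(n :: nat) p. fst p ((real n + c) / d)" and g = "\<lambda>p. nat \<lfloor>d * snd p t\<rfloor>"])
    fix n :: nat
    show "(\<lambda>p. fst p ((real n + c) / d)) \<in> borel_measurable (?D \<Otimes>\<^sub>M ?D)"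
      by (rule measurable_compose[OF measurable_fst measurable_component_singleton]) (use assms in auto)
  next
    have "(\<lambda>p. snd p t) \<in> borel_measurable (?D \<Otimes>\<^sub>M ?D)"
      by (rule measurable_compose[OF measurable_snd measurable_component_singleton]) (use assms in auto)
    then show "(\<lambda>p. nat \<lfloor>d * snd p t\<rfloor>) \<in> measurable (?D \<Otimes>\<^sub>M ?D) (count_space UNIV)"
      by measurable
  qed
  then show ?thesis
    by (simp add: case_prod_beta')
qed

text \<open>Evaluating at the shifted grid points \<open>(\<lfloor>d * H t\<^sub>i\<rfloor> + 1 + i) / d\<close> makes the times countably valued,
  strictly increasing in \<open>i\<close> and convergent to \<open>H t\<^sub>i\<close> from the right.\<close>

lemma expectation_prod_grid:
  fixes g :: "nat \<Rightarrow> real \<Rightarrow> 'b :: {real_normed_field, banach, second_countable_topology}"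
    and d :: nat
  assumes d: "0 < d" and t: "\<And>i. i \<le> n \<Longrightarrow> 0 \<le> t i" "\<And>i. i < n \<Longrightarrow> t i \<le> t (Suc i)"
    and g: "\<And>i x. i < n \<Longrightarrow> isCont (g i) x" "\<And>i x. i < n \<Longrightarrow> norm (g i x) \<le> B"
  defines "k \<equiv> \<lambda>i \<omega>. (real (nat \<lfloor>d * H (t i) \<omega>\<rfloor>) + (1 + real i)) / d"
  shows "expectation (\<lambda>\<omega>. \<Prod>i<n. g i (M (k (Suc i) \<omega>) \<omega> - M (k i \<omega>) \<omega>))
      = expectation (\<lambda>\<omega>. \<Prod>i<n. average (g i) (k (Suc i) \<omega> - k i \<omega>))"
    and "i \<le> n \<Longrightarrow> (\<lambda>\<omega>. M (k i \<omega>) \<omega>) \<in> borel_measurable P"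
proof -
  define D where "D = PiM {0..} (\<lambda>_ :: real. borel :: real measure)"
  define a where "a \<omega> = (\<lambda>s\<in>{0..}. M s \<omega>)" for \<omega>
  define b where "b \<omega> = (\<lambda>s\<in>{0..}. H s \<omega>)" for \<omega>
  define \<kappa> where "\<kappa> i v = (real (nat \<lfloor>d * v (t i)\<rfloor>) + (1 + real i)) / d" for i and v :: "real \<Rightarrow> real"
  have \<kappa>_nonneg: "0 \<le> \<kappa> i v" for i v
    by (simp add: \<kappa>_def)
  have a_meas [measurable]: "a \<in> measurable P D" and b_meas [measurable]: "b \<in> measurable P D"
    and distr: "distr P D a \<Otimes>\<^sub>M distr P D b = distr P (D \<Otimes>\<^sub>M D) (\<lambda>\<omega>. (a \<omega>, b \<omega>))"
    using indep unfolding independent_processes_def indep_var_distribution_eq a_def[abs_def] b_def[abs_def] D_def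
    by auto
  have u\<kappa>: "(\<lambda>(u, v). u (\<kappa> i v)) \<in> borel_measurable (D \<Otimes>\<^sub>M D)" if "i \<le> n" for i
    unfolding D_def \<kappa>_def by (rule measurable_at_random_grid_point) (use t that in auto)
  have k\<kappa>: "k i \<omega> = \<kappa> i (b \<omega>)" if "i \<le> n" for i \<omega>
    using t that by (simp add: k_def \<kappa>_def b_def)
  have Mk: "M (k i \<omega>) \<omega> = a \<omega> (\<kappa> i (b \<omega>))" if "i \<le> n" for i \<omega>
    using k\<kappa>[OF that] \<kappa>_nonneg by (simp add: a_def)
  show "(\<lambda>\<omega>. M (k i \<omega>) \<omega>) \<in> borel_measurable P" if "i \<le> n" for i
  proof -
    have "(\<lambda>\<omega>. (a \<omega>, b \<omega>)) \<in> measurable P (D \<Otimes>\<^sub>M D)"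
      by measurable
    from measurable_compose[OF this u\<kappa>[OF that]] show ?thesis
      by (simp add: Mk[OF that])
  qed
  have g_meas [measurable]: "g i \<in> borel_measurable borel" if "i < n" for i
    using g that by (intro borel_measurable_continuous_onI continuous_at_imp_continuous_on) auto
  have avg_meas: "average (g i) \<in> borel_measurable borel" if "i < n" for i
    using isCont_average[OF g(1)[OF that] g(2)[OF that]]
    by (intro borel_measurable_continuous_onI continuous_at_imp_continuous_on) auto
  have \<kappa>_meas: "\<kappa> i \<in> borel_measurable D" if "i \<le> n" for i
  proof -
    have "(\<lambda>v. v (t i)) \<in> borel_measurable D"
      unfolding D_def by (rule measurable_component_singleton) (use t that in auto)
    moreover have "(\<lambda>x :: real. (real (nat \<lfloor>real d * x\<rfloor>) + (1 + real i)) / d) \<in> borel_measurable borel"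
      by measurable
    ultimately show ?thesis
      unfolding \<kappa>_def[abs_def] by (rule measurable_compose)
  qed
  have avg\<kappa>_meas: "(\<lambda>v. \<Prod>i<n. average (g i) (\<kappa> (Suc i) v - \<kappa> i v)) \<in> borel_measurable D"
    by (intro borel_measurable_prod measurable_compose[OF borel_measurable_diff avg_meas] \<kappa>_meas) auto
  define f where "f u v = (\<Prod>i<n. g i (u (\<kappa> (Suc i) v) - u (\<kappa> i v)))" for u v :: "real \<Rightarrow> real"
  have f_meas [measurable]: "case_prod f \<in> borel_measurable (D \<Otimes>\<^sub>M D)"
  proof -
    have "(\<lambda>p. \<Prod>i<n. g i (fst p (\<kappa> (Suc i) (snd p)) - fst p (\<kappa> i (snd p)))) \<in> borel_measurable (D \<Otimes>\<^sub>M D)"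
    proof (intro borel_measurable_prod)
      fix i assume i: "i \<in> {..<n}"
      show "(\<lambda>p. g i (fst p (\<kappa> (Suc i) (snd p)) - fst p (\<kappa> i (snd p)))) \<in> borel_measurable (D \<Otimes>\<^sub>M D)"
        using u\<kappa>[of i] u\<kappa>[of "Suc i"] i
        by (intro measurable_compose[OF borel_measurable_diff g_meas]) (auto simp: case_prod_beta')
    qed
    then show ?thesis
      by (simp add: f_def[abs_def] case_prod_beta')
  qed
  have f_bdd: "norm (f u v) \<le> B ^ n" for u v
  proof -
    have "norm (f u v) \<le> (\<Prod>i<n. B)"
      unfolding f_def prod_norm[symmetric] using g by (intro prod_mono) auto
    then show ?thesis by simp
  qed
  interpret a: prob_space "distr P D a" by (rule prob_space_distr) measurable
  interpret b: prob_space "distr P D b" by (rule prob_space_distr) measurable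
  interpret ab: pair_prob_space "distr P D a" "distr P D b" ..
  have "expectation (\<lambda>\<omega>. \<Prod>i<n. g i (M (k (Suc i) \<omega>) \<omega> - M (k i \<omega>) \<omega>)) = expectation (\<lambda>\<omega>. f (a \<omega>) (b \<omega>))"
    by (intro Bochner_Integration.integral_cong refl) (auto simp: f_def Mk)
  also have "\<dots> = integral\<^sup>L (distr P D a \<Otimes>\<^sub>M distr P D b) (case_prod f)"
    unfolding distr by (subst integral_distr) auto
  \<comment> \<open>Independence makes the joint law a product, so \<open>M\<close> is integrated
    first with the path \<open>v\<close> of \<open>H\<close> frozen.\<close>
  also have "\<dots> = (\<integral>v. (\<integral>u. f u v \<partial>distr P D a) \<partial>distr P D b)"
  proof (rule ab.integral_snd[symmetric])
    have "case_prod f \<in> borel_measurable (distr P D a \<Otimes>\<^sub>M distr P D b)"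
      by measurable
    then show "integrable (distr P D a \<Otimes>\<^sub>M distr P D b) (case_prod f)"
      using f_bdd by (intro ab.P.integrable_const_bound[of _ "B ^ n"]) auto
  qed
  also have "\<dots> = (\<integral>v. (\<Prod>i<n. average (g i) (\<kappa> (Suc i) v - \<kappa> i v)) \<partial>distr P D b)"
  proof (rule integral_cong_AE)
    have "AE \<omega> in P. \<forall>i<n. b \<omega> (t i) \<le> b \<omega> (t (Suc i))"
      using AE_H_mono
    proof eventually_elim
      case (elim \<omega>)
      then show ?case
        using t by (auto simp: b_def)
    qed
    \<comment> \<open>Only finitely many coordinates are compared, so this is an event of the
      product sigma-algebra and the almost sure monotonicity passes to the law of
      \<open>H\<close>.\<close>
    moreover have "{v \<in> space D. \<forall>i<n. v (t i) \<le> v (t (Suc i))} \<in> sets D"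
    proof -
      have vt: "(\<lambda>v. v (t i)) \<in> borel_measurable D" if "i \<le> n" for i
        unfolding D_def by (rule measurable_component_singleton) (use t that in auto)
      have "{v \<in> space D. \<forall>i\<in>{..<n}. v (t i) \<le> v (t (Suc i))} \<in> sets D"
        by (intro sets.sets_Collect_finite_All borel_measurable_le vt) auto
      then show ?thesis
        unfolding Ball_def lessThan_iff .
    qed
    ultimately have "AE v in distr P D b. \<forall>i<n. v (t i) \<le> v (t (Suc i))"
      using AE_distr_iff[OF b_meas, of "\<lambda>v. \<forall>i<n. v (t i) \<le> v (t (Suc i))"] by blast
    then show "AE v in distr P D b. (\<integral>u. f u v \<partial>distr P D a) = (\<Prod>i<n. average (g i) (\<kappa> (Suc i) v - \<kappa> i v))"
    proof eventually_elim
      case (elim v)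
      have \<kappa>_less: "\<kappa> i v < \<kappa> (Suc i) v" if "i < n" for i
      proof -
        have "nat \<lfloor>d * v (t i)\<rfloor> \<le> nat \<lfloor>d * v (t (Suc i))\<rfloor>"
          using elim that by (intro nat_mono floor_mono mult_left_mono) auto
        then show ?thesis
          using d by (simp add: \<kappa>_def divide_strict_right_mono)
      qed
      have comp: "(\<lambda>u. u (\<kappa> i v)) \<in> borel_measurable D" for i
        unfolding D_def by (rule measurable_component_singleton) (use \<kappa>_nonneg in auto)
      have "(\<lambda>u. f u v) \<in> borel_measurable D"
        unfolding f_def
        by (intro borel_measurable_prod measurable_compose[OF borel_measurable_diff g_meas] comp) auto
      then have "(\<integral>u. f u v \<partial>distr P D a) = expectation (\<lambda>\<omega>. f (a \<omega>) v)"
        by (intro integral_distr) auto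
      also have "\<dots> = expectation (\<lambda>\<omega>. \<Prod>i<n. g i (M (\<kappa> (Suc i) v) \<omega> - M (\<kappa> i v) \<omega>))"
        using \<kappa>_nonneg by (simp add: f_def a_def)
      also have "\<dots> = (\<Prod>i<n. expectation (\<lambda>\<omega>. g i (M (\<kappa> (Suc i) v - \<kappa> i v) \<omega>)))"
        using \<kappa>_nonneg \<kappa>_less g_meas g by (intro expectation_prod_M_increments) auto
      also have "\<dots> = (\<Prod>i<n. average (g i) (\<kappa> (Suc i) v - \<kappa> i v))"
        using \<kappa>_less by (intro prod.cong refl) (simp add: average_def less_imp_le)
      finally show ?case .
    qed
    show "(\<lambda>v. \<integral>u. f u v \<partial>distr P D a) \<in> borel_measurable (distr P D b)"
      by measurable
    show "(\<lambda>v. \<Prod>i<n. average (g i) (\<kappa> (Suc i) v - \<kappa> i v)) \<in> borel_measurable (distr P D b)"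
      using avg\<kappa>_meas by simp
  qed
  also have "\<dots> = expectation (\<lambda>\<omega>. \<Prod>i<n. average (g i) (\<kappa> (Suc i) (b \<omega>) - \<kappa> i (b \<omega>)))"
    using avg\<kappa>_meas by (intro integral_distr) auto
  also have "\<dots> = expectation (\<lambda>\<omega>. \<Prod>i<n. average (g i) (k (Suc i) \<omega> - k i \<omega>))"
    by (intro Bochner_Integration.integral_cong prod.cong refl) (simp add: k\<kappa>)
  finally show "expectation (\<lambda>\<omega>. \<Prod>i<n. g i (M (k (Suc i) \<omega>) \<omega> - M (k i \<omega>) \<omega>))
      = expectation (\<lambda>\<omega>. \<Prod>i<n. average (g i) (k (Suc i) \<omega> - k i \<omega>))" .
qed

end

context subordinated_levy
begin

text \<open>Limit of the grid identity under dominated convergence: one side uses right-continuity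
  of the paths of \<open>M\<close>, the other continuity of the averages. Several factors serve the
  independence of increments, a single one serves the propagator.\<close>

theorem expectation_prod_subordinated:
  fixes g :: "nat \<Rightarrow> real \<Rightarrow> 'b :: {real_normed_field, banach, second_countable_topology}"
  assumes t: "\<And>i. i \<le> n \<Longrightarrow> 0 \<le> t i" "\<And>i. i < n \<Longrightarrow> t i \<le> t (Suc i)"
    and g: "\<And>i x. i < n \<Longrightarrow> isCont (g i) x" "\<And>i x. i < n \<Longrightarrow> norm (g i x) \<le> B"
  shows "expectation (\<lambda>\<omega>. \<Prod>i<n. g i (MH (t (Suc i)) \<omega> - MH (t i) \<omega>))
      = expectation (\<lambda>\<omega>. \<Prod>i<n. average (g i) (H (t (Suc i)) \<omega> - H (t i) \<omega>))"
proof -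
  define k where "k m i \<omega> = (real (nat \<lfloor>real (Suc m) * H (t i) \<omega>\<rfloor>) + (1 + real i)) / real (Suc m)" for m i \<omega>
  have grid: "expectation (\<lambda>\<omega>. \<Prod>i<n. g i (M (k m (Suc i) \<omega>) \<omega> - M (k m i \<omega>) \<omega>))
      = expectation (\<lambda>\<omega>. \<Prod>i<n. average (g i) (k m (Suc i) \<omega> - k m i \<omega>))" for m
    unfolding k_def by (rule expectation_prod_grid(1)[where B = B]) (use t g in auto)
  have Mk_meas: "(\<lambda>\<omega>. M (k m i \<omega>) \<omega>) \<in> borel_measurable P" if "i \<le> n" for m i
    unfolding k_def by (rule expectation_prod_grid(2)[where g = g and B = B and n = n]) (use t g that in auto)
  have k_meas: "k m i \<in> borel_measurable P" if "i \<le> n" for m i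
  proof -
    have [measurable]: "H (t i) \<in> borel_measurable P"
      using t that by auto
    show ?thesis
      unfolding k_def[abs_def] by measurable
  qed
  have g_meas: "g i \<in> borel_measurable borel" if "i < n" for i
    using g that by (intro borel_measurable_continuous_onI continuous_at_imp_continuous_on) auto
  have avg_cont: "isCont (average (g i)) x" if "i < n" for i x
    by (rule isCont_average[OF g(1)[OF that] g(2)[OF that]])
  have avg_bdd: "norm (average (g i) x) \<le> B" if "i < n" for i x
    by (rule norm_average_le[OF g(1)[OF that] g(2)[OF that]])
  have avg_meas: "average (g i) \<in> borel_measurable borel" if "i < n" for i
    using avg_cont that by (intro borel_measurable_continuous_onI continuous_at_imp_continuous_on) auto
  have prod_bdd: "norm (\<Prod>i<n. f i) \<le> B ^ n" if "\<And>i. i < n \<Longrightarrow> norm (f i) \<le> B" for f :: "nat \<Rightarrow> 'b"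
  proof -
    have "norm (\<Prod>i<n. f i) \<le> (\<Prod>i<n. B)"
      unfolding prod_norm[symmetric] using that by (intro prod_mono) auto
    then show ?thesis by simp
  qed
  \<comment> \<open>Strict approach from above is required because \<open>at_right\<close> excludes
    its base point; the summand 1 in the numerator provides it even when \<open>Suc m * H\<close> is
    an integer.\<close>
  have k_lim: "filterlim (\<lambda>m. k m i \<omega>) (at_right (H (t i) \<omega>)) sequentially" if "0 \<le> H (t i) \<omega>" for i \<omega>
  proof (rule tendsto_imp_filterlim_at_right)
    let ?h = "H (t i) \<omega>"
    have floor: "real (nat \<lfloor>real (Suc m) * ?h\<rfloor>) = of_int \<lfloor>real (Suc m) * ?h\<rfloor>" for m
      using that by simp
    have gt: "?h < k m i \<omega>" for m
    proof -
      have "real (Suc m) * ?h < of_int \<lfloor>real (Suc m) * ?h\<rfloor> + 1"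
        by linarith
      also have "\<dots> \<le> of_int \<lfloor>real (Suc m) * ?h\<rfloor> + (1 + real i)"
        by simp
      finally show ?thesis
        unfolding k_def floor by (simp only: pos_less_divide_eq mult.commute of_nat_0_less_iff zero_less_Suc)
    qed
    then show "\<forall>\<^sub>F m in sequentially. ?h < k m i \<omega>"
      by simp
    have le: "k m i \<omega> \<le> ?h + (1 + real i) / real (Suc m)" for m
    proof -
      have "of_int \<lfloor>real (Suc m) * ?h\<rfloor> \<le> real (Suc m) * ?h"
        by linarith
      then have "k m i \<omega> \<le> (real (Suc m) * ?h + (1 + real i)) / real (Suc m)"
        unfolding k_def floor by (intro divide_right_mono) auto
      also have "\<dots> = ?h + (1 + real i) / real (Suc m)"
        by (simp only: add_divide_distrib) simp
      finally show ?thesis .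
    qed
    show "(\<lambda>m. k m i \<omega>) \<longlonglongrightarrow> ?h"
    proof (rule tendsto_sandwich[of "\<lambda>_. ?h"])
      have "(\<lambda>m. ?h + (1 + real i) / real (Suc m)) \<longlonglongrightarrow> ?h + 0"
        by (intro tendsto_add tendsto_const LIMSEQ_Suc[OF lim_const_over_n])
      then show "(\<lambda>m. ?h + (1 + real i) / real (Suc m)) \<longlonglongrightarrow> ?h"
        by simp
    qed (use gt le in \<open>auto intro!: always_eventually simp: less_imp_le simp del: of_nat_Suc\<close>)
  qed
  have "(\<lambda>m. expectation (\<lambda>\<omega>. \<Prod>i<n. g i (M (k m (Suc i) \<omega>) \<omega> - M (k m i \<omega>) \<omega>)))
      \<longlonglongrightarrow> expectation (\<lambda>\<omega>. \<Prod>i<n. g i (MH (t (Suc i)) \<omega> - MH (t i) \<omega>))"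
  proof (rule integral_dominated_convergence[where w = "\<lambda>_. B ^ n"])
    show "(\<lambda>\<omega>. \<Prod>i<n. g i (MH (t (Suc i)) \<omega> - MH (t i) \<omega>)) \<in> borel_measurable P"
      using t by (intro borel_measurable_prod measurable_compose[OF borel_measurable_diff g_meas]) auto
    show "(\<lambda>\<omega>. \<Prod>i<n. g i (M (k m (Suc i) \<omega>) \<omega> - M (k m i \<omega>) \<omega>)) \<in> borel_measurable P" for m
      by (intro borel_measurable_prod measurable_compose[OF borel_measurable_diff g_meas] Mk_meas) auto
    show "AE \<omega> in P. norm (\<Prod>i<n. g i (M (k m (Suc i) \<omega>) \<omega> - M (k m i \<omega>) \<omega>)) \<le> B ^ n" for m
      by (intro AE_I2 prod_bdd g)
    show "AE \<omega> in P. (\<lambda>m. \<Prod>i<n. g i (M (k m (Suc i) \<omega>) \<omega> - M (k m i \<omega>) \<omega>))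
        \<longlonglongrightarrow> (\<Prod>i<n. g i (MH (t (Suc i)) \<omega> - MH (t i) \<omega>))"
      using AE_H_nonneg AE_M_right_continuous
    proof eventually_elim
      case (elim \<omega>)
      have "(\<lambda>m. M (k m i \<omega>) \<omega>) \<longlonglongrightarrow> MH (t i) \<omega>" if "i \<le> n" for i
        unfolding MH_def using elim t(1)[OF that] by (intro filterlim_compose[OF _ k_lim]) auto
      then show ?case
        by (intro tendsto_prod isCont_tendsto_compose[OF g(1)] tendsto_diff) auto
    qed
  qed simp
  moreover have "(\<lambda>m. expectation (\<lambda>\<omega>. \<Prod>i<n. average (g i) (k m (Suc i) \<omega> - k m i \<omega>)))
      \<longlonglongrightarrow> expectation (\<lambda>\<omega>. \<Prod>i<n. average (g i) (H (t (Suc i)) \<omega> - H (t i) \<omega>))"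
  proof (rule integral_dominated_convergence[where w = "\<lambda>_. B ^ n"])
    show "(\<lambda>\<omega>. \<Prod>i<n. average (g i) (H (t (Suc i)) \<omega> - H (t i) \<omega>)) \<in> borel_measurable P"
      using t by (intro borel_measurable_prod measurable_compose[OF borel_measurable_diff avg_meas]) auto
    show "(\<lambda>\<omega>. \<Prod>i<n. average (g i) (k m (Suc i) \<omega> - k m i \<omega>)) \<in> borel_measurable P" for m
      by (intro borel_measurable_prod measurable_compose[OF borel_measurable_diff avg_meas] k_meas) auto
    show "AE \<omega> in P. norm (\<Prod>i<n. average (g i) (k m (Suc i) \<omega> - k m i \<omega>)) \<le> B ^ n" for m
      by (intro AE_I2 prod_bdd avg_bdd)
    show "AE \<omega> in P. (\<lambda>m. \<Prod>i<n. average (g i) (k m (Suc i) \<omega> - k m i \<omega>))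
        \<longlonglongrightarrow> (\<Prod>i<n. average (g i) (H (t (Suc i)) \<omega> - H (t i) \<omega>))"
      using AE_H_nonneg
    proof eventually_elim
      case (elim \<omega>)
      have "(\<lambda>m. k m i \<omega>) \<longlonglongrightarrow> H (t i) \<omega>" if "i \<le> n" for i
        using elim t(1)[OF that] k_lim[of i \<omega>] by (simp add: filterlim_at)
      then show ?case
        by (intro tendsto_prod isCont_tendsto_compose[OF avg_cont] tendsto_diff) auto
    qed
  qed simp
  ultimately show ?thesis
    unfolding grid by (rule LIMSEQ_unique)
qed

lemma expectation_subordinated_increment:
  fixes g :: "real \<Rightarrow> 'b :: {real_normed_field, banach, second_countable_topology}"
  assumes "0 \<le> s" "s \<le> t" and g: "\<And>x. isCont g x" "\<And>x. norm (g x) \<le> B"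
  shows "expectation (\<lambda>\<omega>. g (MH t \<omega> - MH s \<omega>)) = expectation (\<lambda>\<omega>. average g (H t \<omega> - H s \<omega>))"
  using expectation_prod_subordinated[of 1 "\<lambda>i. if i = 0 then s else t" "\<lambda>_. g" B] assms by simp

text \<open>The subordination identity is applied to the whole product and again to each single
  factor; in between, the product of averages factors by independence of the increments of
  \<open>H\<close>.\<close>

lemma independent_increments_MH: "independent_increments MH"
  unfolding independent_increments_def
proof (intro allI impI)
  fix n :: nat and t :: "nat \<Rightarrow> real"
  assume t0: "0 \<le> t 0" and t: "\<forall>i<n. t i < t (Suc i)"
  have t_nonneg: "0 \<le> t i" if "i \<le> n" for i
    using that
  proof (induction i)
    case (Suc i)
    then have "t i < t (Suc i)"
      using t by simp
    with Suc show ?case by simp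
  qed (use t0 in simp)
  show "indep_vars (\<lambda>_. borel) (\<lambda>i \<omega>. MH (t (Suc i)) \<omega> - MH (t i) \<omega>) {..<n}"
  proof (rule indep_vars_borel_if_expectation_prod)
    show "random_variable borel (\<lambda>\<omega>. MH (t (Suc i)) \<omega> - MH (t i) \<omega>)" if "i < n" for i
      using that t_nonneg[of i] t_nonneg[of "Suc i"] by (intro borel_measurable_diff MH_measurable) auto
    fix g :: "nat \<Rightarrow> real \<Rightarrow> real"
    assume g: "\<And>i x. isCont (g i) x" "\<And>i x. norm (g i x) \<le> 1"
    have avg_meas: "average (g i) \<in> borel_measurable borel" for i
      using isCont_average[OF g] by (intro borel_measurable_continuous_onI continuous_at_imp_continuous_on) auto
    have "expectation (\<lambda>\<omega>. \<Prod>i<n. g i (MH (t (Suc i)) \<omega> - MH (t i) \<omega>))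
        = expectation (\<lambda>\<omega>. \<Prod>i<n. average (g i) (H (t (Suc i)) \<omega> - H (t i) \<omega>))"
      using t_nonneg t g by (intro expectation_prod_subordinated[where B = 1]) (auto intro: less_imp_le)
    also have "\<dots> = (\<Prod>i<n. expectation (\<lambda>\<omega>. average (g i) (H (t (Suc i)) \<omega> - H (t i) \<omega>)))"
    proof (rule expectation_prod_increments)
      show "independent_increments H"
        using subordinator by (simp add: inhomogeneous_subordinator_def additive_process_def)
      show "norm (average (g i) x) \<le> 1" for i x
        using norm_average_le[OF g] .
    qed (use t0 t avg_meas in auto)
    also have "\<dots> = (\<Prod>i<n. expectation (\<lambda>\<omega>. g i (MH (t (Suc i)) \<omega> - MH (t i) \<omega>)))"
    proof (intro prod.cong refl)
      fix i assume "i \<in> {..<n}"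
      then show "expectation (\<lambda>\<omega>. average (g i) (H (t (Suc i)) \<omega> - H (t i) \<omega>)) = expectation (\<lambda>\<omega>. g i (MH (t (Suc i)) \<omega> - MH (t i) \<omega>))"
        using t t_nonneg[of i] g by (intro expectation_subordinated_increment[symmetric, where B = 1]) (auto intro: less_imp_le)
    qed
    finally show "expectation (\<lambda>\<omega>. \<Prod>i<n. g i (MH (t (Suc i)) \<omega> - MH (t i) \<omega>))
        = (\<Prod>i<n. expectation (\<lambda>\<omega>. g i (MH (t (Suc i)) \<omega> - MH (t i) \<omega>)))" .
  qed
qed

text \<open>The function \<open>g\<close> is a continuous majorant of the indicator of
  \<open>\<bar>y\<bar> > \<epsilon>\<close>. Its average is continuous and vanishes at 0, so a small
  increment of \<open>H\<close> forces a small bound. Since \<open>g\<close> is even, the order of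
  \<open>s\<close> and \<open>t\<close> is immaterial.\<close>

lemma stochastically_continuous_MH: "stochastically_continuous MH"
  unfolding stochastically_continuous_def
proof (intro allI impI)
  fix t \<epsilon> :: real assume t: "0 \<le> t" and \<epsilon>: "0 < \<epsilon>"
  define g where "g y = min 1 (\<bar>y\<bar> / \<epsilon>)" for y :: real
  have g: "isCont g x" "norm (g x) \<le> 1" for x
    using \<epsilon> unfolding g_def by (auto intro!: continuous_intros)
  have avg: "isCont (average g) x" "\<bar>average g x\<bar> \<le> 1" for x
    using isCont_average[OF g] norm_average_le[OF g] by auto
  have [measurable]: "g \<in> borel_measurable borel" "average g \<in> borel_measurable borel"
    using g avg by (auto intro!: borel_measurable_continuous_onI continuous_at_imp_continuous_on)
  have avg0: "average g 0 = 0"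
  proof -
    have "average g 0 = expectation (\<lambda>\<omega>. 0)"
      unfolding average_def using AE_M_0 by (intro integral_cong_AE) (auto simp: g_def elim!: eventually_mono)
    then show ?thesis by simp
  qed
  have bound: "prob {\<omega> \<in> space P. \<bar>MH s \<omega> - MH t \<omega>\<bar> > \<epsilon>} \<le> expectation (\<lambda>\<omega>. average g \<bar>H s \<omega> - H t \<omega>\<bar>)" if s: "0 \<le> s" for s
  proof -
    have [measurable]: "MH s \<in> borel_measurable P" "MH t \<in> borel_measurable P" "H s \<in> borel_measurable P" "H t \<in> borel_measurable P"
      "H (max s t) \<in> borel_measurable P" "H (min s t) \<in> borel_measurable P"
      using s t by (auto simp: max_def min_def)
    let ?A = "{\<omega> \<in> space P. \<bar>MH s \<omega> - MH t \<omega>\<bar> > \<epsilon>}"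
    have "prob ?A = expectation (indicat_real ?A)"
      by (simp add: Int_absorb2)
    also have "\<dots> \<le> expectation (\<lambda>\<omega>. g (MH s \<omega> - MH t \<omega>))"
    proof (rule integral_mono)
      show "integrable P (indicat_real ?A)"
        by (intro integrable_real_indicator) (auto simp: emeasure_eq_measure)
      show "integrable P (\<lambda>\<omega>. g (MH s \<omega> - MH t \<omega>))"
        using g by (intro integrable_const_bound[of _ 1]) auto
      show "indicat_real ?A \<omega> \<le> g (MH s \<omega> - MH t \<omega>)" for \<omega>
        using \<epsilon> by (auto simp: g_def indicator_def)
    qed
    also have "\<dots> = expectation (\<lambda>\<omega>. g (MH (max s t) \<omega> - MH (min s t) \<omega>))"
      by (cases "s \<le> t") (simp_all add: g_def abs_minus_commute)
    also have "\<dots> = expectation (\<lambda>\<omega>. average g (H (max s t) \<omega> - H (min s t) \<omega>))"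
      using s t g by (intro expectation_subordinated_increment[where B = 1]) auto
    also have "\<dots> = expectation (\<lambda>\<omega>. average g \<bar>H s \<omega> - H t \<omega>\<bar>)"
    proof (rule integral_cong_AE)
      show "AE \<omega> in P. average g (H (max s t) \<omega> - H (min s t) \<omega>) = average g \<bar>H s \<omega> - H t \<omega>\<bar>"
        using AE_H_mono
      proof eventually_elim
        case (elim \<omega>)
        then have "H (min s t) \<omega> \<le> H (max s t) \<omega>"
          using s t by auto
        then show ?case
          by (auto simp: max_def min_def abs_if split: if_splits)
      qed
    qed measurable
    finally show ?thesis .
  qed
  show "((\<lambda>s. prob {\<omega> \<in> space P. \<bar>MH s \<omega> - MH t \<omega>\<bar> > \<epsilon>}) \<longlongrightarrow> 0) (at t within {0..})"
  proof (rule tendstoI)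
    fix e :: real assume e: "0 < e"
    have "\<exists>\<delta>>0. \<forall>z. \<bar>z\<bar> < \<delta> \<longrightarrow> \<bar>average g z\<bar> < e / 2"
      using avg(1)[of 0, unfolded continuous_at_eps_delta, rule_format, of "e / 2"] e avg0
      by (simp add: dist_real_def)
    then obtain \<delta> where \<delta>: "0 < \<delta>" "\<And>z. \<bar>z\<bar> < \<delta> \<Longrightarrow> \<bar>average g z\<bar> < e / 2"
      by blast
    \<comment> \<open>Half of \<delta>, so that the complementary event, a non-strict inequality,
      stays strictly inside the \<delta>-neighbourhood of 0.\<close>
    have "((\<lambda>s. prob {\<omega> \<in> space P. \<bar>H s \<omega> - H t \<omega>\<bar> > \<delta> / 2}) \<longlongrightarrow> 0) (at t within {0..})"
    proof -
      have "stochastically_continuous H"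
        using subordinator by (simp add: inhomogeneous_subordinator_def additive_process_def)
      moreover have "0 < \<delta> / 2"
        using \<delta> by simp
      ultimately show ?thesis
        using t unfolding stochastically_continuous_def by blast
    qed
    then have "\<forall>\<^sub>F s in at t within {0..}. prob {\<omega> \<in> space P. \<bar>H s \<omega> - H t \<omega>\<bar> > \<delta> / 2} < e / 2"
      using e by (intro order_tendstoD) auto
    moreover have "\<forall>\<^sub>F s in at t within {0..}. s \<in> {0..}"
      by (auto simp: eventually_at_filter)
    ultimately show "\<forall>\<^sub>F s in at t within {0..}. dist (prob {\<omega> \<in> space P. \<bar>MH s \<omega> - MH t \<omega>\<bar> > \<epsilon>}) 0 < e"
    proof eventually_elim
      case (elim s)
      have [measurable]: "H s \<in> borel_measurable P" "H t \<in> borel_measurable P"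
        using elim t by auto
      let ?A = "{\<omega> \<in> space P. \<bar>H s \<omega> - H t \<omega>\<bar> > \<delta> / 2}"
      have intA: "integrable P (indicat_real ?A)"
        by (intro integrable_real_indicator) (auto simp: emeasure_eq_measure)
      have "prob {\<omega> \<in> space P. \<bar>MH s \<omega> - MH t \<omega>\<bar> > \<epsilon>} \<le> expectation (\<lambda>\<omega>. average g \<bar>H s \<omega> - H t \<omega>\<bar>)"
        using bound elim by simp
      also have "\<dots> \<le> expectation (\<lambda>\<omega>. e / 2 + indicat_real ?A \<omega>)"
      proof (rule integral_mono)
        show "integrable P (\<lambda>\<omega>. average g \<bar>H s \<omega> - H t \<omega>\<bar>)"
          using avg by (intro integrable_const_bound[of _ 1]) auto
        show "integrable P (\<lambda>\<omega>. e / 2 + indicat_real ?A \<omega>)"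
          using intA by simp
        fix \<omega> assume "\<omega> \<in> space P"
        define z where "z = \<bar>H s \<omega> - H t \<omega>\<bar>"
        have "average g z \<le> e / 2 + (if z > \<delta> / 2 then 1 else 0)"
          using \<delta>(1) \<delta>(2)[of z] avg(2)[of z] e by (auto simp: z_def)
        then show "average g \<bar>H s \<omega> - H t \<omega>\<bar> \<le> e / 2 + indicat_real ?A \<omega>"
          using \<open>\<omega> \<in> space P\<close> by (auto simp: z_def indicator_def split: if_splits)
      qed
      also have "\<dots> = e / 2 + prob ?A"
        using intA by (simp add: prob_space Int_absorb2)
      finally show ?case
        using elim by simp
    qed
  qed
qed

lemma additive_process_MH: "additive_process MH"
proof -
  have "AE \<omega> in P. MH 0 \<omega> = 0"
    using AE_H_0 AE_M_0 by eventually_elim (simp add: MH_def)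
  then show ?thesis
    using independent_increments_MH stochastically_continuous_MH by (simp add: additive_process_def)
qed

end

subsection \<open>The generator\<close>

lemma integrable_one_minus_exp_levy_measure:
  assumes "subordinator_levy_measure N"
  shows "integrable N (\<lambda>z. 1 - exp (- max 0 z))"
proof (rule integrableI_bounded)
  have sets [measurable_cong]: "sets N = sets borel"
    using assms by (simp add: subordinator_levy_measure_def)
  show "(\<lambda>z. 1 - exp (- max 0 z)) \<in> borel_measurable N"
    by measurable
  have "(\<integral>\<^sup>+z. ennreal (norm (1 - exp (- max 0 z))) \<partial>N) \<le> (\<integral>\<^sup>+z. ennreal (min 1 z) \<partial>N)"
  proof (rule nn_integral_mono)
    fix z
    show "ennreal (norm (1 - exp (- max 0 z))) \<le> ennreal (min 1 z)"
      using one_minus_exp_le_min_one[of z] by (cases "0 \<le> z") (auto intro: ennreal_leI)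
  qed
  also have "\<dots> < \<infinity>"
    using assms by (simp add: subordinator_levy_measure_def)
  finally show "(\<integral>\<^sup>+z. ennreal (norm (1 - exp (- max 0 z))) \<partial>N) < \<infinity>" .
qed

lemma tilting_levy_measure:
  assumes "subordinator_levy_measure N"
  shows "tilting N 1 (\<lambda>z. max 0 z)"
proof
  have sets [measurable_cong]: "sets N = sets borel"
    using assms by (simp add: subordinator_levy_measure_def)
  show "(\<lambda>z. max 0 z) \<in> borel_measurable N"
    by measurable
qed (use integrable_one_minus_exp_levy_measure[OF assms] in auto)

context subordinated_levy
begin

text \<open>Conditioning on \<open>H\<close> makes the difference quotient of the propagator equal
  to \<open>1 / \<epsilon>\<close> times the expectation of \<open>q x\<close> at the increment of
  \<open>H\<close>. The family \<open>q\<close> is bounded by \<open>norm_average_le\<close>, and it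
  is Lipschitz and of order \<open>z\<close> by \<open>semigroup_Lipschitz\<close>, as
  \<open>uniform_limit_integral_of_Laplace\<close> demands.\<close>

lemma generator_MH:
  assumes t: "0 \<le> t" and N: "subordinator_levy_measure N" and h: "h \<in> schwartz"
    and Laplace: "\<And>k :: nat. ((\<lambda>\<epsilon>. expectation (\<lambda>\<omega>. 1 - exp (- real k * (H (t + \<epsilon>) \<omega> - H t \<omega>))) / \<epsilon>) \<longlongrightarrow>
      (LINT z:{0<..}|N. 1 - exp (- z * real k))) (at_right 0)"
  shows "set_integrable N {0<..} (\<lambda>z. semigroup_of M z h x - h x)"
    and "has_generator_at MH t h (\<lambda>x. LINT z:{0<..}|N. (semigroup_of M z h x - h x))"
proof -
  have sets [measurable_cong]: "sets N = sets borel"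
    using N by (simp add: subordinator_levy_measure_def)
  obtain h1 h2 B where h': "\<And>x. (h has_vector_derivative h1 x) (at x)" and B: "\<And>x. norm (h x) \<le> B"
    using schwartz_derivativesE[OF h] by metis
  have h_isCont: "isCont h y" for y
    by (rule has_vector_derivative_continuous[OF h'])
  have h_cont: "isCont (\<lambda>y. h (x + y)) y" for x y
    using h_isCont by (intro isCont_o2[of _ "\<lambda>y. x + y" h] continuous_intros) auto
  have hx_bdd: "norm (h (x + y)) \<le> B" for x y
    by (rule B)
  obtain C where C: "0 \<le> C"
    "\<And>x w z. 0 \<le> w \<Longrightarrow> 0 \<le> z \<Longrightarrow> norm (semigroup_of M (w + z) h x - semigroup_of M w h x) \<le> C * z"
    using semigroup_Lipschitz[OF h] by blast
  define q where "q x z = average (\<lambda>y. h (x + y)) z - h x" for x z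
  have q_eq: "q x z = semigroup_of M z h x - h x" if "0 \<le> z" for x z
    using that by (simp add: q_def average_def semigroup_of_def)
  have q_meas [measurable]: "q x \<in> borel_measurable borel" for x
  proof -
    have "average (\<lambda>y. h (x + y)) \<in> borel_measurable borel"
      using isCont_average[OF h_cont hx_bdd]
      by (intro borel_measurable_continuous_onI continuous_at_imp_continuous_on) auto
    then show ?thesis
      unfolding q_def[abs_def] by measurable
  qed
  have q_bdd: "norm (q x z) \<le> 2 * B" for x z
    using norm_triangle_le_diff[OF add_mono[OF norm_average_le[OF h_cont hx_bdd, of x z] B[of x]]]
    by (simp add: q_def)
  have q_lip: "norm (q x z - q x w) \<le> C * \<bar>z - w\<bar>" if "0 \<le> z" "0 \<le> w" for x z w
  proof -
    have *: "norm (q x z - q x w) \<le> C * (z - w)" if "0 \<le> w" "w \<le> z" for z w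
      using C(2)[of w "z - w" x] that by (simp add: q_eq)
    show ?thesis
      using *[of z w] *[of w z] that by (cases "w \<le> z") (auto simp: norm_minus_commute abs_if)
  qed
  have M0: "semigroup_of M 0 h x = h x" for x
  proof -
    have [measurable]: "M 0 \<in> borel_measurable P" "h \<in> borel_measurable borel"
      using h_isCont by (auto intro!: borel_measurable_continuous_onI continuous_at_imp_continuous_on)
    have "semigroup_of M 0 h x = expectation (\<lambda>\<omega>. h x)"
      unfolding semigroup_of_def using AE_M_0 by (intro integral_cong_AE) (auto elim: eventually_mono)
    then show ?thesis by (simp add: prob_space)
  qed
  have q0: "q x 0 = 0" for x
    by (simp add: q_eq M0)
  \<comment> \<open>Bounds \<open>C * z\<close> near 0 and \<open>2 * B\<close> far away combine to
    \<open>(C + 2 * B) * min 1 z\<close>; the factor 2 passes to the weight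
    \<open>1 - exp (- z)\<close>.\<close>
  define A where "A = 2 * (C + 2 * B)"
  have B0: "0 \<le> B"
    using order_trans[OF norm_ge_zero B[of 0]] .
  have q_lin: "norm (q x z) \<le> A * (1 - exp (- z))" if z: "0 \<le> z" for x z
  proof -
    have "norm (q x z) \<le> C * z"
      using q_lip[of z 0 x] z by (simp add: q0)
    then have "norm (q x z) \<le> (C + 2 * B) * min 1 z"
      using q_bdd[of x z] C(1) B0 z by (auto simp: min_def distrib_right intro: order_trans)
    also have "\<dots> \<le> (C + 2 * B) * (2 * (1 - exp (- z)))"
      using C(1) B0 z by (intro mult_left_mono min_one_le_one_minus_exp) auto
    also have "\<dots> = A * (1 - exp (- z))"
      by (simp only: A_def mult_ac)
    finally show ?thesis .
  qed
  interpret T0: tilting N 1 "\<lambda>z. max 0 z"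
    by (rule tilting_levy_measure[OF N])
  \<comment> \<open>Since \<open>q x 0 = 0\<close>, clipping at 0 absorbs the restriction to the
    positive half-line.\<close>
  have ind: "indicator {0<..} z *\<^sub>R (semigroup_of M z h x - h x) = q x (max 0 z)" for x z
    by (auto simp: indicator_def q_eq M0 max_def)
  show "set_integrable N {0<..} (\<lambda>z. semigroup_of M z h x - h x)"
    unfolding set_integrable_def ind by (rule T0.integrable_weighted[OF q_meas q_lin])
  \<comment> \<open>Both the time step and the increment are clipped, and
    \<open>1 / \<bar>\<epsilon>\<bar>\<close> is used below, so that the tilting locale holds for
    every real \<epsilon>; only \<epsilon> > 0 matters for the limit.\<close>
  define Z where "Z \<epsilon> \<omega> = max 0 (H (t + max 0 \<epsilon>) \<omega> - H t \<omega>)" for \<epsilon> \<omega>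
  have Z_meas [measurable]: "Z \<epsilon> \<in> borel_measurable P" for \<epsilon>
  proof -
    have [measurable]: "H (t + max 0 \<epsilon>) \<in> borel_measurable P" "H t \<in> borel_measurable P"
      using t by auto
    show ?thesis
      unfolding Z_def[abs_def] by measurable
  qed
  have tilting_Z: "tilting P (1 / \<bar>\<epsilon>\<bar>) (Z \<epsilon>)" for \<epsilon>
  proof
    have Z_nonneg: "0 \<le> Z \<epsilon> \<omega>" for \<omega>
      by (simp add: Z_def)
    show "0 \<le> Z \<epsilon> \<omega>" for \<omega>
      by (rule Z_nonneg)
    have "norm (1 - exp (- Z \<epsilon> \<omega>)) \<le> 1" for \<omega>
      using Z_nonneg[of \<omega>] by simp
    then show "integrable P (\<lambda>\<omega>. 1 - exp (- Z \<epsilon> \<omega>))"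
      by (intro integrable_const_bound[of _ 1] AE_I2) measurable
  qed auto
  have AE_Z: "AE \<omega> in P. Z \<epsilon> \<omega> = H (t + \<epsilon>) \<omega> - H t \<omega>" if "0 < \<epsilon>" for \<epsilon>
    using AE_H_mono
  proof eventually_elim
    case (elim \<omega>)
    then have "H t \<omega> \<le> H (t + \<epsilon>) \<omega>"
      using t that by simp
    with that show ?case
      by (simp add: Z_def)
  qed
  have "uniform_limit UNIV (\<lambda>\<epsilon> x. (1 / \<bar>\<epsilon>\<bar>) *\<^sub>R expectation (\<lambda>\<omega>. q x (Z \<epsilon> \<omega>))) (\<lambda>x. \<integral>z. q x (max 0 z) \<partial>N) (at_right 0)"
  proof (rule uniform_limit_integral_of_Laplace[OF tilting_Z tilting_levy_measure[OF N] _ q_meas q_bdd q_lip q_lin])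
    fix k :: nat
    have lim_eq: "(LINT z:{0<..}|N. 1 - exp (- z * real k)) = (\<integral>z. 1 - exp (- (real k * max 0 z)) \<partial>N)"
      unfolding set_lebesgue_integral_def
      by (intro Bochner_Integration.integral_cong refl) (auto simp: indicator_def max_def mult.commute)
    have "\<forall>\<^sub>F \<epsilon> in at_right (0::real). expectation (\<lambda>\<omega>. 1 - exp (- real k * (H (t + \<epsilon>) \<omega> - H t \<omega>))) / \<epsilon> =
        1 / \<bar>\<epsilon>\<bar> * expectation (\<lambda>\<omega>. 1 - exp (- (real k * Z \<epsilon> \<omega>)))"
      using eventually_at_right_less[of "0::real"]
    proof eventually_elim
      case (elim \<epsilon>)
      have [measurable]: "H (t + \<epsilon>) \<in> borel_measurable P" "H t \<in> borel_measurable P"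
        using t elim by auto
      have "expectation (\<lambda>\<omega>. 1 - exp (- real k * (H (t + \<epsilon>) \<omega> - H t \<omega>))) = expectation (\<lambda>\<omega>. 1 - exp (- (real k * Z \<epsilon> \<omega>)))"
      proof (rule integral_cong_AE)
        show "AE \<omega> in P. 1 - exp (- real k * (H (t + \<epsilon>) \<omega> - H t \<omega>)) = 1 - exp (- (real k * Z \<epsilon> \<omega>))"
          using AE_Z[OF elim] by eventually_elim simp
      qed measurable
      then show ?case
        using elim by simp
    qed
    from Lim_transform_eventually[OF Laplace[of k] this]
    show "((\<lambda>\<epsilon>. 1 / \<bar>\<epsilon>\<bar> * expectation (\<lambda>\<omega>. 1 - exp (- (real k * Z \<epsilon> \<omega>)))) \<longlongrightarrow> (\<integral>z. 1 - exp (- (real k * max 0 z)) \<partial>N)) (at_right 0)"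
      unfolding lim_eq .
  qed
  moreover have "\<forall>\<^sub>F \<epsilon> in at_right 0. \<forall>x\<in>UNIV. (1 / \<bar>\<epsilon>\<bar>) *\<^sub>R expectation (\<lambda>\<omega>. q x (Z \<epsilon> \<omega>)) = (propagator MH t (t + \<epsilon>) h x - h x) /\<^sub>R \<epsilon>"
    using eventually_at_right_less[of "0::real"]
  proof eventually_elim
    case (elim \<epsilon>)
    show ?case
    proof
      fix x
      have [measurable]: "H (t + \<epsilon>) \<in> borel_measurable P" "H t \<in> borel_measurable P"
        using t elim by auto
      let ?avg = "average (\<lambda>y. h (x + y))"
      have avg_meas [measurable]: "?avg \<in> borel_measurable borel"
        using isCont_average[OF h_cont hx_bdd]
        by (intro borel_measurable_continuous_onI continuous_at_imp_continuous_on) auto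
      have "propagator MH t (t + \<epsilon>) h x = expectation (\<lambda>\<omega>. h (x + (MH (t + \<epsilon>) \<omega> - MH t \<omega>)))"
        by (simp add: propagator_def add_diff_eq)
      also have "\<dots> = expectation (\<lambda>\<omega>. ?avg (H (t + \<epsilon>) \<omega> - H t \<omega>))"
        using t elim by (intro expectation_subordinated_increment[OF _ _ h_cont hx_bdd]) auto
      also have "\<dots> = expectation (\<lambda>\<omega>. ?avg (Z \<epsilon> \<omega>))"
      proof (rule integral_cong_AE)
        show "AE \<omega> in P. ?avg (H (t + \<epsilon>) \<omega> - H t \<omega>) = ?avg (Z \<epsilon> \<omega>)"
          using AE_Z[OF elim] by eventually_elim simp
      qed measurable
      finally have "propagator MH t (t + \<epsilon>) h x - h x = expectation (\<lambda>\<omega>. ?avg (Z \<epsilon> \<omega>)) - h x"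
        by simp
      also have "\<dots> = expectation (\<lambda>\<omega>. q x (Z \<epsilon> \<omega>))"
      proof -
        have "integrable P (\<lambda>\<omega>. ?avg (Z \<epsilon> \<omega>))"
          using norm_average_le[OF h_cont hx_bdd] by (intro integrable_const_bound[of _ B]) auto
        then show ?thesis
          by (simp add: q_def prob_space)
      qed
      finally show "(1 / \<bar>\<epsilon>\<bar>) *\<^sub>R expectation (\<lambda>\<omega>. q x (Z \<epsilon> \<omega>)) = (propagator MH t (t + \<epsilon>) h x - h x) /\<^sub>R \<epsilon>"
        using elim by (simp add: inverse_eq_divide)
    qed
  qed
  ultimately have "uniform_limit UNIV (\<lambda>\<epsilon> x. (propagator MH t (t + \<epsilon>) h x - h x) /\<^sub>R \<epsilon>) (\<lambda>x. \<integral>z. q x (max 0 z) \<partial>N) (at_right 0)"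
    by (rule uniform_limit_cong[THEN iffD1, rotated 2]) auto
  then show "has_generator_at MH t h (\<lambda>x. LINT z:{0<..}|N. (semigroup_of M z h x - h x))"
    unfolding has_generator_at_def set_lebesgue_integral_def ind .
qed

end

section \<open>Right derivatives of the integrated Laplace exponents\<close>

lemma tendsto_average_if_right_continuous:
  fixes g :: "real \<Rightarrow> real"
  assumes g: "continuous (at_right t) g" and int: "\<And>s. t \<le> s \<Longrightarrow> set_integrable lborel {t..s} g"
  shows "((\<lambda>e. (LINT \<tau>:{t..t+e}|lborel. g \<tau>) / e) \<longlongrightarrow> g t) (at_right 0)"
proof (rule tendstoI)
  fix r :: real assume r: "0 < r"
  have "(g \<longlongrightarrow> g t) (at_right t)"
    using g by (simp add: continuous_within)
  then have "\<forall>\<^sub>F s in at_right t. dist (g s) (g t) < r / 2"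
    using r by (intro tendstoD) auto
  then obtain d where d: "t < d" "\<And>s. t < s \<Longrightarrow> s < d \<Longrightarrow> dist (g s) (g t) < r / 2"
    by (auto simp: eventually_at_right_field)
  show "\<forall>\<^sub>F e in at_right 0. dist ((LINT \<tau>:{t..t+e}|lborel. g \<tau>) / e) (g t) < r"
    unfolding eventually_at_right_field
  proof (intro exI conjI allI impI)
    show "0 < d - t" using d by simp
    fix e assume e: "0 < e" "e < d - t"
    have const: "set_integrable lborel {t..t+e} (\<lambda>_. c)" for c :: real
      unfolding set_integrable_def by (intro integrable_scaleR_left integrable_real_indicator) (use e in auto)
    have const_int: "(LINT \<tau>:{t..t+e}|lborel. c) = c * e" for c :: real
      using e by (simp add: set_integral_const)
    have close: "\<bar>g \<tau> - g t\<bar> \<le> r / 2" if "\<tau> \<in> {t..t+e}" for \<tau>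
      using d(2)[of \<tau>] that e r by (cases "\<tau> = t") (auto simp: dist_real_def)
    have bounds: "g \<tau> \<le> g t + r / 2" "g t - r / 2 \<le> g \<tau>" if "\<tau> \<in> {t..t+e}" for \<tau>
      using close[OF that] by linarith+
    have int_e: "set_integrable lborel {t..t+e} g"
      using e by (intro int) simp
    have "(LINT \<tau>:{t..t+e}|lborel. g \<tau>) \<le> (LINT \<tau>:{t..t+e}|lborel. g t + r / 2)"
      and "(LINT \<tau>:{t..t+e}|lborel. g t - r / 2) \<le> (LINT \<tau>:{t..t+e}|lborel. g \<tau>)"
      by (rule set_integral_mono[OF int_e const bounds(1)] set_integral_mono[OF const int_e bounds(2)]; assumption)+
    then have "(LINT \<tau>:{t..t+e}|lborel. g \<tau>) / e \<le> g t + r / 2" "g t - r / 2 \<le> (LINT \<tau>:{t..t+e}|lborel. g \<tau>) / e"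
      unfolding const_int using e by (simp_all add: divide_le_eq le_divide_eq)
    then show "dist ((LINT \<tau>:{t..t+e}|lborel. g \<tau>) / e) (g t) < r"
      using r by (simp add: dist_real_def abs_less_iff)
  qed
qed

text \<open>The differentiation theorem asks for integrability on the whole line, so it is applied
  to the truncations to \<open>[0, n]\<close>; at a given \<open>t < n\<close> truncation does not
  affect short averages.\<close>

lemma AE_tendsto_average_if_locally_integrable:
  fixes g :: "real \<Rightarrow> real"
  assumes int: "\<And>s t. 0 \<le> s \<Longrightarrow> s \<le> t \<Longrightarrow> set_integrable lborel {s..t} g"
  shows "AE t in lborel. 0 \<le> t \<longrightarrow> ((\<lambda>e. (LINT \<tau>:{t..t+e}|lborel. g \<tau>) / e) \<longlongrightarrow> g t) (at_right 0)"
proof -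
  define G where "G n \<tau> = indicator {0..real n} \<tau> *\<^sub>R g \<tau>" for n :: nat and \<tau>
  have "integrable lborel (G n)" for n
    using int[of 0 "real n"] by (simp add: G_def[abs_def] set_integrable_def)
  then have "AE t in lborel. ((\<lambda>e. (LINT \<tau>:{t..t+e}|lborel. G n \<tau>) / e) \<longlongrightarrow> G n t) (at_right 0)" for n
    by (rule AE_tendsto_right_average)
  then have "AE t in lborel. \<forall>n. ((\<lambda>e. (LINT \<tau>:{t..t+e}|lborel. G n \<tau>) / e) \<longlongrightarrow> G n t) (at_right 0)"
    by (simp add: AE_all_countable)
  then show ?thesis
  proof (eventually_elim, intro impI)
    fix t :: real
    assume lim: "\<forall>n. ((\<lambda>e. (LINT \<tau>:{t..t+e}|lborel. G n \<tau>) / e) \<longlongrightarrow> G n t) (at_right 0)" and t: "0 \<le> t"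
    obtain n :: nat where n: "t < n"
      using reals_Archimedean2 by blast
    have "\<forall>\<^sub>F e in at_right 0. (LINT \<tau>:{t..t+e}|lborel. G n \<tau>) / e = (LINT \<tau>:{t..t+e}|lborel. g \<tau>) / e"
      unfolding eventually_at_right_field
    proof (intro exI conjI allI impI)
      show "0 < real n - t" using n by simp
      fix e assume "0 < e" "e < real n - t"
      then have "(LINT \<tau>:{t..t+e}|lborel. G n \<tau>) = (LINT \<tau>:{t..t+e}|lborel. g \<tau>)"
        using t by (intro set_lebesgue_integral_cong) (auto simp: G_def)
      then show "(LINT \<tau>:{t..t+e}|lborel. G n \<tau>) / e = (LINT \<tau>:{t..t+e}|lborel. g \<tau>) / e"
        by simp
    qed
    from Lim_transform_eventually[OF lim[rule_format] this]
    show "((\<lambda>e. (LINT \<tau>:{t..t+e}|lborel. g \<tau>) / e) \<longlongrightarrow> g t) (at_right 0)"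
      using t n by (simp add: G_def)
  qed
qed

lemma tendsto_one_minus_exp_average:
  fixes I :: "real \<Rightarrow> real"
  assumes "((\<lambda>e. I e / e) \<longlongrightarrow> l) (at_right 0)"
  shows "((\<lambda>e. (1 - exp (- I e)) / e) \<longlongrightarrow> l) (at_right 0)"
proof -
  have lim: "((\<lambda>e. I e / e * e) \<longlongrightarrow> l * 0) (at_right 0)"
    by (intro tendsto_mult assms tendsto_ident_at)
  have "\<forall>\<^sub>F e in at_right 0. I e / e * e = I e"
    by (auto simp: eventually_at_filter)
  from Lim_transform_eventually[OF lim this] have I0: "(I \<longlongrightarrow> 0) (at_right 0)"
    by simp
  \<comment> \<open>Fills the removable singularity of \<open>(1 - exp (- u)) / u\<close>, so that
    the factorisation is valid also where \<open>I e = 0\<close>.\<close>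
  define \<phi> where "\<phi> u = (if u = 0 then 1 else (1 - exp (- u)) / u)" for u :: real
  have "((\<lambda>u :: real. (exp (- u) - 1) / u) \<longlongrightarrow> - 1) (at 0)"
  proof -
    have "((\<lambda>u :: real. exp (- u)) has_real_derivative - 1) (at 0)"
      by (auto intro!: derivative_eq_intros)
    then show ?thesis
      by (simp add: has_field_derivative_iff)
  qed
  then have "((\<lambda>u :: real. - ((exp (- u) - 1) / u)) \<longlongrightarrow> 1) (at 0)"
    using tendsto_minus by fastforce
  then have "(\<phi> \<longlongrightarrow> 1) (at 0)"
    by (rule Lim_transform_eventually) (auto simp: \<phi>_def eventually_at_filter minus_divide_left)
  then have "isCont \<phi> 0"
    by (simp add: isCont_def \<phi>_def)
  then have "((\<lambda>e. \<phi> (I e)) \<longlongrightarrow> \<phi> 0) (at_right 0)"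
    using I0 by (rule isCont_tendsto_compose)
  then have "((\<lambda>e. \<phi> (I e) * (I e / e)) \<longlongrightarrow> \<phi> 0 * l) (at_right 0)"
    by (intro tendsto_mult assms)
  moreover have "(\<lambda>e. \<phi> (I e) * (I e / e)) = (\<lambda>e. (1 - exp (- I e)) / e)"
    by (auto simp: \<phi>_def)
  moreover have "\<phi> 0 = 1"
    by (simp add: \<phi>_def)
  ultimately show ?thesis
    by simp
qed

text \<open>\<open>laplace_H\<close> fixes each \<open>f p\<close> only up to a null set of times:
  altering \<open>\<nu>\<close> at a single time changes the proposed generator but not
  \<open>H\<close>. Hence the two forms, at every time where all \<open>f p\<close> are
  right-continuous and at almost every time in general. The integrability clause excludes the
  default value 0 of an undefined integral. Measurability of \<open>MH\<close> is assumed because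
  paths are cadlag only almost surely and \<open>P\<close> may be incomplete.\<close>

theorem lemma3:
  fixes P :: "'a measure"
    and M H :: "real \<Rightarrow> 'a \<Rightarrow> real"
    and \<eta> :: "real \<Rightarrow> complex"
    and \<nu> :: "real \<Rightarrow> real measure"
    and f :: "real \<Rightarrow> real \<Rightarrow> real"
  defines "T \<equiv> prob_space.semigroup_of P M"
    and "MH \<equiv> (\<lambda>t \<omega>. M (H t \<omega>) \<omega>)"
  assumes P: "prob_space P"
    and M: "prob_space.levy_process P M"
    and char_M: "\<And>t \<xi>. 0 \<le> t \<Longrightarrow>
      (\<integral>\<omega>. exp (\<i> * of_real (\<xi> * M t \<omega>)) \<partial>P) = exp (of_real t * \<eta> \<xi>)"
    and H: "prob_space.inhomogeneous_subordinator P H"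
    and indep: "prob_space.independent_processes P M H"
    and MH_measurable: "\<And>t. 0 \<le> t \<Longrightarrow> MH t \<in> borel_measurable P"
    and \<nu>: "\<And>\<tau>. 0 \<le> \<tau> \<Longrightarrow> subordinator_levy_measure (\<nu> \<tau>)"
    and f: "\<And>p \<tau>. 0 \<le> p \<Longrightarrow> 0 \<le> \<tau> \<Longrightarrow> f p \<tau> = (LINT z:{0<..}|\<nu> \<tau>. 1 - exp (- z * p))"
    and f_integrable: "\<And>p s t. 0 \<le> p \<Longrightarrow> 0 \<le> s \<Longrightarrow> s \<le> t \<Longrightarrow> set_integrable lborel {s..t} (f p)"
    and laplace_H: "\<And>p s t. 0 \<le> p \<Longrightarrow> 0 \<le> s \<Longrightarrow> s \<le> t \<Longrightarrow>
      (\<integral>\<omega>. exp (- p * (H t \<omega> - H s \<omega>)) \<partial>P) = exp (- (LINT \<tau>:{s..t}|lborel. f p \<tau>))"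
  shows "prob_space.additive_process P MH \<and>
    (\<forall>t\<ge>0. (\<forall>p\<ge>0. continuous (at_right t) (f p)) \<longrightarrow>
      (\<forall>h\<in>schwartz.
        (\<forall>x. set_integrable (\<nu> t) {0<..} (\<lambda>z. T z h x - h x)) \<and>
        prob_space.has_generator_at P MH t h
          (\<lambda>x. LINT z:{0<..}|\<nu> t. (T z h x - h x)))) \<and>
    (AE t in lborel. 0 \<le> t \<longrightarrow>
      (\<forall>h\<in>schwartz.
        (\<forall>x. set_integrable (\<nu> t) {0<..} (\<lambda>z. T z h x - h x)) \<and>
        prob_space.has_generator_at P MH t h
          (\<lambda>x. LINT z:{0<..}|\<nu> t. (T z h x - h x))))"
proof -
  interpret prob_space P by (rule P)
  interpret S: subordinated_levy P M \<eta> H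
    using M char_M H indep MH_measurable
    by unfold_locales (auto simp: MH_def simp del: of_real_mult)
  have MH_eq: "MH = S.MH"
    by (simp add: MH_def S.MH_def fun_eq_iff)
  have generator: "(\<forall>x. set_integrable (\<nu> t) {0<..} (\<lambda>z. T z h x - h x)) \<and>
      has_generator_at MH t h (\<lambda>x. LINT z:{0<..}|\<nu> t. (T z h x - h x))"
    if t: "0 \<le> t" and h: "h \<in> schwartz"
      and avg: "\<And>k :: nat. ((\<lambda>e. (LINT \<tau>:{t..t+e}|lborel. f (real k) \<tau>) / e) \<longlongrightarrow> f (real k) t) (at_right 0)" for t h
  proof -
    have "((\<lambda>\<epsilon>. expectation (\<lambda>\<omega>. 1 - exp (- real k * (H (t + \<epsilon>) \<omega> - H t \<omega>))) / \<epsilon>) \<longlongrightarrow>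
        (LINT z:{0<..}|\<nu> t. 1 - exp (- z * real k))) (at_right 0)" for k :: nat
    proof -
      have "((\<lambda>e. (1 - exp (- (LINT \<tau>:{t..t+e}|lborel. f (real k) \<tau>))) / e) \<longlongrightarrow> f (real k) t) (at_right 0)"
        by (rule tendsto_one_minus_exp_average[OF avg])
      moreover have "\<forall>\<^sub>F e in at_right 0. (1 - exp (- (LINT \<tau>:{t..t+e}|lborel. f (real k) \<tau>))) / e
          = expectation (\<lambda>\<omega>. 1 - exp (- real k * (H (t + e) \<omega> - H t \<omega>))) / e"
        using eventually_at_right_less[of "0::real"]
      proof eventually_elim
        case (elim e)
        have [measurable]: "H (t + e) \<in> borel_measurable P" "H t \<in> borel_measurable P"
          using t elim by auto
        have "integrable P (\<lambda>\<omega>. exp (- real k * (H (t + e) \<omega> - H t \<omega>)))"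
        proof (rule integrable_const_bound[of _ 1])
          show "AE \<omega> in P. norm (exp (- real k * (H (t + e) \<omega> - H t \<omega>))) \<le> 1"
            using S.AE_H_mono
          proof eventually_elim
            case (elim \<omega>)
            then have "H t \<omega> \<le> H (t + e) \<omega>"
              using t \<open>0 < e\<close> by simp
            then show ?case by simp
          qed
        qed measurable
        then have "expectation (\<lambda>\<omega>. 1 - exp (- real k * (H (t + e) \<omega> - H t \<omega>)))
            = 1 - expectation (\<lambda>\<omega>. exp (- real k * (H (t + e) \<omega> - H t \<omega>)))"
          by (subst Bochner_Integration.integral_diff) (auto simp: prob_space)
        then show ?case
          using laplace_H[of "real k" t "t + e"] t elim by simp
      qed
      ultimately have "((\<lambda>\<epsilon>. expectation (\<lambda>\<omega>. 1 - exp (- real k * (H (t + \<epsilon>) \<omega> - H t \<omega>))) / \<epsilon>) \<longlongrightarrow> f (real k) t) (at_right 0)"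
        by (rule Lim_transform_eventually)
      then show ?thesis
        using f[of "real k" t] t by simp
    qed
    from S.generator_MH[OF t \<nu>[OF t] h this] show ?thesis
      unfolding T_def MH_eq by blast
  qed
  \<comment> \<open>The exceptional null set is a union over the integers \<open>k\<close> alone,
    hence common to all \<open>h\<close> and \<open>x\<close>.\<close>
  have "AE t in lborel. \<forall>k :: nat. 0 \<le> t \<longrightarrow>
      ((\<lambda>e. (LINT \<tau>:{t..t+e}|lborel. f (real k) \<tau>) / e) \<longlongrightarrow> f (real k) t) (at_right 0)"
    unfolding AE_all_countable
    by (intro allI AE_tendsto_average_if_locally_integrable f_integrable) auto
  then have "AE t in lborel. 0 \<le> t \<longrightarrow>
      (\<forall>h\<in>schwartz.
        (\<forall>x. set_integrable (\<nu> t) {0<..} (\<lambda>z. T z h x - h x)) \<and>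
        has_generator_at MH t h (\<lambda>x. LINT z:{0<..}|\<nu> t. (T z h x - h x)))"
    by eventually_elim (use generator in blast)
  moreover have "additive_process MH"
    unfolding MH_eq by (rule S.additive_process_MH)
  moreover have "(\<forall>x. set_integrable (\<nu> t) {0<..} (\<lambda>z. T z h x - h x)) \<and>
      has_generator_at MH t h (\<lambda>x. LINT z:{0<..}|\<nu> t. (T z h x - h x))"
    if "0 \<le> t" "\<forall>p\<ge>0. continuous (at_right t) (f p)" "h \<in> schwartz" for t h
    using that by (intro generator tendsto_average_if_right_continuous f_integrable) auto
  ultimately show ?thesis
    by blast
qed

end
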